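(* Let $G=(V,E)$ be a graph with $|V|=N$ and $|E|=M$, with start node $s$, end node $t\ne s$, at least one $s$-$t$ path, nominal edge costs $\hat c_e\ge0$ and weights $d_e>0$, $e\in E$. The variable-sized robust shortest path problem on $G$ with the generalized Manhattan norm, i.e. with $B=\{c\in\mathbb{R}^E:\sum_{e\in E}|c_e|/d_e\le1\}$, can be solved in time $O(M^2+NM\log(N))$, and the resulting set satisfies $|\mathcal{S}|\le M$.
   Context: Let $\mathcal{P}$ be the set of all paths from $s$ to $t$ and, for $P\in\mathcal{P}$ and costs $c\in\mathbb{R}^E$, let $c(P)=\sum_{e\in P}c_e$. For $\lambda\ge0$ let $\mathcal{U}_\lambda=\{\hat c\}+\lambda B$ and consider $\mathsf{P}(\lambda)$: $\min_{P\in\mathcal{P}}\max_{c\in\mathcal{U}_\lambda}c(P)$ (its objective equals $\hat c(P)+\lambda\max_{e\in P}d_e$). Solving the variable-sized robust shortest path problem means computing a set $\mathcal{S}\subset\mathcal{P}$ of smallest possible size such that for every $\lambda\ge0$, $\mathcal{S}$ contains an optimal solution of $\mathsf{P}(\lambda)$. *)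

theory Defs
  imports Complex_Main "Graph_Theory.Arc_Walk"
begin

section \<open>Variable-sized robust shortest paths\<close>

text \<open>
  The same record type carries directed and undirected graphs. For an undirected graph the
  arcs are the edges and (tail, head) is an arbitrary ordering of the two endpoints. A simple path
  uses each edge at most once, so it is a simple directed path under some choice of orientations.
  Paths are lists of edges.
\<close>

definition reorientations :: "('v, 'e) pre_digraph \<Rightarrow> ('v, 'e) pre_digraph set" where
  "reorientations G = {H. verts H = verts G \<and> arcs H = arcs G \<and>
     (\<forall>e\<in>arcs G. (tail H e = tail G e \<and> head H e = head G e) \<or>
                 (tail H e = head G e \<and> head H e = tail G e))}"

definition st_paths :: "bool \<Rightarrow> ('v, 'e) pre_digraph \<Rightarrow> 'v \<Rightarrow> 'v \<Rightarrow> 'e list set" where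
  "st_paths directed G s t =
     (if directed then {P. pre_digraph.apath G s P t}
      else {P. \<exists>H\<in>reorientations G. pre_digraph.apath H s P t})"

definition path_cost :: "('e \<Rightarrow> real) \<Rightarrow> 'e list \<Rightarrow> real" where
  "path_cost c P = (\<Sum>e\<in>set P. c e)"

text \<open>
  Elements of $R^E$ are functions on the edge type; only their values on the edge set matter.
\<close>

definition manhattan_ball :: "'e set \<Rightarrow> ('e \<Rightarrow> real) \<Rightarrow> ('e \<Rightarrow> real) set" where
  "manhattan_ball E d = {c. (\<Sum>e\<in>E. \<bar>c e\<bar> / d e) \<le> 1}"

definition uncertainty_set ::
    "('e \<Rightarrow> real) set \<Rightarrow> ('e \<Rightarrow> real) \<Rightarrow> real \<Rightarrow> ('e \<Rightarrow> real) set" where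
  "uncertainty_set B chat l = {\<lambda>e. chat e + l * b e |b. b \<in> B}"

text \<open>
  For the norm balls used here and paths inside the edge set, the supremum is a maximum.
\<close>

definition robust_cost ::
    "('e \<Rightarrow> real) set \<Rightarrow> ('e \<Rightarrow> real) \<Rightarrow> real \<Rightarrow> 'e list \<Rightarrow> real" where
  "robust_cost B chat l P = (SUP c\<in>uncertainty_set B chat l. path_cost c P)"

definition robust_optimal ::
    "'e list set \<Rightarrow> ('e \<Rightarrow> real) set \<Rightarrow> ('e \<Rightarrow> real) \<Rightarrow> real \<Rightarrow> 'e list \<Rightarrow> bool" where
  "robust_optimal \<P> B chat l P \<longleftrightarrow> is_arg_min (robust_cost B chat l) (\<lambda>Q. Q \<in> \<P>) P"

definition covers_all_sizes ::
    "'e list set \<Rightarrow> ('e \<Rightarrow> real) set \<Rightarrow> ('e \<Rightarrow> real) \<Rightarrow> 'e list set \<Rightarrow> bool" where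
  "covers_all_sizes \<P> B chat S \<longleftrightarrow>
     S \<subseteq> \<P> \<and> (\<forall>l\<ge>0. \<exists>P\<in>S. robust_optimal \<P> B chat l P)"

definition solves_variable_sized ::
    "'e list set \<Rightarrow> ('e \<Rightarrow> real) set \<Rightarrow> ('e \<Rightarrow> real) \<Rightarrow> 'e list set \<Rightarrow> bool" where
  "solves_variable_sized \<P> B chat S \<longleftrightarrow>
     is_arg_min card (covers_all_sizes \<P> B chat) S"


section \<open>A structured real RAM\<close>

text \<open>
  Algorithms are programs of a real random access machine with while-programs as control
  structure. Memory consists of natural-number and real scalars and arrays, each referred to
  by a name; a program mentions finitely many names. Natural numbers serve as indices and
  have no multiplication, division or bit operations, and there is neither rounding of reals nor a
  conversion between the two sorts, so unit cost cannot be exploited by packing data into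
  large numbers. Subtraction of naturals is truncated, and real division by 0 yields 0.
\<close>

type_synonym name = string

record store =
  nat_var :: "name \<Rightarrow> nat"
  nat_arr :: "name \<Rightarrow> nat \<Rightarrow> nat"
  real_var :: "name \<Rightarrow> real"
  real_arr :: "name \<Rightarrow> nat \<Rightarrow> real"

datatype nexp =
    NConst nat
  | NVar name
  | NArr name nexp
  | NAdd nexp nexp
  | NSub nexp nexp

datatype rexp =
    RConst int
  | RVar name
  | RArr name nexp
  | RAdd rexp rexp
  | RSub rexp rexp
  | RMul rexp rexp
  | RDiv rexp rexp

datatype test =
    NLess nexp nexp
  | RLess rexp rexp
  | TNot test
  | TAnd test test

datatype prog =
    Skip
  | SetNVar name nexp
  | SetNArr name nexp nexp
  | SetRVar name rexp
  | SetRArr name nexp rexp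
  | Seq prog prog
  | Cond test prog prog
  | Loop test prog

primrec nval :: "nexp \<Rightarrow> store \<Rightarrow> nat" where
  "nval (NConst k) \<sigma> = k"
| "nval (NVar x) \<sigma> = nat_var \<sigma> x"
| "nval (NArr a i) \<sigma> = nat_arr \<sigma> a (nval i \<sigma>)"
| "nval (NAdd x y) \<sigma> = nval x \<sigma> + nval y \<sigma>"
| "nval (NSub x y) \<sigma> = nval x \<sigma> - nval y \<sigma>"

primrec rval :: "rexp \<Rightarrow> store \<Rightarrow> real" where
  "rval (RConst k) \<sigma> = of_int k"
| "rval (RVar x) \<sigma> = real_var \<sigma> x"
| "rval (RArr a i) \<sigma> = real_arr \<sigma> a (nval i \<sigma>)"
| "rval (RAdd x y) \<sigma> = rval x \<sigma> + rval y \<sigma>"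
| "rval (RSub x y) \<sigma> = rval x \<sigma> - rval y \<sigma>"
| "rval (RMul x y) \<sigma> = rval x \<sigma> * rval y \<sigma>"
| "rval (RDiv x y) \<sigma> = rval x \<sigma> / rval y \<sigma>"

primrec tval :: "test \<Rightarrow> store \<Rightarrow> bool" where
  "tval (NLess x y) \<sigma> \<longleftrightarrow> nval x \<sigma> < nval y \<sigma>"
| "tval (RLess x y) \<sigma> \<longleftrightarrow> rval x \<sigma> < rval y \<sigma>"
| "tval (TNot b) \<sigma> \<longleftrightarrow> \<not> tval b \<sigma>"
| "tval (TAnd a b) \<sigma> \<longleftrightarrow> tval a \<sigma> \<and> tval b \<sigma>"

text \<open>
  In \<open>exec p \<sigma> T \<sigma>'\<close>, \<open>T\<close> is the running time. Every elementary command and every evaluation of a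
  test counts 1. Expressions have a size fixed by the program, so charging their individual
  operations changes running times only by a constant factor depending on the program.
\<close>

inductive exec :: "prog \<Rightarrow> store \<Rightarrow> nat \<Rightarrow> store \<Rightarrow> bool" where
  Skip: "exec Skip \<sigma> 1 \<sigma>"
| SetNVar: "exec (SetNVar x e) \<sigma> 1 (\<sigma>\<lparr>nat_var := (nat_var \<sigma>)(x := nval e \<sigma>)\<rparr>)"
| SetNArr: "exec (SetNArr a i e) \<sigma> 1
    (\<sigma>\<lparr>nat_arr := (nat_arr \<sigma>)(a := (nat_arr \<sigma> a)(nval i \<sigma> := nval e \<sigma>))\<rparr>)"
| SetRVar: "exec (SetRVar x r) \<sigma> 1 (\<sigma>\<lparr>real_var := (real_var \<sigma>)(x := rval r \<sigma>)\<rparr>)"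
| SetRArr: "exec (SetRArr a i r) \<sigma> 1
    (\<sigma>\<lparr>real_arr := (real_arr \<sigma>)(a := (real_arr \<sigma> a)(nval i \<sigma> := rval r \<sigma>))\<rparr>)"
| Seq: "exec p \<sigma> T1 \<sigma>' \<Longrightarrow> exec q \<sigma>' T2 \<sigma>'' \<Longrightarrow> exec (Seq p q) \<sigma> (T1 + T2) \<sigma>''"
| CondTrue: "tval b \<sigma> \<Longrightarrow> exec p \<sigma> T \<sigma>' \<Longrightarrow> exec (Cond b p q) \<sigma> (1 + T) \<sigma>'"
| CondFalse: "\<not> tval b \<sigma> \<Longrightarrow> exec q \<sigma> T \<sigma>' \<Longrightarrow> exec (Cond b p q) \<sigma> (1 + T) \<sigma>'"
| LoopFalse: "\<not> tval b \<sigma> \<Longrightarrow> exec (Loop b p) \<sigma> 1 \<sigma>"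
| LoopTrue: "tval b \<sigma> \<Longrightarrow> exec p \<sigma> T1 \<sigma>' \<Longrightarrow> exec (Loop b p) \<sigma>' T2 \<sigma>'' \<Longrightarrow>
    exec (Loop b p) \<sigma> (1 + T1 + T2) \<sigma>''"

inductive_cases SkipE: "exec Skip \<sigma> T \<sigma>'"
  and SetNVarE: "exec (SetNVar x e) \<sigma> T \<sigma>'"
  and SetNArrE: "exec (SetNArr a i e) \<sigma> T \<sigma>'"
  and SetRVarE: "exec (SetRVar x r) \<sigma> T \<sigma>'"
  and SetRArrE: "exec (SetRArr a i r) \<sigma> T \<sigma>'"
  and SeqE: "exec (Seq p q) \<sigma> T \<sigma>'"
  and CondE: "exec (Cond b p q) \<sigma> T \<sigma>'"
  and LoopE: "exec (Loop b p) \<sigma> T \<sigma>'"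

lemma exec_deterministic:
  "exec p \<sigma> T \<sigma>' \<Longrightarrow> exec p \<sigma> U \<tau> \<Longrightarrow> T = U \<and> \<sigma>' = \<tau>"
proof (induction arbitrary: U \<tau> rule: exec.induct)
  case (Skip \<sigma>)
  then show ?case by (rule SkipE) simp
next
  case (SetNVar x e \<sigma>)
  then show ?case by (rule SetNVarE) simp
next
  case (SetNArr a i e \<sigma>)
  then show ?case by (rule SetNArrE) simp
next
  case (SetRVar x r \<sigma>)
  then show ?case by (rule SetRVarE) simp
next
  case (SetRArr a i r \<sigma>)
  then show ?case by (rule SetRArrE) simp
next
  case (Seq p \<sigma> T1 \<sigma>' q T2 \<sigma>'')
  from Seq.prems show ?case by (rule SeqE) (metis Seq.IH)
next
  case (CondTrue b \<sigma> p T \<sigma>' q)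
  from CondTrue.prems show ?case by (rule CondE) (metis CondTrue.IH CondTrue.hyps(1) plus_1_eq_Suc)+
next
  case (CondFalse b \<sigma> q T \<sigma>' p)
  from CondFalse.prems show ?case by (rule CondE) (metis CondFalse.IH CondFalse.hyps(1) plus_1_eq_Suc)+
next
  case (LoopFalse b \<sigma> p)
  from LoopFalse.prems show ?case by (rule LoopE) (metis LoopFalse.hyps One_nat_def)+
next
  case (LoopTrue b \<sigma> p T1 \<sigma>' T2 \<sigma>'')
  from LoopTrue.prems show ?case by (rule LoopE) (metis LoopTrue.IH LoopTrue.hyps(1) plus_1_eq_Suc add_Suc)+
qed


section \<open>Input and output\<close>

text \<open>
  Nodes are numbered 0, ..., N - 1 and edges 0, ..., M - 1. The input is the plain list of edges with
  their endpoints, costs and weights; all other memory is 0.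
\<close>

definition input_store ::
    "(nat, nat) pre_digraph \<Rightarrow> nat \<Rightarrow> nat \<Rightarrow> (nat \<Rightarrow> real) \<Rightarrow> (nat \<Rightarrow> real) \<Rightarrow> store" where
  "input_store G s t chat d =
     \<lparr> nat_var = (\<lambda>_. 0)(''N'' := card (verts G), ''M'' := card (arcs G), ''s'' := s, ''t'' := t),
       nat_arr = (\<lambda>_ _. 0)(''tail'' := (\<lambda>e. if e \<in> arcs G then tail G e else 0),
                           ''head'' := (\<lambda>e. if e \<in> arcs G then head G e else 0)),
       real_var = (\<lambda>_. 0),
       real_arr = (\<lambda>_ _. 0)(''chat'' := (\<lambda>e. if e \<in> arcs G then chat e else 0),
                            ''d'' := (\<lambda>e. if e \<in> arcs G then d e else 0)) \<rparr>"

text \<open>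
  The output lists, for \<open>i\<close> below the value of \<open>k\<close>, the edges of the \<open>i\<close>-th path
  in the segment of \<open>out\<close> between \<open>start[i]\<close> and \<open>start[i+1]\<close>.
\<close>

definition output_path :: "store \<Rightarrow> nat \<Rightarrow> nat list" where
  "output_path \<sigma> i =
     map (nat_arr \<sigma> ''out'') [nat_arr \<sigma> ''start'' i ..< nat_arr \<sigma> ''start'' (Suc i)]"

definition output_set :: "store \<Rightarrow> nat list set" where
  "output_set \<sigma> = output_path \<sigma> ` {..<nat_var \<sigma> ''k''}"

end

theory Submission
  imports Defs
begin

text \<open>
  A path \<open>P\<close> contributes the line \<open>\<lambda> \<mapsto> chat(P) + \<lambda> max d(P)\<close>, and a smallest solution set consists of one
  path per linear piece of the lower envelope of these lines on \<open>[0, \<infinity>)\<close>. The envelope is found in rounds: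
  compute a shortest path among the edges with \<open>d e < T\<close>, push its line onto a stack after dropping the
  lines that it makes redundant, and lower \<open>T\<close> to the maximal \<open>d\<close> on the path. Each round discards
  an edge, so there are at most \<open>M + 1\<close> rounds.

  A round costs \<open>O(M + N log N)\<close> by Dijkstra's algorithm with a Fibonacci heap. The heap invariant
  says that at most \<open>n\<close> children of a node have degree plus mark below \<open>n\<close>. Hence a node of degree
  \<open>j + 3\<close> has two children of degree at least \<open>j\<close>, so the number of nodes of degree at least
  \<open>3 j\<close> halves with every step of \<open>j\<close>, and degrees are logarithmic.
\<close>

section \<open>Weakest preconditions with a clock\<close>

text \<open>Why lowering the threshold loses nothing: let \<open>m\<close> be the maximal weight on
  the path found at threshold \<open>T\<close>. A path with maximum in \<open>[m, T)\<close> was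
  admissible in that search, so neither its cost nor its slope is smaller, and its line lies on or
  above the new one for every size. Slopes strictly decrease from round to round, so lines reach the
  stack in sorted order. The time bound leaves no room for a logarithm per arc: a binary heap would
  give \<open>M^2 log N\<close> over all rounds, hence the Fibonacci heap with its constant
  amortised cost of decreasing a key. It departs from the textbook where this shortens the argument:
  there is no pointer to the minimum, a decreased node that has a parent is always cut, and a
  consolidation pass links every tree at most once. Amortisation needs the time spent inside
  invariants. Postconditions therefore receive the absolute clock \<tau>, and bounds on
  \<open>\<tau> + 60 * pot\<close> are ordinary clauses of an invariant. The existential in
  \<open>wp\<close> asserts termination as well; since execution is deterministic, it also speaks
  about the only run.\<close>

definition wp :: "prog \<Rightarrow> (store \<Rightarrow> nat \<Rightarrow> bool) \<Rightarrow> store \<Rightarrow> nat \<Rightarrow> bool" where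
  "wp p Q \<s> \<tau> \<longleftrightarrow> (\<exists>T \<s>'. exec p \<s> T \<s>' \<and> Q \<s>' (\<tau> + T))"

lemma wp_Skip [simp]: "wp Skip Q \<s> \<tau> \<longleftrightarrow> Q \<s> (Suc \<tau>)"
  unfolding wp_def by (metis exec.Skip SkipE Suc_eq_plus1)

lemma wp_SetNVar [simp]:
  "wp (SetNVar x e) Q \<s> \<tau> \<longleftrightarrow> Q (\<s>\<lparr>nat_var := (nat_var \<s>)(x := nval e \<s>)\<rparr>) (Suc \<tau>)"
  unfolding wp_def by (metis SetNVar SetNVarE Suc_eq_plus1)

lemma wp_SetNArr [simp]:
  "wp (SetNArr a i e) Q \<s> \<tau> \<longleftrightarrow>
     Q (\<s>\<lparr>nat_arr := (nat_arr \<s>)(a := (nat_arr \<s> a)(nval i \<s> := nval e \<s>))\<rparr>) (Suc \<tau>)"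
  unfolding wp_def by (metis SetNArr SetNArrE Suc_eq_plus1)

lemma wp_SetRVar [simp]:
  "wp (SetRVar x e) Q \<s> \<tau> \<longleftrightarrow> Q (\<s>\<lparr>real_var := (real_var \<s>)(x := rval e \<s>)\<rparr>) (Suc \<tau>)"
  unfolding wp_def by (metis SetRVar SetRVarE Suc_eq_plus1)

lemma wp_SetRArr [simp]:
  "wp (SetRArr a i e) Q \<s> \<tau> \<longleftrightarrow>
     Q (\<s>\<lparr>real_arr := (real_arr \<s>)(a := (real_arr \<s> a)(nval i \<s> := rval e \<s>))\<rparr>) (Suc \<tau>)"
  unfolding wp_def by (metis SetRArr SetRArrE Suc_eq_plus1)

lemma wp_Seq [simp]: "wp (Seq p q) Q \<s> \<tau> \<longleftrightarrow> wp p (wp q Q) \<s> \<tau>"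
proof
  assume "wp (Seq p q) Q \<s> \<tau>"
  then obtain T \<s>' where "exec (Seq p q) \<s> T \<s>'" "Q \<s>' (\<tau> + T)" unfolding wp_def by blast
  then show "wp p (wp q Q) \<s> \<tau>" unfolding wp_def by (elim SeqE) (auto simp: add.assoc)
next
  assume "wp p (wp q Q) \<s> \<tau>"
  then obtain T1 \<s>1 T2 \<s>2 where "exec p \<s> T1 \<s>1" "exec q \<s>1 T2 \<s>2" "Q \<s>2 (\<tau> + T1 + T2)"
    unfolding wp_def by blast
  then show "wp (Seq p q) Q \<s> \<tau>" unfolding wp_def using exec.Seq by (metis add.assoc)
qed

lemma wp_Cond [simp]:
  "wp (Cond b p q) Q \<s> \<tau> \<longleftrightarrow>
     (tval b \<s> \<longrightarrow> wp p Q \<s> (Suc \<tau>)) \<and> (\<not> tval b \<s> \<longrightarrow> wp q Q \<s> (Suc \<tau>))"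
proof
  assume "wp (Cond b p q) Q \<s> \<tau>"
  then obtain T \<s>' where "exec (Cond b p q) \<s> T \<s>'" "Q \<s>' (\<tau> + T)" unfolding wp_def by blast
  then show "(tval b \<s> \<longrightarrow> wp p Q \<s> (Suc \<tau>)) \<and> (\<not> tval b \<s> \<longrightarrow> wp q Q \<s> (Suc \<tau>))"
    unfolding wp_def by (elim CondE) auto
next
  assume *: "(tval b \<s> \<longrightarrow> wp p Q \<s> (Suc \<tau>)) \<and> (\<not> tval b \<s> \<longrightarrow> wp q Q \<s> (Suc \<tau>))"
  define r where "r = (if tval b \<s> then p else q)"
  have "wp r Q \<s> (Suc \<tau>)" using * by (simp add: r_def)
  then obtain T \<s>' where T: "exec r \<s> T \<s>'" "Q \<s>' (Suc \<tau> + T)" unfolding wp_def by blast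
  have "exec (Cond b p q) \<s> (1 + T) \<s>'"
    using T(1) CondTrue[of b \<s> p T \<s>' q] CondFalse[of b \<s> q T \<s>' p]
    by (cases "tval b \<s>") (simp_all add: r_def)
  then show "wp (Cond b p q) Q \<s> \<tau>" unfolding wp_def using T(2) by fastforce
qed

lemma wp_mono: "wp p Q \<s> \<tau> \<Longrightarrow> (\<And>\<s>' \<tau>'. Q \<s>' \<tau>' \<Longrightarrow> R \<s>' \<tau>') \<Longrightarrow> wp p R \<s> \<tau>"
  unfolding wp_def by blast

text \<open>Every iteration advances the clock, so an invariant that bounds the clock forces termination.\<close>

lemma wp_Loop:
  assumes init: "I \<s> \<tau>"
    and bound: "\<And>\<s> \<tau>. I \<s> \<tau> \<Longrightarrow> \<tau> \<le> K"
    and step: "\<And>\<s> \<tau>. I \<s> \<tau> \<Longrightarrow> tval b \<s> \<Longrightarrow> wp p I \<s> (Suc \<tau>)"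
    and final: "\<And>\<s> \<tau>. I \<s> \<tau> \<Longrightarrow> \<not> tval b \<s> \<Longrightarrow> Q \<s> (Suc \<tau>)"
  shows "wp (Loop b p) Q \<s> \<tau>"
  using init
proof (induction "K - \<tau>" arbitrary: \<s> \<tau> rule: less_induct)
  case less
  show ?case
  proof (cases "tval b \<s>")
    case False
    then have "exec (Loop b p) \<s> 1 \<s>" by (rule LoopFalse)
    then show ?thesis using final[OF less.prems False] unfolding wp_def by (metis Suc_eq_plus1)
  next
    case True
    then obtain T \<s>' where T: "exec p \<s> T \<s>'" "I \<s>' (Suc \<tau> + T)"
      using step[OF less.prems] unfolding wp_def by blast
    have "K - (Suc \<tau> + T) < K - \<tau>" using bound[OF T(2)] by simp
    then obtain U \<s>'' where "exec (Loop b p) \<s>' U \<s>''" "Q \<s>'' (Suc \<tau> + T + U)"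
      using less.hyps T(2) unfolding wp_def by blast
    then show ?thesis using LoopTrue[OF True T(1)] unfolding wp_def
      by (metis (no_types, lifting) add.assoc add_Suc_shift plus_1_eq_Suc)
  qed
qed

section \<open>Frame rule: the names that a program can write\<close>

primrec nvars :: "prog \<Rightarrow> name set" where
  "nvars Skip = {}"
| "nvars (SetNVar x e) = {x}"
| "nvars (SetNArr a i e) = {}"
| "nvars (SetRVar x r) = {}"
| "nvars (SetRArr a i r) = {}"
| "nvars (Seq p q) = nvars p \<union> nvars q"
| "nvars (Cond b p q) = nvars p \<union> nvars q"
| "nvars (Loop b p) = nvars p"

primrec narrs :: "prog \<Rightarrow> name set" where
  "narrs Skip = {}"
| "narrs (SetNVar x e) = {}"
| "narrs (SetNArr a i e) = {a}"
| "narrs (SetRVar x r) = {}"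
| "narrs (SetRArr a i r) = {}"
| "narrs (Seq p q) = narrs p \<union> narrs q"
| "narrs (Cond b p q) = narrs p \<union> narrs q"
| "narrs (Loop b p) = narrs p"

primrec rvars :: "prog \<Rightarrow> name set" where
  "rvars Skip = {}"
| "rvars (SetNVar x e) = {}"
| "rvars (SetNArr a i e) = {}"
| "rvars (SetRVar x r) = {x}"
| "rvars (SetRArr a i r) = {}"
| "rvars (Seq p q) = rvars p \<union> rvars q"
| "rvars (Cond b p q) = rvars p \<union> rvars q"
| "rvars (Loop b p) = rvars p"

primrec rarrs :: "prog \<Rightarrow> name set" where
  "rarrs Skip = {}"
| "rarrs (SetNVar x e) = {}"
| "rarrs (SetNArr a i e) = {}"
| "rarrs (SetRVar x r) = {}"
| "rarrs (SetRArr a i r) = {a}"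
| "rarrs (Seq p q) = rarrs p \<union> rarrs q"
| "rarrs (Cond b p q) = rarrs p \<union> rarrs q"
| "rarrs (Loop b p) = rarrs p"

text \<open>An array counts as changed as a whole once one entry may be written, so the four sets
  consist of names and the simplifier can compute them from the program text.\<close>

definition unchanged :: "prog \<Rightarrow> store \<Rightarrow> store \<Rightarrow> bool" where
  "unchanged p \<s> \<s>' \<longleftrightarrow>
     (\<forall>x. x \<notin> nvars p \<longrightarrow> nat_var \<s>' x = nat_var \<s> x) \<and>
     (\<forall>x. x \<notin> narrs p \<longrightarrow> nat_arr \<s>' x = nat_arr \<s> x) \<and>
     (\<forall>x. x \<notin> rvars p \<longrightarrow> real_var \<s>' x = real_var \<s> x) \<and>
     (\<forall>x. x \<notin> rarrs p \<longrightarrow> real_arr \<s>' x = real_arr \<s> x)"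

lemma exec_unchanged: "exec p \<s> T \<s>' \<Longrightarrow> unchanged p \<s> \<s>'"
  by (induction rule: exec.induct) (simp_all add: unchanged_def)

text \<open>Lets specifications mention only what a program changes; the rest of the store is
  recovered from its syntax.\<close>

lemma wp_frame:
  assumes "wp p Q \<s> \<tau>" "\<And>\<s>' \<tau>'. Q \<s>' \<tau>' \<Longrightarrow> unchanged p \<s> \<s>' \<Longrightarrow> R \<s>' \<tau>'"
  shows "wp p R \<s> \<tau>"
  using assms exec_unchanged unfolding wp_def by blast

fun seq :: "prog list \<Rightarrow> prog" where
  "seq [] = Skip"
| "seq [p] = p"
| "seq (p # q # ps) = Seq p (seq (q # ps))"

lemma unchangedD:
  assumes "unchanged p \<s> \<s>'"
  shows "x \<notin> nvars p \<Longrightarrow> nat_var \<s>' x = nat_var \<s> x"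
    and "x \<notin> narrs p \<Longrightarrow> nat_arr \<s>' x = nat_arr \<s> x"
    and "x \<notin> rvars p \<Longrightarrow> real_var \<s>' x = real_var \<s> x"
    and "x \<notin> rarrs p \<Longrightarrow> real_arr \<s>' x = real_arr \<s> x"
  using assms by (simp_all add: unchanged_def)

text \<open>The invariant speaks of what the body changes; all else stays tied to the store before
  the loop, as \<open>unchanged\<close> is transitive.\<close>

lemma wp_Loop_frame:
  assumes "I \<s>0 \<tau>0"
    and "\<And>\<s> \<tau>. I \<s> \<tau> \<Longrightarrow> unchanged p \<s>0 \<s> \<Longrightarrow> \<tau> \<le> K"
    and "\<And>\<s> \<tau>. I \<s> \<tau> \<Longrightarrow> unchanged p \<s>0 \<s> \<Longrightarrow> tval b \<s> \<Longrightarrow> wp p I \<s> (Suc \<tau>)"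
    and "\<And>\<s> \<tau>. I \<s> \<tau> \<Longrightarrow> unchanged p \<s>0 \<s> \<Longrightarrow> \<not> tval b \<s> \<Longrightarrow> Q \<s> (Suc \<tau>)"
  shows "wp (Loop b p) Q \<s>0 \<tau>0"
proof (rule wp_Loop[where I = "\<lambda>\<s> \<tau>. I \<s> \<tau> \<and> unchanged p \<s>0 \<s>" and K = K])
  fix \<s> \<tau> assume *: "I \<s> \<tau> \<and> unchanged p \<s>0 \<s>" "tval b \<s>"
  then have "wp p I \<s> (Suc \<tau>)" using assms(3) by blast
  then show "wp p (\<lambda>\<s> \<tau>. I \<s> \<tau> \<and> unchanged p \<s>0 \<s>) \<s> (Suc \<tau>)"
    by (rule wp_frame) (use * in \<open>auto simp: unchanged_def\<close>)
qed (use assms in \<open>auto simp: unchanged_def\<close>)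

definition NEq :: "nexp \<Rightarrow> nexp \<Rightarrow> test" where
  "NEq x y = TAnd (TNot (NLess x y)) (TNot (NLess y x))"

lemma tval_NEq [simp]: "tval (NEq x y) \<s> \<longleftrightarrow> nval x \<s> = nval y \<s>"
  by (auto simp: NEq_def)

section \<open>Memory layout\<close>

text \<open>
  \<open>Par\<close> is 0 at roots of the heap and \<open>Suc p\<close> at children of \<open>p\<close>; the children of \<open>x\<close> are the entries
  \<open>x * N, ..., x * N + Deg x - 1\<close> of \<open>Kid\<close>, and \<open>Row x = x * N\<close> since the machine cannot multiply.
  \<open>Status\<close> is 0 for unseen and 1 for queued nodes; the \<open>i\<close>-th node removed from the queue gets \<open>i + 2\<close>.
  The search runs backwards from \<open>t\<close>: the arcs into \<open>v\<close> are \<open>Off v, ..., Off (v + 1) - 1\<close>, and \<open>Next v\<close>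
  is the first arc of the path from \<open>v\<close> to \<open>t\<close>.
\<close>

abbreviation (input) "Par \<s> \<equiv> nat_arr \<s> ''p''"
abbreviation (input) "Deg \<s> \<equiv> nat_arr \<s> ''g''"
abbreviation (input) "Mark \<s> \<equiv> nat_arr \<s> ''m''"
abbreviation (input) "Kid \<s> \<equiv> nat_arr \<s> ''c''"
abbreviation (input) "Pos \<s> \<equiv> nat_arr \<s> ''q''"
abbreviation (input) "Root \<s> \<equiv> nat_arr \<s> ''r''"
abbreviation (input) "Row \<s> \<equiv> nat_arr \<s> ''w''"
abbreviation (input) "Bucket \<s> \<equiv> nat_arr \<s> ''b''"
abbreviation (input) "Status \<s> \<equiv> nat_arr \<s> ''f''"
abbreviation (input) "Next \<s> \<equiv> nat_arr \<s> ''x''"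
abbreviation (input) "Off \<s> \<equiv> nat_arr \<s> ''a''"
abbreviation (input) "Src \<s> \<equiv> nat_arr \<s> ''u''"
abbreviation (input) "Lab \<s> \<equiv> nat_arr \<s> ''e''"
abbreviation (input) "Dst \<s> \<equiv> nat_arr \<s> ''v''"
abbreviation (input) "Out \<s> \<equiv> nat_arr \<s> ''out''"
abbreviation (input) "Start \<s> \<equiv> nat_arr \<s> ''start''"
abbreviation (input) "Tail \<s> \<equiv> nat_arr \<s> ''tail''"
abbreviation (input) "Head \<s> \<equiv> nat_arr \<s> ''head''"
abbreviation (input) "Key \<s> \<equiv> real_arr \<s> ''k''"
abbreviation (input) "Cost \<s> \<equiv> real_arr \<s> ''c''"
abbreviation (input) "Slope \<s> \<equiv> real_arr \<s> ''m''"
abbreviation (input) "Break \<s> \<equiv> real_arr \<s> ''b''"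
abbreviation (input) "Chat \<s> \<equiv> real_arr \<s> ''chat''"
abbreviation (input) "Weight \<s> \<equiv> real_arr \<s> ''d''"
abbreviation (input) "VR \<s> \<equiv> nat_var \<s> ''R''"
abbreviation (input) "Vk \<s> \<equiv> nat_var \<s> ''k''"
abbreviation (input) "Vi \<s> \<equiv> nat_var \<s> ''i''"
abbreviation (input) "Vj \<s> \<equiv> nat_var \<s> ''j''"
abbreviation (input) "Vx \<s> \<equiv> nat_var \<s> ''x''"
abbreviation (input) "Vy \<s> \<equiv> nat_var \<s> ''y''"
abbreviation (input) "Vz \<s> \<equiv> nat_var \<s> ''z''"
abbreviation (input) "Ve \<s> \<equiv> nat_var \<s> ''e''"
abbreviation (input) "Vv \<s> \<equiv> nat_var \<s> ''v''"
abbreviation (input) "Vo \<s> \<equiv> nat_var \<s> ''o''"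
abbreviation (input) "VG \<s> \<equiv> nat_var \<s> ''G''"
abbreviation (input) "VF \<s> \<equiv> nat_var \<s> ''F''"
abbreviation (input) "VN \<s> \<equiv> nat_var \<s> ''N''"
abbreviation (input) "VM \<s> \<equiv> nat_var \<s> ''M''"
abbreviation (input) "Vs \<s> \<equiv> nat_var \<s> ''s''"
abbreviation (input) "Vt \<s> \<equiv> nat_var \<s> ''t''"
abbreviation (input) "RT \<s> \<equiv> real_var \<s> ''T''"
abbreviation (input) "Rm \<s> \<equiv> real_var \<s> ''m''"
abbreviation (input) "Rn \<s> \<equiv> real_var \<s> ''n''"

section \<open>Fibonacci heaps\<close>

text \<open>
  During a cascading cut the node \<open>y0\<close> is exempt from heap order and from the degree count of its parent.
  Outside of one, \<open>y0 = N\<close>, which is not a node.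
\<close>

definition fib :: "nat \<Rightarrow> nat set \<Rightarrow> (nat \<Rightarrow> nat) \<Rightarrow> (nat \<Rightarrow> nat) \<Rightarrow> (nat \<Rightarrow> nat) \<Rightarrow>
    (nat \<Rightarrow> nat) \<Rightarrow> (nat \<Rightarrow> nat) \<Rightarrow> (nat \<Rightarrow> real) \<Rightarrow> nat \<Rightarrow> bool" where
  "fib N H par deg mark kid pos key y0 \<longleftrightarrow>
     H \<subseteq> {..<N} \<and>
     (\<forall>x\<in>H. \<forall>p. par x = Suc p \<longrightarrow>
        p \<in> H \<and> pos x < deg p \<and> kid (p * N + pos x) = x \<and> (x \<noteq> y0 \<longrightarrow> key p \<le> key x)) \<and>
     (\<forall>x\<in>H. \<forall>j<deg x. kid (x * N + j) \<in> H \<and> par (kid (x * N + j)) = Suc x \<and>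
        pos (kid (x * N + j)) = j) \<and>
     acyclic {(x, p). x \<in> H \<and> par x = Suc p} \<and>
     (\<forall>x\<in>H. \<forall>k. card {y \<in> H. par y = Suc x \<and> y \<noteq> y0 \<and> deg y + mark y < k} \<le> k) \<and>
     (\<forall>x\<in>H. mark x \<le> 1 \<and> (par x = 0 \<longrightarrow> mark x = 0))"

text \<open>The child table is a matrix with \<open>N\<close> columns laid out in one array; columns
  below \<open>N\<close> keep the rows of different nodes apart.\<close>

lemma row_major_eq_iff:
  fixes N :: nat
  assumes "j < N" "j' < N"
  shows "x * N + j = x' * N + j' \<longleftrightarrow> x = x' \<and> j = j'"
proof -
  have "(x * N + j) div N = x" "(x * N + j) mod N = j" "(x' * N + j') div N = x'" "(x' * N + j') mod N = j'"
    using assms by auto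
  then show ?thesis by metis
qed

lemma fibI:
  assumes "H \<subseteq> {..<N}"
    and "\<And>x p. x \<in> H \<Longrightarrow> par x = Suc p \<Longrightarrow> p \<in> H \<and> pos x < deg p \<and> kid (p * N + pos x) = x \<and>
      (x \<noteq> y0 \<longrightarrow> key p \<le> key x)"
    and "\<And>x j. x \<in> H \<Longrightarrow> j < deg x \<Longrightarrow> kid (x * N + j) \<in> H \<and> par (kid (x * N + j)) = Suc x \<and>
      pos (kid (x * N + j)) = j"
    and "acyclic {(x, p). x \<in> H \<and> par x = Suc p}"
    and "\<And>x k. x \<in> H \<Longrightarrow> card {y \<in> H. par y = Suc x \<and> y \<noteq> y0 \<and> deg y + mark y < k} \<le> k"
    and "\<And>x. x \<in> H \<Longrightarrow> mark x \<le> 1 \<and> (par x = 0 \<longrightarrow> mark x = 0)"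
  shows "fib N H par deg mark kid pos key y0"
  using assms unfolding fib_def by blast

context
  fixes N H par deg mark kid pos key y0
  assumes fib: "fib N H par deg mark kid pos key y0"
begin

lemma fib_sub: "H \<subseteq> {..<N}"
  using fib by (simp add: fib_def)

lemma fib_finite: "finite H"
  using fib_sub finite_subset by blast

lemma fib_up: "x \<in> H \<Longrightarrow> par x = Suc p \<Longrightarrow>
    p \<in> H \<and> pos x < deg p \<and> kid (p * N + pos x) = x \<and> (x \<noteq> y0 \<longrightarrow> key p \<le> key x)"
  using fib by (simp add: fib_def)

lemma fib_down: "x \<in> H \<Longrightarrow> j < deg x \<Longrightarrow>
    kid (x * N + j) \<in> H \<and> par (kid (x * N + j)) = Suc x \<and> pos (kid (x * N + j)) = j"
  using fib by (simp add: fib_def)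

lemma fib_acyclic: "acyclic {(x, p). x \<in> H \<and> par x = Suc p}"
  using fib by (simp add: fib_def)

lemma fib_count: "x \<in> H \<Longrightarrow> card {y \<in> H. par y = Suc x \<and> y \<noteq> y0 \<and> deg y + mark y < k} \<le> k"
  using fib by (simp add: fib_def)

lemma fib_mark: "x \<in> H \<Longrightarrow> mark x \<le> 1 \<and> (par x = 0 \<longrightarrow> mark x = 0)"
  using fib by (simp add: fib_def)

lemma fib_irrefl: "x \<in> H \<Longrightarrow> par x \<noteq> Suc x"
proof
  assume "x \<in> H" "par x = Suc x"
  then have "(x, x) \<in> {(x, p). x \<in> H \<and> par x = Suc p}" by simp
  then show False using fib_acyclic unfolding acyclic_def by blast
qed

text \<open>\<open>pos\<close> and \<open>kid\<close> are mutually inverse between the children of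
  \<open>x\<close> and the numbers below \<open>deg x\<close>. The bound is strict because
  \<open>x\<close> is not its own child; it leaves a free cell in each row of the child table for
  one more child.\<close>

lemma fib_kids:
  assumes "x \<in> H"
  shows "card {y \<in> H. par y = Suc x} = deg x" "deg x < N"
proof -
  have eq: "{y \<in> H. par y = Suc x} = (\<lambda>j. kid (x * N + j)) ` {..<deg x}"
  proof (intro equalityI subsetI)
    fix y assume "y \<in> {y \<in> H. par y = Suc x}"
    then have "pos y < deg x" "kid (x * N + pos y) = y" using fib_up by auto
    then show "y \<in> (\<lambda>j. kid (x * N + j)) ` {..<deg x}" by (intro image_eqI[of _ _ "pos y"]) auto
  next
    fix y assume "y \<in> (\<lambda>j. kid (x * N + j)) ` {..<deg x}"
    then show "y \<in> {y \<in> H. par y = Suc x}" using fib_down assms by auto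
  qed
  have inj: "inj_on (\<lambda>j. kid (x * N + j)) {..<deg x}"
    using fib_down assms by (intro inj_onI) (metis lessThan_iff)
  show c: "card {y \<in> H. par y = Suc x} = deg x"
    unfolding eq using card_image[OF inj] by simp
  have "{y \<in> H. par y = Suc x} \<subset> H" using assms fib_irrefl by auto
  then have "card {y \<in> H. par y = Suc x} < card H" using fib_finite psubset_card_mono by blast
  also have "\<dots> \<le> N" using card_mono[OF _ fib_sub] by simp
  finally show "deg x < N" using c by simp
qed

text \<open>Climbing from \<open>v\<close> to its root never raises the key, as the exempt node has
  no parent here. This is why a scan of the roots finds the global minimum, and why a heap without
  roots is empty.\<close>

lemma fib_root_below:
  assumes "y0 \<notin> H \<or> par y0 = 0" "v \<in> H"
  shows "\<exists>r\<in>H. par r = 0 \<and> key r \<le> key v"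
proof -
  let ?R = "{(x, p). x \<in> H \<and> par x = Suc p}"
  have "?R \<subseteq> H \<times> H" using fib_up by auto
  then have "finite ?R" using fib_finite finite_subset by blast
  \<comment> \<open>The induction passes from a parent to its children, so the converse of the
    parent relation must be well-founded; finiteness derives this from acyclicity.\<close>
  then have "wf (?R\<inverse>)" using fib_acyclic finite_acyclic_wf_converse by blast
  then show ?thesis using assms(2)
  proof (induction v)
    case (less v)
    show ?case
    proof (cases "par v")
      case 0 then show ?thesis using less by auto
    next
      case (Suc p)
      then have "(p, v) \<in> ?R\<inverse>" using less by auto
      moreover have "p \<in> H" using Suc less fib_up by blast
      ultimately obtain r where r: "r \<in> H" "par r = 0" "key r \<le> key p" using less(1) by blast
      moreover have "key p \<le> key v" using fib_up[OF less(2) Suc] assms less Suc by auto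
      ultimately show ?thesis by fastforce
    qed
  qed
qed

text \<open>A root or a non-member uses no exemption: it has no parent whose order it could violate
  or whose count it could enter. The exemption may then pass to an arbitrary
  \<open>y1\<close>.\<close>

lemma fib_exception:
  assumes "y0 \<notin> H \<or> par y0 = 0"
  shows "fib N H par deg mark kid pos key y1"
proof -
  have "card {y \<in> H. par y = Suc x \<and> y \<noteq> y1 \<and> deg y + mark y < k} \<le> k" if "x \<in> H" for x k
  proof -
    have "{y \<in> H. par y = Suc x \<and> y \<noteq> y1 \<and> deg y + mark y < k}
        \<subseteq> {y \<in> H. par y = Suc x \<and> y \<noteq> y0 \<and> deg y + mark y < k}" using assms by auto
    from card_mono[OF _ this] fib_finite fib_count[OF that, of k] show ?thesis by fastforce
  qed
  moreover have "key p \<le> key x" if "x \<in> H" "par x = Suc p" for x p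
    using fib_up[OF that] that assms by auto
  ultimately show ?thesis
    using fib_sub fib_up fib_down fib_acyclic fib_mark by (intro fibI) simp_all
qed

lemma fib_degrees_double:
  assumes "y0 \<notin> H \<or> par y0 = 0"
  shows "2 * card {x \<in> H. j + 3 \<le> deg x} \<le> card {x \<in> H. j \<le> deg x}"
proof -
  let ?A = "{x \<in> H. j + 3 \<le> deg x}" and ?C = "\<lambda>x. {y \<in> H. par y = Suc x \<and> j \<le> deg y}"
  have two: "2 \<le> card (?C x)" if "x \<in> ?A" for x
  proof -
    \<comment> \<open>The count is used at \<open>j + 1\<close>: a child with degree plus mark at
      least \<open>j + 1\<close> has degree at least \<open>j\<close>, as marks are at most 1. Of
      \<open>j + 3\<close> children at most \<open>j + 1\<close> fall short, which leaves
      two.\<close>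
    have "{y \<in> H. par y = Suc x} \<subseteq> ?C x \<union> {y \<in> H. par y = Suc x \<and> y \<noteq> y0 \<and> deg y + mark y < j + 1}"
      using assms fib_mark by fastforce
    from card_mono[OF _ this] have "deg x \<le> card (?C x \<union> {y \<in> H. par y = Suc x \<and> y \<noteq> y0 \<and> deg y + mark y < j + 1})"
      using that fib_kids(1)[of x] fib_finite by simp
    also have "\<dots> \<le> card (?C x) + (j + 1)"
      using fib_count[of x "j + 1"] that by (intro order_trans[OF card_Un_le] add_left_mono) simp
    finally show ?thesis using that by simp
  qed
  have "2 * card ?A \<le> (\<Sum>x\<in>?A. card (?C x))"
    using sum_bounded_below[of ?A 2 "\<lambda>x. card (?C x)"] two by (simp add: mult.commute)
  also have "\<dots> = card (\<Union>x\<in>?A. ?C x)"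
    using fib_finite by (intro card_UN_disjoint[symmetric]) auto
  also have "\<dots> \<le> card {x \<in> H. j \<le> deg x}"
    using fib_finite by (intro card_mono) auto
  finally show ?thesis .
qed

lemma fib_degree_bound:
  assumes "y0 \<notin> H \<or> par y0 = 0" "N < 2 ^ q" "x \<in> H"
  shows "deg x < 3 * q"
proof (rule ccontr)
  assume "\<not> deg x < 3 * q"
  \<comment> \<open>Iterated doubling. At \<open>i = q\<close> a single node of degree
    \<open>3 * q\<close> would already force \<open>2 ^ q\<close> nodes into a heap of at most
    \<open>N\<close>.\<close>
  have "2 ^ i * card {x \<in> H. 3 * i \<le> deg x} \<le> card H" for i
  proof (induction i)
    case (Suc i)
    have "{x \<in> H. 3 * Suc i \<le> deg x} = {x \<in> H. 3 * i + 3 \<le> deg x}" by auto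
    then have "2 * card {x \<in> H. 3 * Suc i \<le> deg x} \<le> card {x \<in> H. 3 * i \<le> deg x}"
      using fib_degrees_double[OF assms(1), of "3 * i"] by simp
    from mult_le_mono2[OF this, of "2 ^ i"] have "2 ^ Suc i * card {x \<in> H. 3 * Suc i \<le> deg x}
        \<le> 2 ^ i * card {x \<in> H. 3 * i \<le> deg x}" by (simp only: power_Suc mult_ac)
    then show ?case using Suc by linarith
  qed simp
  moreover have "1 \<le> card {x \<in> H. 3 * q \<le> deg x}"
    using \<open>\<not> deg x < 3 * q\<close> assms(3) fib_finite
    by (auto simp: Suc_le_eq card_gt_0_iff)
  ultimately have "2 ^ q \<le> card H"
    by (metis le_trans mult.right_neutral mult_le_mono2)
  moreover have "card H \<le> N" using card_mono[OF _ fib_sub] by simp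
  ultimately show False using assms(2) by simp
qed

text \<open>A smaller key at \<open>x\<close> can violate the order only towards the parent of
  \<open>x\<close>, so \<open>x\<close> becomes the exempt node until the cascade has cut it
  off.\<close>

lemma fib_decrease_key:
  assumes "y0 \<notin> H \<or> par y0 = 0" "x \<in> H" "nk \<le> key x"
  shows "fib N H par deg mark kid pos (key(x := nk)) x"
proof -
  note f = fib_exception[OF assms(1), of x]
  show ?thesis
  proof (rule fibI)
    fix z p assume z: "z \<in> H" "par z = Suc p"
    have "z \<noteq> x \<Longrightarrow> key p \<le> key z" using fib_up[OF z] assms(1) z by auto
    then show "p \<in> H \<and> pos z < deg p \<and> kid (p * N + pos z) = z \<and> (z \<noteq> x \<longrightarrow> (key(x := nk)) p \<le> (key(x := nk)) z)"
      using fib_up[OF z] assms(3) by auto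
  qed (use fib_sub fib_down fib_acyclic fib_mark f in \<open>simp_all add: fib_def\<close>)
qed

text \<open>Entries of \<open>x\<close> may be stale from an earlier search, so parent, degree and
  mark are reset. \<open>kid\<close> and \<open>pos\<close> may stay: for a childless root the
  invariant does not consult them.\<close>

lemma fib_insert:
  assumes "y0 \<notin> H \<or> par y0 = 0" "x \<notin> H" "x < N"
  shows "fib N (insert x H) (par(x := 0)) (deg(x := 0)) (mark(x := 0)) kid pos (key(x := nk)) y1"
proof -
  note f = fib_exception[OF assms(1), of y1]
  have nox: "par y \<noteq> Suc x" if "y \<in> H" for y using fib_up that assms(2) by blast
  show ?thesis
  proof (rule fibI)
    show "insert x H \<subseteq> {..<N}" using fib_sub assms(3) by simp
  next
    fix z p assume z: "z \<in> insert x H" "(par(x := 0)) z = Suc p"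
    then have *: "z \<in> H" "par z = Suc p" "z \<noteq> x" by (auto split: if_splits)
    then have "p \<noteq> x" using nox by auto
    have "z \<noteq> y1 \<longrightarrow> key p \<le> key z" using f * by (auto simp: fib_def)
    then show "p \<in> insert x H \<and> pos z < (deg(x := 0)) p \<and> kid (p * N + pos z) = z \<and>
        (z \<noteq> y1 \<longrightarrow> (key(x := nk)) p \<le> (key(x := nk)) z)"
      using fib_up[OF *(1,2)] \<open>p \<noteq> x\<close> \<open>z \<noteq> x\<close> by simp
  next
    fix z j assume z: "z \<in> insert x H" "j < (deg(x := 0)) z"
    then have *: "z \<in> H" "j < deg z" by (auto split: if_splits)
    have "kid (z * N + j) \<noteq> x" using fib_down[OF *] assms(2) by auto
    then show "kid (z * N + j) \<in> insert x H \<and> (par(x := 0)) (kid (z * N + j)) = Suc z \<and> pos (kid (z * N + j)) = j"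
      using fib_down[OF *] by simp
  next
    show "acyclic {(y, p). y \<in> insert x H \<and> (par(x := 0)) y = Suc p}"
      by (rule acyclic_subset[OF fib_acyclic]) (auto split: if_splits)
  next
    fix z k assume z: "z \<in> insert x H"
    have "{y \<in> insert x H. (par(x := 0)) y = Suc z \<and> y \<noteq> y1 \<and> (deg(x := 0)) y + (mark(x := 0)) y < k}
       = {y \<in> H. par y = Suc z \<and> y \<noteq> y1 \<and> deg y + mark y < k}" (is "?l = ?r") using assms(2) by auto
    moreover have "card ?r \<le> k"
    proof (cases "z = x")
      case True
      then have "?r = {}" using nox by auto
      then show ?thesis by (metis card.empty le0)
    next
      case False
      then have "z \<in> H" using z by simp
      then show ?thesis using f unfolding fib_def by blast
    qed
    ultimately show "card ?l \<le> k" by simp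
  next
    fix z assume "z \<in> insert x H"
    then show "(mark(x := 0)) z \<le> 1 \<and> ((par(x := 0)) z = 0 \<longrightarrow> (mark(x := 0)) z = 0)"
      using fib_mark[of z] by auto
  qed
qed

lemma fib_remove:
  assumes "y0 \<notin> H \<or> par y0 = 0" "x \<in> H" "deg x = 0" "par x = 0"
  shows "fib N (H - {x}) par deg mark kid pos key y1"
proof -
  note f = fib_exception[OF assms(1), of y1]
  have nox: "par y \<noteq> Suc x" if "y \<in> H" for y using fib_up that assms(3) by fastforce
  show ?thesis
  proof (rule fibI)
    show "H - {x} \<subseteq> {..<N}" using fib_sub by auto
  next
    fix z p assume z: "z \<in> H - {x}" "par z = Suc p"
    then have "z \<noteq> y1 \<longrightarrow> key p \<le> key z" using f by (auto simp: fib_def)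
    then show "p \<in> H - {x} \<and> pos z < deg p \<and> kid (p * N + pos z) = z \<and> (z \<noteq> y1 \<longrightarrow> key p \<le> key z)"
      using fib_up[of z p] z nox by auto
  next
    fix z j assume z: "z \<in> H - {x}" "j < deg z"
    then show "kid (z * N + j) \<in> H - {x} \<and> par (kid (z * N + j)) = Suc z \<and> pos (kid (z * N + j)) = j"
      using fib_down[of z j] assms(4) by auto
  next
    show "acyclic {(y, p). y \<in> H - {x} \<and> par y = Suc p}"
      by (rule acyclic_subset[OF fib_acyclic]) auto
  next
    fix z k assume z: "z \<in> H - {x}"
    have "card {y \<in> H - {x}. par y = Suc z \<and> y \<noteq> y1 \<and> deg y + mark y < k}
       \<le> card {y \<in> H. par y = Suc z \<and> y \<noteq> y1 \<and> deg y + mark y < k}"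
      using fib_finite by (intro card_mono) auto
    also have "\<dots> \<le> k" using f z unfolding fib_def by blast
    finally show "card {y \<in> H - {x}. par y = Suc z \<and> y \<noteq> y1 \<and> deg y + mark y < k} \<le> k" .
  next
    fix z assume "z \<in> H - {x}"
    then show "mark z \<le> 1 \<and> (par z = 0 \<longrightarrow> mark z = 0)" using fib_mark by simp
  qed
qed

text \<open>The gap among the children of \<open>p\<close> is closed by moving the last child
  \<open>l\<close> into it. The lower degree of \<open>p\<close> could push \<open>p\<close> into
  the count kept for its own parent. There are three ways out: \<open>p\<close> is a root, or its
  mark grows by one so that degree plus mark is unchanged, or \<open>p\<close> becomes the next
  exempt node, to be cut in turn.\<close>

lemma fib_cut:
  fixes mp :: nat
  assumes y: "y0 = y \<or> y0 \<notin> H \<or> par y0 = 0" "y \<in> H" "par y = Suc p"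
    and mp: "mp \<le> 1" "par p = 0 \<longrightarrow> mp = 0" "y1 = p \<or> par p = 0 \<or> mp = Suc (mark p)"
  defines "l \<equiv> kid (p * N + (deg p - 1))"
  shows "fib N H (par(y := 0)) (deg(p := deg p - 1)) (mark(y := 0, p := mp))
    (kid(p * N + pos y := l)) (pos(l := pos y)) key y1"
proof -
  note yp = fib_up[OF y(2,3)]
  have pH: "p \<in> H" and py: "p \<noteq> y" and dp: "0 < deg p"
    using yp fib_irrefl y by auto
  have lp: "l \<in> H" "par l = Suc p" "pos l = deg p - 1"
    using fib_down[OF pH, of "deg p - 1"] dp unfolding l_def by auto
  have ly: "l = y \<Longrightarrow> pos y = deg p - 1" using lp by simp
  have ly': "l = y" if "pos y = deg p - 1" using that yp unfolding l_def by metis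
  have key: "key q \<le> key z" if "z \<in> H" "par z = Suc q" "z \<noteq> y" for z q
    using fib_up[OF that(1,2)] y(1) that by auto
  note addr = row_major_eq_iff
  show ?thesis
  proof (rule fibI)
    show "H \<subseteq> {..<N}" by (rule fib_sub)
  next
    fix z q assume "z \<in> H" "(par(y := 0)) z = Suc q"
    then have z: "z \<in> H" "par z = Suc q" "z \<noteq> y" by (auto split: if_splits)
    note zq = fib_up[OF z(1,2)]
    have dN: "pos z < N" "pos y < N" using fib_kids(2) zq yp by (metis less_trans)+
    have "pos z \<noteq> pos y" if "q = p" using zq yp that z(3) by metis
    then have "(pos(l := pos y)) z < (deg(p := deg p - 1)) q"
    proof (cases "z = l")
      case True
      then have "q = p" using z lp by simp
      moreover have "pos y \<noteq> deg p - 1" using ly' True z by auto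
      ultimately show ?thesis using True yp by auto
    next
      case False
      then have "q = p \<Longrightarrow> pos z \<noteq> deg p - 1" using zq unfolding l_def by metis
      then show ?thesis using False zq by (cases "q = p") auto
    qed
    moreover have "(kid(p * N + pos y := l)) (q * N + (pos(l := pos y)) z) = z"
    proof (cases "z = l")
      case True
      then have "q = p" using z lp by simp
      then show ?thesis using True by simp
    next
      case False
      have "q * N + pos z \<noteq> p * N + pos y" using addr[OF dN] \<open>q = p \<Longrightarrow> pos z \<noteq> pos y\<close> by auto
      then show ?thesis using zq False by simp
    qed
    ultimately show "q \<in> H \<and> (pos(l := pos y)) z < (deg(p := deg p - 1)) q \<and>
       (kid(p * N + pos y := l)) (q * N + (pos(l := pos y)) z) = z \<and> (z \<noteq> y1 \<longrightarrow> key q \<le> key z)"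
      using zq key[OF z] by blast
  next
    fix x j assume x: "x \<in> H" "j < (deg(p := deg p - 1)) x"
    then have j: "j < deg x" "x = p \<Longrightarrow> j < deg p - 1" by (auto split: if_splits)
    have dN: "j < N" "pos y < N" using fib_kids(2) j(1) x(1) pH yp by (metis less_trans)+
    note k = fib_down[OF x(1) j(1)]
    show "(kid(p * N + pos y := l)) (x * N + j) \<in> H \<and>
       (par(y := 0)) ((kid(p * N + pos y := l)) (x * N + j)) = Suc x \<and>
       (pos(l := pos y)) ((kid(p * N + pos y := l)) (x * N + j)) = j"
    proof (cases "x = p \<and> j = pos y")
      case True
      then show ?thesis using lp ly j by auto
    next
      case False
      then have "x * N + j \<noteq> p * N + pos y" using addr[OF dN] by simp
      moreover have "kid (x * N + j) \<noteq> y" using k y False by auto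
      moreover have "kid (x * N + j) \<noteq> l" using k lp j by auto
      ultimately show ?thesis using k by simp
    qed
  next
    show "acyclic {(z, q). z \<in> H \<and> (par(y := 0)) z = Suc q}"
      by (rule acyclic_subset[OF fib_acyclic]) (auto split: if_splits)
  next
    fix x k assume x: "x \<in> H"
    have "card {z \<in> H. (par(y := 0)) z = Suc x \<and> z \<noteq> y1 \<and> (deg(p := deg p - 1)) z + (mark(y := 0, p := mp)) z < k}
       \<le> card {z \<in> H. par z = Suc x \<and> z \<noteq> y0 \<and> deg z + mark z < k}"
    proof (intro card_mono subsetI)
      fix z assume "z \<in> {z \<in> H. (par(y := 0)) z = Suc x \<and> z \<noteq> y1 \<and> (deg(p := deg p - 1)) z + (mark(y := 0, p := mp)) z < k}"
      then have z: "z \<in> H" "z \<noteq> y" "par z = Suc x" "z \<noteq> y1"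
        "(deg(p := deg p - 1)) z + (mark(y := 0, p := mp)) z < k" by (auto split: if_splits)
      \<comment> \<open>Only \<open>z = p\<close> needs care: it is then neither a root nor
        \<open>y1\<close>, so \<open>mp = Suc (mark p)\<close> makes up for the lost child.\<close>
      moreover have "deg z + mark z < k" using z mp dp by (cases "z = p") auto
      ultimately show "z \<in> {z \<in> H. par z = Suc x \<and> z \<noteq> y0 \<and> deg z + mark z < k}" using y by auto
    qed (use fib_finite in auto)
    also have "\<dots> \<le> k" by (rule fib_count[OF x])
    finally show "card {z \<in> H. (par(y := 0)) z = Suc x \<and> z \<noteq> y1 \<and>
      (deg(p := deg p - 1)) z + (mark(y := 0, p := mp)) z < k} \<le> k" .
  next
    fix x assume "x \<in> H"
    then show "(mark(y := 0, p := mp)) x \<le> 1 \<and> ((par(y := 0)) x = 0 \<longrightarrow> (mark(y := 0, p := mp)) x = 0)"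
      using fib_mark[of x] mp py by simp
  qed
qed

text \<open>Equal degrees \<open>n\<close> preserve the count: \<open>z\<close> has degree
  \<open>n\<close> and, as a root, no mark, so it is counted only for \<open>k > n\<close>; and
  there the bound is trivial, since \<open>y\<close> has just \<open>n + 1\<close> children.\<close>

lemma fib_link:
  assumes "y0 \<notin> H \<or> par y0 = 0" "y \<in> H" "z \<in> H" "y \<noteq> z" "par y = 0" "par z = 0"
    "deg y = deg z" "key y \<le> key z"
  shows "fib N H (par(z := Suc y)) (deg(y := Suc (deg y))) mark
    (kid(y * N + deg y := z)) (pos(z := deg y)) key y1"
proof -
  note f = fib_exception[OF assms(1), of y1]
  note addr = row_major_eq_iff
  show ?thesis
  proof (rule fibI)
    show "H \<subseteq> {..<N}" by (rule fib_sub)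
  next
    fix x p assume x: "x \<in> H" "(par(z := Suc y)) x = Suc p"
    show "p \<in> H \<and> (pos(z := deg y)) x < (deg(y := Suc (deg y))) p \<and>
       (kid(y * N + deg y := z)) (p * N + (pos(z := deg y)) x) = x \<and> (x \<noteq> y1 \<longrightarrow> key p \<le> key x)"
    proof (cases "x = z")
      case True then show ?thesis using x assms by auto
    next
      case False
      then have *: "par x = Suc p" using x by simp
      note xp = fib_up[OF x(1) *]
      have "pos x < N" "deg y < N" using fib_kids(2) xp assms(2) by (metis less_trans)+
      from addr[OF this] have "p * N + pos x \<noteq> y * N + deg y" using xp by auto
      moreover have "x \<noteq> y1 \<longrightarrow> key p \<le> key x" using f x(1) * by (auto simp: fib_def)
      ultimately show ?thesis using xp False by auto
    qed
  next
    fix x j assume x: "x \<in> H" "j < (deg(y := Suc (deg y))) x"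
    show "(kid(y * N + deg y := z)) (x * N + j) \<in> H \<and>
      (par(z := Suc y)) ((kid(y * N + deg y := z)) (x * N + j)) = Suc x \<and>
      (pos(z := deg y)) ((kid(y * N + deg y := z)) (x * N + j)) = j"
    proof (cases "x = y \<and> j = deg y")
      case True then show ?thesis using assms by auto
    next
      case False
      then have j: "j < deg x" using x by (auto split: if_splits)
      have "j < N" "deg y < N" using fib_kids(2) j x(1) assms(2) by (metis less_trans)+
      from addr[OF this] have "x * N + j \<noteq> y * N + deg y" using False by auto
      moreover have "kid (x * N + j) \<noteq> z" using fib_down[OF x(1) j] assms(6) by auto
      ultimately show ?thesis using fib_down[OF x(1) j] by auto
    qed
  next
    let ?r = "{(x, p). x \<in> H \<and> par x = Suc p}"
    \<comment> \<open>\<open>y\<close> is a root, so it reaches only itself, and the new edge from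
      \<open>z\<close> to \<open>y\<close> closes no cycle.\<close>
    have "(y, z) \<notin> ?r\<^sup>*"
    proof
      assume "(y, z) \<in> ?r\<^sup>*"
      then show False using assms(4,5) by (cases rule: converse_rtranclE) auto
    qed
    then have "acyclic (insert (z, y) ?r)" using fib_acyclic by (simp add: acyclic_insert)
    then show "acyclic {(x, p). x \<in> H \<and> (par(z := Suc y)) x = Suc p}"
      by (rule acyclic_subset) (auto split: if_splits)
  next
    fix x k assume x: "x \<in> H"
    have m0: "mark z = 0" using fib_mark assms(3,6) by auto
    let ?S = "{v \<in> H. (par(z := Suc y)) v = Suc x \<and> v \<noteq> y1 \<and> (deg(y := Suc (deg y))) v + mark v < k}"
    show "card ?S \<le> k"
    proof (cases "x = y \<and> deg y < k")
      case True
      have "?S \<subseteq> insert z {v \<in> H. par v = Suc y}" using True by (auto split: if_split_asm)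
      then have "card ?S \<le> card (insert z {v \<in> H. par v = Suc y})"
        using fib_finite by (intro card_mono) auto
      also have "\<dots> \<le> Suc (deg y)" using fib_kids(1)[OF assms(2)] by (simp add: card_insert_if fib_finite)
      finally show ?thesis using True by simp
    next
      case False
      have "?S \<subseteq> {v \<in> H. par v = Suc x \<and> v \<noteq> y1 \<and> deg v + mark v < k}"
      proof
        fix v assume v: "v \<in> ?S"
        have "v \<noteq> y" using v assms(4,5) by auto
        then have "deg v + mark v < k" using v by auto
        then have "v \<noteq> z" using v False assms(7) m0 by auto
        then show "v \<in> {v \<in> H. par v = Suc x \<and> v \<noteq> y1 \<and> deg v + mark v < k}"
          using v \<open>v \<noteq> y\<close> by auto
      qed
      then have "card ?S \<le> card {v \<in> H. par v = Suc x \<and> v \<noteq> y1 \<and> deg v + mark v < k}"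
        using fib_finite by (intro card_mono) auto
      also have "\<dots> \<le> k" using f x unfolding fib_def by blast
      finally show ?thesis .
    qed
  next
    fix x assume "x \<in> H"
    then show "mark x \<le> 1 \<and> ((par(z := Suc y)) x = 0 \<longrightarrow> mark x = 0)" using fib_mark[of x] by simp
  qed
qed

end

section \<open>Heap operations as programs\<close>

lemma bij_betw_push:
  assumes "bij_betw r {..<n} A" "y \<notin> A"
  shows "bij_betw (r(n := y)) {..<Suc n} (insert y A)"
proof -
  have "bij_betw (r(n := y)) {..<n} A" using assms(1) by (subst bij_betw_cong[of _ _ r]) auto
  then show ?thesis using bij_betw_combine[of "r(n := y)" "{..<n}" A "{n}" "{y}"] assms(2)
    by (simp add: lessThan_Suc insert_commute Un_commute bij_betw_def)
qed

lemma bij_betw_move: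
  assumes "bij_betw r S A" "i \<in> S" "h \<in> S" "i \<noteq> h"
  shows "bij_betw (r(h := r i)) (S - {i}) (A - {r h})"
proof -
  have "inj_on r S" "r ` S = A" using assms(1) by (auto simp: bij_betw_def)
  then show ?thesis using assms(2-4) unfolding bij_betw_def
    by (auto simp: inj_on_def image_iff)
qed

lemma sum_fun_upd_nat:
  fixes f :: "'a \<Rightarrow> nat"
  assumes "finite H" "x \<in> H"
  shows "(\<Sum>y\<in>H. (f(x := v)) y) + f x = (\<Sum>y\<in>H. f y) + v"
  using assms by (simp add: sum.remove)

definition heap :: "nat \<Rightarrow> nat \<Rightarrow> nat set \<Rightarrow> store \<Rightarrow> bool" where
  "heap N y0 H \<s> \<longleftrightarrow>
     fib N H (Par \<s>) (Deg \<s>) (Mark \<s>) (Kid \<s>)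
       (Pos \<s>) (Key \<s>) y0 \<and>
     bij_betw (Root \<s>) {..<VR \<s>} {x \<in> H. Par \<s> x = 0} \<and>
     (\<forall>x<N. Row \<s> x = x * N)"

lemma heap_exception: "heap N y0 H \<s> \<Longrightarrow> y0 \<notin> H \<or> Par \<s> y0 = 0 \<Longrightarrow> heap N y1 H \<s>"
  using fib_exception unfolding heap_def by blast

text \<open>One unit of potential pays for 60 ticks of the clock.\<close>

definition pot :: "nat set \<Rightarrow> store \<Rightarrow> nat" where
  "pot H \<s> = VR \<s> + 2 * (\<Sum>x\<in>H. Mark \<s> x)"

section \<open>Cascading cuts\<close>

definition cut_prog :: prog where
  "cut_prog = seq [
     SetNArr ''g'' (NVar ''q'') (NSub (NArr ''g'' (NVar ''q'')) (NConst 1)),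
     SetNVar ''l'' (NArr ''c'' (NAdd (NArr ''w'' (NVar ''q'')) (NArr ''g'' (NVar ''q'')))),
     SetNArr ''c'' (NAdd (NArr ''w'' (NVar ''q'')) (NArr ''q'' (NVar ''z''))) (NVar ''l''),
     SetNArr ''q'' (NVar ''l'') (NArr ''q'' (NVar ''z'')),
     SetNArr ''p'' (NVar ''z'') (NConst 0),
     SetNArr ''m'' (NVar ''z'') (NConst 0),
     SetNArr ''r'' (NVar ''R'') (NVar ''z''),
     SetNVar ''R'' (NAdd (NVar ''R'') (NConst 1))]"

text \<open>The cascade stops by setting \<open>z\<close> back to \<open>y\<close>, which is a root
  by then, so that the loop test fails. When \<open>p\<close> is itself a root, moving on to it has
  the same effect.\<close>

definition cascade_step :: prog where
  "cascade_step = seq [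
     SetNVar ''q'' (NSub (NArr ''p'' (NVar ''z'')) (NConst 1)),
     cut_prog,
     Cond (TAnd (NLess (NConst 0) (NArr ''p'' (NVar ''q''))) (NEq (NArr ''m'' (NVar ''q'')) (NConst 0)))
       (seq [SetNArr ''m'' (NVar ''q'') (NConst 1), SetNVar ''z'' (NVar ''y'')])
       (SetNVar ''z'' (NVar ''q''))]"

definition cascade_prog :: prog where
  "cascade_prog = seq [
     SetNVar ''z'' (NVar ''y''),
     Loop (NLess (NConst 0) (NArr ''p'' (NVar ''z''))) cascade_step]"

text \<open>The balance of the potential: one more root, the mark of \<open>y\<close> gone, the mark
  of \<open>p\<close> replaced by \<open>mp\<close>. It is arranged as a sum on both sides because
  subtraction of naturals is truncated.\<close>

lemma heap_cut:
  assumes "heap N y0 H \<s>" "y0 = y \<or> y0 \<notin> H \<or> Par \<s> y0 = 0" "y \<in> H" "Par \<s> y = Suc p"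
    and "mp \<le> 1" "Par \<s> p = 0 \<longrightarrow> mp = 0" "y1 = p \<or> Par \<s> p = 0 \<or> mp = Suc (Mark \<s> p)"
    and l: "l = Kid \<s> (p * N + (Deg \<s> p - Suc 0))"
    and s': "Par \<s>' = (Par \<s>)(y := 0)"
      "Deg \<s>' = (Deg \<s>)(p := Deg \<s> p - Suc 0)"
      "Mark \<s>' = (Mark \<s>)(y := 0, p := mp)"
      "Kid \<s>' = (Kid \<s>)(p * N + Pos \<s> y := l)"
      "Pos \<s>' = (Pos \<s>)(l := Pos \<s> y)"
      "Root \<s>' = (Root \<s>)(VR \<s> := y)"
      "VR \<s>' = Suc (VR \<s>)"
      "Row \<s>' = Row \<s>" "Key \<s>' = Key \<s>"
  shows "heap N y1 H \<s>'" "pot H \<s>' + 2 * Mark \<s> y + 2 * Mark \<s> p = Suc (pot H \<s>) + 2 * mp"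
proof -
  have f: "fib N H (Par \<s>) (Deg \<s>) (Mark \<s>) (Kid \<s>)
       (Pos \<s>) (Key \<s>) y0"
    and b: "bij_betw (Root \<s>) {..<VR \<s>} {x \<in> H. Par \<s> x = 0}"
    and w: "\<forall>x<N. Row \<s> x = x * N"
    using assms(1) by (auto simp: heap_def)
  have "{x \<in> H. ((Par \<s>)(y := 0)) x = 0} = insert y {x \<in> H. Par \<s> x = 0}"
    using assms(3) by auto
  moreover have "y \<notin> {x \<in> H. Par \<s> x = 0}" using assms(4) by simp
  ultimately have "bij_betw (Root \<s>') {..<VR \<s>'} {x \<in> H. Par \<s>' x = 0}"
    using bij_betw_push[OF b] unfolding s' by simp
  then show "heap N y1 H \<s>'"
    using fib_cut[OF f assms(2-7)] w unfolding heap_def s' l by simp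
  have "p \<in> H" "p \<noteq> y" using fib_up[OF f assms(3,4)] fib_irrefl[OF f assms(3)] assms(4) by auto
  then show "pot H \<s>' + 2 * Mark \<s> y + 2 * Mark \<s> p = Suc (pot H \<s>) + 2 * mp"
    using sum_fun_upd_nat[OF fib_finite[OF f] assms(3), of "Mark \<s>" 0]
      sum_fun_upd_nat[OF fib_finite[OF f] \<open>p \<in> H\<close>, of "(Mark \<s>)(y := 0)" mp]
    unfolding pot_def s' by simp
qed

lemma wp_cascade:
  assumes "heap N y H \<s>" "y \<in> H" "Vy \<s> = y"
  shows "wp cascade_prog (\<lambda>\<s>' \<tau>'. heap N N H \<s>' \<and> \<tau>' + 60 * pot H \<s>' \<le> \<tau> + 60 * pot H \<s> + 250) \<s> \<tau>"
proof -
  define B where "B = \<tau> + 1 + 60 * pot H \<s>"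
  \<comment> \<open>A step takes at most 13 ticks. The first cut may hit an unmarked node and so
    raise the potential by one unit; each later cut removes a mark and releases a unit, which keeps
    the bound at \<open>B + 120\<close>. The last step may also mark \<open>p\<close>, which adds
    two units, and \<open>B + 240\<close> covers this.\<close>
  let ?I = "\<lambda>\<s>' \<tau>'. Vy \<s>' = y \<and> Vz \<s>' \<in> H \<and> heap N (Vz \<s>') H \<s>' \<and>
    (Vz \<s>' = y \<or> Par \<s>' y = 0) \<and>
    (Par \<s>' (Vz \<s>') \<noteq> 0 \<longrightarrow> Vz \<s>' = y \<and> \<tau>' + 60 * pot H \<s>' \<le> B \<or>
       Mark \<s>' (Vz \<s>') = 1 \<and> \<tau>' + 60 * pot H \<s>' \<le> B + 120) \<and>
    \<tau>' + 60 * pot H \<s>' \<le> B + 240"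
  show ?thesis
    unfolding cascade_prog_def seq.simps wp_Seq wp_SetNVar
  proof (rule wp_Loop[where I = ?I and K = "B + 240"], goal_cases)
    case 1
    then show ?case using assms by (simp add: B_def heap_def pot_def)
  next
    case (2 \<s> \<tau>)
    then show ?case by simp
  next
    case (3 \<s> \<tau>)
    obtain p where p: "Par \<s> (Vz \<s>) = Suc p" using 3(2) by (auto simp: gr0_conv_Suc)
    have I: "Vy \<s> = y" "Vz \<s> \<in> H" "heap N (Vz \<s>) H \<s>" using 3(1) by auto
    note h = I(3)[unfolded heap_def]
    have pH: "p \<in> H" "p < N" "p \<noteq> Vz \<s>" "Row \<s> p = p * N"
      using h p fib_up[OF conjunct1[OF h] I(2) p] fib_sub[OF conjunct1[OF h]] fib_irrefl[OF conjunct1[OF h] I(2)] by auto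
    let ?z = "Vz \<s>"
    define c where "c \<longleftrightarrow> Par \<s> p \<noteq> 0 \<and> Mark \<s> p = 0"
    define mp where "mp = (if c then 1 else Mark \<s> p)"
    define l where "l = Kid \<s> (p * N + (Deg \<s> p - Suc 0))"
    let ?R = "\<lambda>(\<s>' :: store) \<tau>'. \<tau>' \<le> \<tau> + 13 \<and> Vy \<s>' = y \<and> Vz \<s>' = (if c then y else p) \<and>
      Par \<s>' = (Par \<s>)(?z := 0) \<and>
      Deg \<s>' = (Deg \<s>)(p := Deg \<s> p - Suc 0) \<and>
      Mark \<s>' = (Mark \<s>)(?z := 0, p := mp) \<and>
      Kid \<s>' = (Kid \<s>)(p * N + Pos \<s> ?z := l) \<and>
      Pos \<s>' = (Pos \<s>)(l := Pos \<s> ?z) \<and>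
      Root \<s>' = (Root \<s>)(VR \<s> := ?z) \<and>
      VR \<s>' = Suc (VR \<s>) \<and>
      Row \<s>' = Row \<s> \<and> Key \<s>' = Key \<s>"
    have mk: "Mark \<s> p \<le> 1" "Par \<s> p = 0 \<longrightarrow> Mark \<s> p = 0"
      using fib_mark[OF conjunct1[OF h] pH(1)] by auto
    have "wp cascade_step ?R \<s> (Suc \<tau>)"
      using pH(3) I(1) by (simp add: cascade_step_def cut_prog_def p pH c_def mp_def l_def fun_eq_iff)
    then show ?case
    proof (rule wp_mono)
      fix \<s>' \<tau>' assume R: "?R \<s>' \<tau>'"
      have mp: "mp \<le> 1" "Par \<s> p = 0 \<longrightarrow> mp = 0"
        "(if c then N else p) = p \<or> Par \<s> p = 0 \<or> mp = Suc (Mark \<s> p)"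
        using mk by (auto simp: mp_def c_def)
      note cut = heap_cut[OF I(3) disjI1[OF refl] I(2) p mp l_def, of \<s>']
      have hp: "heap N (if c then N else p) H \<s>'" using cut(1) R by blast
      have pt: "pot H \<s>' + 2 * Mark \<s> ?z + 2 * Mark \<s> p = Suc (pot H \<s>) + 2 * mp"
        using cut(2) R by blast
      have "N \<notin> H" using fib_sub[OF conjunct1[OF h]] by auto
      then have "heap N (Vz \<s>') H \<s>'" using hp R by (auto intro: heap_exception)
      moreover have "Par \<s>' y = 0" using R 3(1) by auto
      ultimately show "?I \<s>' \<tau>'"
        using R pt 3(1) p mk pH \<open>y \<in> H\<close> by (cases c) (auto simp: mp_def c_def)
    qed
  next
    case (4 \<s> \<tau>)
    moreover from this have "heap N N H \<s>" using heap_exception[of N "Vz \<s>"] by simp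
    ultimately show ?case by (auto simp: B_def)
  qed
qed

section \<open>Extracting the minimum\<close>

definition min_step :: prog where
  "min_step = seq [
     Cond (RLess (RArr ''k'' (NArr ''r'' (NVar ''j''))) (RArr ''k'' (NArr ''r'' (NVar ''i''))))
       (SetNVar ''i'' (NVar ''j'')) Skip,
     SetNVar ''j'' (NAdd (NVar ''j'') (NConst 1))]"

text \<open>The scan of all roots replaces a pointer to the minimum; it is paid for by the potential
  released when the roots are linked afterwards.\<close>

definition min_prog :: prog where
  "min_prog = seq [SetNVar ''i'' (NConst 0), SetNVar ''j'' (NConst 1),
     Loop (NLess (NVar ''j'') (NVar ''R'')) min_step]"

lemma wp_min:
  assumes "0 < VR \<s>"
  shows "wp min_prog (\<lambda>\<s>' \<tau>'. Vi \<s>' < VR \<s> \<and>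
    (\<forall>l<VR \<s>. Key \<s> (Root \<s> (Vi \<s>')) \<le> Key \<s> (Root \<s> l)) \<and>
    \<tau>' \<le> \<tau> + 4 * VR \<s> + 4) \<s> \<tau>"
proof -
  let ?R = "VR \<s>" and ?f = "\<lambda>l. Key \<s> (Root \<s> l)"
  let ?I = "\<lambda>(\<s>' :: store) \<tau>'. Vi \<s>' < ?R \<and> Vj \<s>' \<le> ?R \<and>
    (\<forall>l<Vj \<s>'. ?f (Vi \<s>') \<le> ?f l) \<and> \<tau>' \<le> \<tau> + 2 + 4 * Vj \<s>'"
  show ?thesis
    unfolding min_prog_def seq.simps wp_Seq wp_SetNVar
  proof (rule wp_Loop_frame[where I = ?I and K = "\<tau> + 2 + 4 * ?R"], goal_cases)
    case 1
    then show ?case using assms by simp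
  next
    case (3 \<s>' \<tau>')
    note u = unchangedD[OF 3(2), unfolded min_step_def, simplified]
    show ?case using 3(1,3) by (auto simp: min_step_def u less_Suc_eq)
  next
    case (4 \<s>' \<tau>')
    note u = unchangedD[OF 4(2), unfolded min_step_def, simplified]
    show ?case using 4(1,3) by (auto simp: u)
  qed auto
qed

definition kids_step :: prog where
  "kids_step = seq [
     SetNVar ''z'' (NArr ''c'' (NAdd (NArr ''w'' (NVar ''x'')) (NSub (NArr ''g'' (NVar ''x'')) (NConst 1)))),
     SetNVar ''q'' (NVar ''x''), cut_prog]"

definition kids_prog :: prog where
  "kids_prog = Loop (NLess (NConst 0) (NArr ''g'' (NVar ''x''))) kids_step"

text \<open>Children leave from the end of the row, so closing the gap moves nothing. They are
  appended behind the present roots, and \<open>x\<close> keeps the position that the scan has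
  found. Each child costs 11 ticks and one unit of potential, 71 in all.\<close>

lemma wp_kids:
  assumes "heap N N H \<s>" "x \<in> H" "Par \<s> x = 0" "Vx \<s> = x"
  shows "wp kids_prog (\<lambda>\<s>' \<tau>'. heap N N H \<s>' \<and> Par \<s>' x = 0 \<and> Deg \<s>' x = 0 \<and>
    VR \<s> \<le> VR \<s>' \<and> (\<forall>l<VR \<s>. Root \<s>' l = Root \<s> l) \<and>
    \<tau>' + 60 * pot H \<s>' \<le> \<tau> + 60 * pot H \<s> + 71 * Deg \<s> x + 1) \<s> \<tau>"
proof -
  let ?B = "\<tau> + 60 * pot H \<s> + 71 * Deg \<s> x"
  let ?I = "\<lambda>\<s>' \<tau>'. heap N N H \<s>' \<and> Par \<s>' x = 0 \<and>
    VR \<s> \<le> VR \<s>' \<and> (\<forall>l<VR \<s>. Root \<s>' l = Root \<s> l) \<and>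
    \<tau>' + 60 * pot H \<s>' + 71 * Deg \<s>' x \<le> ?B"
  show ?thesis
    unfolding kids_prog_def
  proof (rule wp_Loop_frame[where I = ?I and K = ?B], goal_cases)
    case 1
    then show ?case using assms by simp
  next
    case (3 \<s> \<tau>)
    note u = unchangedD[OF 3(2), unfolded kids_step_def cut_prog_def, simplified]
    have x: "Vx \<s> = x" using u assms(4) by simp
    have I: "heap N N H \<s>" "Par \<s> x = 0" using 3(1) by auto
    note h = I(1)[unfolded heap_def]
    have g: "0 < Deg \<s> x" using 3(3) x by simp
    define z where "z = Kid \<s> (x * N + (Deg \<s> x - Suc 0))"
    have z: "z \<in> H" "Par \<s> z = Suc x"
      using fib_down[OF conjunct1[OF h] assms(2), of "Deg \<s> x - Suc 0"] g by (auto simp: z_def)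
    have w: "Row \<s> x = x * N" "N \<notin> H" using h assms(2) fib_sub[OF conjunct1[OF h]] by auto
    have zx: "x \<noteq> z" using z I by auto
    have m0: "Mark \<s> x = 0" using fib_mark[OF conjunct1[OF h] assms(2)] I by simp
    let ?Q = "\<lambda>(\<s>' :: store) \<tau>'. \<tau>' \<le> \<tau> + 11 \<and>
      Par \<s>' = (Par \<s>)(z := 0) \<and>
      Deg \<s>' = (Deg \<s>)(x := Deg \<s> x - Suc 0) \<and>
      Mark \<s>' = (Mark \<s>)(z := 0, x := 0) \<and>
      Kid \<s>' = (Kid \<s>)(x * N + Pos \<s> z := z) \<and>
      Pos \<s>' = (Pos \<s>)(z := Pos \<s> z) \<and>
      Root \<s>' = (Root \<s>)(VR \<s> := z) \<and>
      VR \<s>' = Suc (VR \<s>) \<and>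
      Row \<s>' = Row \<s> \<and> Key \<s>' = Key \<s>"
    have "wp kids_step ?Q \<s> (Suc \<tau>)"
      using zx m0 by (simp add: kids_step_def cut_prog_def x w z_def[symmetric] fun_eq_iff)
    then show ?case
    proof (rule wp_mono)
      fix \<s>' \<tau>' assume Q: "?Q \<s>' \<tau>'"
      note cut = heap_cut[OF I(1) disjI2[OF disjI1[OF w(2)]] z, where mp = 0 and \<s>' = \<s>' and ?y1.0 = N, OF _ _ _ z_def]
      have "heap N N H \<s>'" using cut(1) Q I(2) by blast
      moreover have "pot H \<s>' \<le> Suc (pot H \<s>)" using cut(2) Q I(2) by fastforce
      ultimately show "?I \<s>' \<tau>'" using Q 3(1) g zx by auto
    qed
  next
    case (4 \<s> \<tau>)
    note u = unchangedD[OF 4(2), unfolded kids_step_def cut_prog_def, simplified]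
    show ?case using 4(1,3) u assms(4) by auto
  qed auto
qed

lemma bij_betw_remove:
  assumes "bij_betw r S A" "i \<in> S"
  shows "bij_betw r (S - {i}) (A - {r i})"
proof -
  have "inj_on r S" "r ` S = A" using assms(1) by (auto simp: bij_betw_def)
  then have "r ` (S - {i}) = A - {r i}"
    using inj_on_image_set_diff[of r S S "{i}"] assms(2) by auto
  then show ?thesis using \<open>inj_on r S\<close> by (auto simp: bij_betw_def intro: inj_on_subset)
qed

lemma bij_betw_shift:
  assumes "bij_betw r S A" "i \<in> S" "j \<notin> S"
  shows "bij_betw (r(j := r i)) (insert j (S - {i})) A"
proof -
  have r: "bij_betw (r(j := r i)) (S - {i}) (A - {r i})"
    using bij_betw_remove[OF assms(1,2)] assms(3) by (subst bij_betw_cong[of _ _ r]) auto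
  have "A = (A - {r i}) \<union> {r i}" using assms by (auto simp: bij_betw_def)
  moreover have "bij_betw (r(j := r i)) ((S - {i}) \<union> {j}) ((A - {r i}) \<union> {r i})"
    by (rule bij_betw_combine[OF r]) auto
  ultimately show ?thesis by simp
qed

lemma heapD:
  assumes "heap N y0 H \<s>"
  shows "fib N H (Par \<s>) (Deg \<s>) (Mark \<s>) (Kid \<s>)
       (Pos \<s>) (Key \<s>) y0"
    and "bij_betw (Root \<s>) {..<VR \<s>} {x \<in> H. Par \<s> x = 0}"
    and "x < N \<Longrightarrow> Row \<s> x = x * N"
  using assms by (auto simp: heap_def)

lemma heap_remove:
  assumes h: "heap N N H \<s>" and x: "x \<in> H" "Par \<s> x = 0" "Deg \<s> x = 0"
    and i: "i < VR \<s>" "Root \<s> i = x"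
    and s': "Root \<s>' = (Root \<s>)(i := Root \<s> (VR \<s> - Suc 0))"
      "VR \<s>' = VR \<s> - Suc 0" "Par \<s>' = Par \<s>"
      "Deg \<s>' = Deg \<s>" "Mark \<s>' = Mark \<s>"
      "Kid \<s>' = Kid \<s>" "Pos \<s>' = Pos \<s>"
      "Row \<s>' = Row \<s>" "Key \<s>' = Key \<s>"
  shows "heap N N (H - {x}) \<s>'" "pot (H - {x}) \<s>' + 1 \<le> pot H \<s>"
proof -
  note f = heapD(1)[OF h] and b = heapD(2)[OF h]
  have N: "N \<notin> H" using fib_sub[OF f] by auto
  obtain R where R: "VR \<s> = Suc R" using i(1) by (cases "VR \<s>") auto
  have eq: "{y \<in> H - {x}. Par \<s> y = 0} = {y \<in> H. Par \<s> y = 0} - {x}" by auto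
  have "bij_betw (Root \<s>') {..<R} ({y \<in> H. Par \<s> y = 0} - {x})"
  proof (cases "i = R")
    case True
    have "bij_betw (Root \<s>) ({..<Suc R} - {R}) ({y \<in> H. Par \<s> y = 0} - {Root \<s> R})"
      by (rule bij_betw_remove) (use b R in auto)
    moreover have "{..<Suc R} - {R} = {..<R}" by auto
    ultimately have "bij_betw (Root \<s>) {..<R} ({y \<in> H. Par \<s> y = 0} - {x})"
      using True i by simp
    moreover have "Root \<s>' = Root \<s>" using True i s'(1) R by (simp add: fun_upd_idem)
    ultimately show ?thesis by simp
  next
    case False
    have "bij_betw ((Root \<s>)(i := Root \<s> R)) ({..<Suc R} - {R})
        ({y \<in> H. Par \<s> y = 0} - {Root \<s> i})"
      by (rule bij_betw_move) (use b R i False in auto)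
    moreover have "{..<Suc R} - {R} = {..<R}" by auto
    ultimately show ?thesis using i s' R by simp
  qed
  then show "heap N N (H - {x}) \<s>'"
    using fib_remove[OF f disjI1[OF N] x(1,3,2)] heapD(3)[OF h] R unfolding heap_def s' eq by simp
  have "(\<Sum>y\<in>H - {x}. Mark \<s> y) \<le> (\<Sum>y\<in>H. Mark \<s> y)"
    by (rule sum_mono2[OF fib_finite[OF f]]) auto
  then show "pot (H - {x}) \<s>' + 1 \<le> pot H \<s>" unfolding pot_def s' R by simp
qed

text \<open>The winner of a link takes the slot of the earlier root and is not entered into a bucket
  again. Several roots of one degree may therefore survive, unlike in the textbook consolidation,
  but their number is halved up to an additive \<open>D\<close>, which is all that the amortisation
  needs.\<close>

definition link_step :: prog where
  "link_step = seq [
     SetNVar ''y'' (NArr ''r'' (NVar ''i'')),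
     SetNVar ''i'' (NAdd (NVar ''i'') (NConst 1)),
     SetNVar ''h'' (NArr ''b'' (NArr ''g'' (NVar ''y''))),
     Cond (NLess (NConst 0) (NVar ''h''))
       (seq [
         SetNVar ''h'' (NSub (NVar ''h'') (NConst 1)),
         SetNVar ''z'' (NArr ''r'' (NVar ''h'')),
         SetNArr ''b'' (NArr ''g'' (NVar ''y'')) (NConst 0),
         Cond (RLess (RArr ''k'' (NVar ''z'')) (RArr ''k'' (NVar ''y'')))
           (seq [SetNVar ''l'' (NVar ''y''), SetNVar ''y'' (NVar ''z''), SetNVar ''z'' (NVar ''l'')]) Skip,
         SetNArr ''p'' (NVar ''z'') (NAdd (NVar ''y'') (NConst 1)),
         SetNArr ''c'' (NAdd (NArr ''w'' (NVar ''y'')) (NArr ''g'' (NVar ''y''))) (NVar ''z''),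
         SetNArr ''q'' (NVar ''z'') (NArr ''g'' (NVar ''y'')),
         SetNArr ''g'' (NVar ''y'') (NAdd (NArr ''g'' (NVar ''y'')) (NConst 1)),
         SetNArr ''r'' (NVar ''h'') (NVar ''y'')])
       (seq [
         SetNArr ''r'' (NVar ''j'') (NVar ''y''),
         SetNVar ''j'' (NAdd (NVar ''j'') (NConst 1)),
         SetNArr ''b'' (NArr ''g'' (NVar ''y'')) (NVar ''j'')])]"

definition link_prog :: prog where
  "link_prog = seq [SetNVar ''i'' (NConst 0), SetNVar ''j'' (NConst 0),
     Loop (NLess (NVar ''i'') (NVar ''R'')) link_step, SetNVar ''R'' (NVar ''j'')]"

text \<open>Positions below \<open>j\<close> hold the new root list, positions from \<open>i\<close> on the unprocessed roots;
  bucket \<open>b n\<close> holds the successor of the position of an unpaired new root of degree \<open>n\<close>.\<close>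

definition linking :: "nat \<Rightarrow> nat set \<Rightarrow> nat \<Rightarrow> nat \<Rightarrow> nat \<Rightarrow> nat \<Rightarrow> store \<Rightarrow> bool" where
  "linking N H D i j R \<s> \<longleftrightarrow>
     fib N H (Par \<s>) (Deg \<s>) (Mark \<s>) (Kid \<s>)
       (Pos \<s>) (Key \<s>) N \<and>
     bij_betw (Root \<s>) ({..<j} \<union> {i..<R}) {x \<in> H. Par \<s> x = 0} \<and>
     j \<le> i \<and> i \<le> R \<and>
     (\<forall>n l. Bucket \<s> n = Suc l \<longrightarrow> l < j \<and> Deg \<s> (Root \<s> l) = n) \<and>
     2 * j \<le> i + card {n. n < D \<and> Bucket \<s> n \<noteq> 0}"

text \<open>For \<open>2 * j \<le> i +\<close> (occupied buckets), a new entry of the root list adds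
  two on the left, and on the right one processed root and one occupied bucket. A link leaves both
  sides unchanged: one more processed root, one bucket less.\<close>

lemma linking_open:
  assumes I: "linking N H D i j R \<s>" and D: "N < 2 ^ q" "D = 3 * q" and i: "i < R"
    and y: "y = Root \<s> i" and b: "Bucket \<s> (Deg \<s> y) = 0"
    and s': "Root \<s>' = (Root \<s>)(j := y)"
      "Bucket \<s>' = (Bucket \<s>)(Deg \<s> y := Suc j)"
      "Par \<s>' = Par \<s>"
      "Deg \<s>' = Deg \<s>" "Mark \<s>' = Mark \<s>"
      "Kid \<s>' = Kid \<s>" "Pos \<s>' = Pos \<s>"
      "Key \<s>' = Key \<s>"
  shows "linking N H D (Suc i) (Suc j) R \<s>'"
proof -
  let ?g = "Deg \<s>" and ?b = "Bucket \<s>" and ?r = "Root \<s>"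
  let ?S = "{..<j} \<union> {i..<R}"
  have f: "fib N H (Par \<s>) ?g (Mark \<s>) (Kid \<s>)
       (Pos \<s>) (Key \<s>) N"
    and bij: "bij_betw ?r ?S {x \<in> H. Par \<s> x = 0}"
    and ji: "j \<le> i" and bk: "\<And>n l. ?b n = Suc l \<Longrightarrow> l < j \<and> ?g (?r l) = n"
    and cnt: "2 * j \<le> i + card {n. n < D \<and> ?b n \<noteq> 0}"
    using I by (auto simp: linking_def)
  have "y \<in> H" using bij i y by (auto simp: bij_betw_def)
  moreover have "N \<notin> H" using fib_sub[OF f] by auto
  \<comment> \<open>The degree bound puts the bucket among the first \<open>D\<close>, the only ones
    that are counted.\<close>
  ultimately have gD: "?g y < D" using fib_degree_bound[OF f _ D(1)] D(2) by simp
  have "bij_betw (?r(j := ?r i)) ({..<Suc j} \<union> {Suc i..<R}) {x \<in> H. Par \<s> x = 0}"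
  proof (cases "i = j")
    case True
    then have "{..<Suc j} \<union> {Suc i..<R} = ?S" using i by auto
    then show ?thesis using bij True by simp
  next
    case False
    have S: "{..<Suc j} \<union> {Suc i..<R} = insert j (?S - {i})" "j \<notin> ?S" "i \<in> ?S" using ji False i by auto
    show ?thesis unfolding S(1) by (rule bij_betw_shift[OF bij S(3,2)])
  qed
  moreover have "2 * Suc j \<le> Suc i + card {n. n < D \<and> (?b(?g y := Suc j)) n \<noteq> 0}"
  proof -
    have "{n. n < D \<and> (?b(?g y := Suc j)) n \<noteq> 0} = insert (?g y) {n. n < D \<and> ?b n \<noteq> 0}"
      using gD by auto
    then show ?thesis using cnt b by simp
  qed
  moreover have "l < Suc j \<and> ?g ((?r(j := y)) l) = n" if "(?b(?g y := Suc j)) n = Suc l" for n l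
    using that bk[of n l] by (auto split: if_splits)
  ultimately show ?thesis using f i ji unfolding linking_def s' y by simp
qed

lemma linking_link:
  assumes I: "linking N H D i j R \<s>" and D: "N < 2 ^ q" "D = 3 * q" and i: "i < R"
    and n: "n = Deg \<s> (Root \<s> i)" and b: "Bucket \<s> n = Suc h"
    and yz: "(y, z) = (Root \<s> i, Root \<s> h) \<or> (z, y) = (Root \<s> i, Root \<s> h)"
      "Key \<s> y \<le> Key \<s> z"
    and s': "Root \<s>' = (Root \<s>)(h := y)"
      "Bucket \<s>' = (Bucket \<s>)(n := 0)"
      "Par \<s>' = (Par \<s>)(z := Suc y)"
      "Deg \<s>' = (Deg \<s>)(y := Suc n)" "Mark \<s>' = Mark \<s>"
      "Kid \<s>' = (Kid \<s>)(y * N + n := z)"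
      "Pos \<s>' = (Pos \<s>)(z := n)"
      "Key \<s>' = Key \<s>"
  shows "linking N H D (Suc i) j R \<s>'"
proof -
  let ?g = "Deg \<s>" and ?b = "Bucket \<s>" and ?r = "Root \<s>" and ?p = "Par \<s>"
  let ?S = "{..<j} \<union> {i..<R}"
  have f: "fib N H ?p ?g (Mark \<s>) (Kid \<s>)
       (Pos \<s>) (Key \<s>) N"
    and bij: "bij_betw ?r ?S {x \<in> H. ?p x = 0}"
    and ji: "j \<le> i" and bk: "\<And>n l. ?b n = Suc l \<Longrightarrow> l < j \<and> ?g (?r l) = n"
    and cnt: "2 * j \<le> i + card {n. n < D \<and> ?b n \<noteq> 0}"
    using I by (auto simp: linking_def)
  note hj = bk[OF b]
  have inj: "inj_on ?r ?S" and img: "?r ` ?S = {x \<in> H. ?p x = 0}" using bij by (auto simp: bij_betw_def)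
  have S: "i \<in> ?S" "h \<in> ?S" "i \<noteq> h" using i hj ji by auto
  have ih: "?r i \<in> H" "?r h \<in> H" "?p (?r i) = 0" "?p (?r h) = 0" "?r i \<noteq> ?r h"
    using img S inj_on_eq_iff[OF inj S(1,2)] by blast+
  have y: "y \<in> H" "?p y = 0" "?g y = n" and z: "z \<in> H" "?p z = 0" "?g z = n" and yz': "y \<noteq> z"
    using yz(1) ih n hj by auto
  have NH: "N \<notin> H" using fib_sub[OF f] by auto
  then have nD: "n < D" using fib_degree_bound[OF f _ D(1)] D(2) y by auto
  have S': "?S - {i} = {..<j} \<union> {Suc i..<R}" using ji by auto
  have roots: "{x \<in> H. (?p(z := Suc y)) x = 0} = {x \<in> H. ?p x = 0} - {z}" by auto
  have "bij_betw (?r(h := y)) (?S - {i}) ({x \<in> H. ?p x = 0} - {z})"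
  proof (cases "y = ?r i")
    case True
    then show ?thesis using bij_betw_move[OF bij S] yz(1) ih(5) by auto
  next
    case False
    then have "y = ?r h" "z = ?r i" using yz(1) by auto
    then have "?r(h := y) = ?r" "z = ?r i" by auto
    then show ?thesis using bij_betw_remove[OF bij S(1)] by simp
  qed
  moreover have "2 * j \<le> Suc i + card {l. l < D \<and> (?b(n := 0)) l \<noteq> 0}"
  proof -
    have "{l. l < D \<and> ?b l \<noteq> 0} = insert n {l. l < D \<and> (?b(n := 0)) l \<noteq> 0}"
      using nD b by auto
    then have "card {l. l < D \<and> ?b l \<noteq> 0} = Suc (card {l. l < D \<and> (?b(n := 0)) l \<noteq> 0})" by simp
    then show ?thesis using cnt by simp
  qed
  moreover have "l < j \<and> (?g(y := Suc n)) ((?r(h := y)) l) = m" if "(?b(n := 0)) m = Suc l" for m l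
  proof -
    have m: "m \<noteq> n" "?b m = Suc l" using that by (auto split: if_splits)
    note l = bk[OF m(2)]
    have "l \<noteq> h" using l hj m(1) by auto
    moreover have "?r l \<noteq> y" using l y m by auto
    ultimately show ?thesis using l by simp
  qed
  moreover have "fib N H (?p(z := Suc y)) (?g(y := Suc n)) (Mark \<s>) ((Kid \<s>)(y * N + n := z))
      ((Pos \<s>)(z := n)) (Key \<s>) N"
    using fib_link[OF f disjI1[OF NH] y(1) z(1) yz' y(2) z(2) _ yz(2)] y z by simp
  ultimately show ?thesis using i ji unfolding linking_def s' roots S' by simp
qed

lemma wp_link:
  assumes h: "heap N N H \<s>" and b: "\<And>n. Bucket \<s> n = 0" and D: "N < 2 ^ q" "D = 3 * q"
  shows "wp link_prog (\<lambda>\<s>' \<tau>'. heap N N H \<s>' \<and> 2 * VR \<s>' \<le> VR \<s> + D \<and>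
     (\<forall>n l. Bucket \<s>' n = Suc l \<longrightarrow>
        l < VR \<s>' \<and> Deg \<s>' (Root \<s>' l) = n) \<and>
     \<tau>' \<le> \<tau> + 17 * VR \<s> + 4) \<s> \<tau>"
proof -
  let ?R = "VR \<s>"
  let ?I = "\<lambda>\<s>' \<tau>'. linking N H D (Vi \<s>') (Vj \<s>') ?R \<s>' \<and>
    \<tau>' \<le> \<tau> + 2 + 17 * Vi \<s>'"
  show ?thesis
    unfolding link_prog_def seq.simps wp_Seq wp_SetNVar
  proof (rule wp_Loop_frame[where I = ?I and K = "\<tau> + 2 + 17 * ?R"], goal_cases)
    case 1
    then show ?case using heapD[OF h] b by (simp add: linking_def lessThan_atLeast0)
  next
    case (2 \<s>' \<tau>')
    then show ?case by (auto simp: linking_def)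
  next
    case (3 \<s>' \<tau>')
    note u = unchangedD[OF 3(2), unfolded link_step_def, simplified]
    let ?i = "Vi \<s>'" and ?j = "Vj \<s>'"
    have I: "linking N H D ?i ?j ?R \<s>'" "\<tau>' \<le> \<tau> + 2 + 17 * ?i" using 3(1) by auto
    have i: "?i < ?R" using 3(3) u by simp
    let ?y = "Root \<s>' ?i" let ?n = "Deg \<s>' ?y"
    show ?case
    proof (cases "Bucket \<s>' ?n")
      case 0
      let ?Q = "\<lambda>(\<s>'' :: store) \<tau>''. \<tau>'' \<le> \<tau>' + 17 \<and> Vi \<s>'' = Suc ?i \<and> Vj \<s>'' = Suc ?j \<and>
        Root \<s>'' = (Root \<s>')(?j := ?y) \<and>
        Bucket \<s>'' = (Bucket \<s>')(?n := Suc ?j) \<and>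
        Par \<s>'' = Par \<s>' \<and>
        Deg \<s>'' = Deg \<s>' \<and> Mark \<s>'' = Mark \<s>' \<and>
        Kid \<s>'' = Kid \<s>' \<and> Pos \<s>'' = Pos \<s>' \<and>
        Key \<s>'' = Key \<s>'"
      have "wp link_step ?Q \<s>' (Suc \<tau>')" using 0 by (simp add: link_step_def)
      then show ?thesis
      proof (rule wp_mono)
        fix \<s>'' \<tau>'' assume Q: "?Q \<s>'' \<tau>''"
        have "linking N H D (Suc ?i) (Suc ?j) ?R \<s>''"
          using Q by (intro linking_open[OF I(1) D i refl 0]) simp_all
        then show "?I \<s>'' \<tau>''" using Q I(2) by simp
      qed
    next
      case (Suc h)
      define z where "z = Root \<s>' h"
      define sw where "sw \<longleftrightarrow> Key \<s>' z < Key \<s>' ?y"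
      define y' where "y' = (if sw then z else ?y)"
      define z' where "z' = (if sw then ?y else z)"
      have gz: "Deg \<s>' z = ?n" using I(1) Suc by (simp add: linking_def z_def)
      have "z \<in> H" "?y \<in> H" using I(1) Suc i by (auto simp: linking_def z_def bij_betw_def)
      moreover have "\<And>x. x < N \<Longrightarrow> Row \<s>' x = x * N" using u heapD(3)[OF h] by simp
      ultimately have w: "Row \<s>' z = z * N" "Row \<s>' ?y = ?y * N"
        using subsetD[OF fib_sub[OF conjunct1[OF I(1)[unfolded linking_def]]]] by auto
      let ?Q = "\<lambda>(\<s>'' :: store) \<tau>''. \<tau>'' \<le> \<tau>' + 17 \<and> Vi \<s>'' = Suc ?i \<and> Vj \<s>'' = ?j \<and>
        Root \<s>'' = (Root \<s>')(h := y') \<and>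
        Bucket \<s>'' = (Bucket \<s>')(?n := 0) \<and>
        Par \<s>'' = (Par \<s>')(z' := Suc y') \<and>
        Deg \<s>'' = (Deg \<s>')(y' := Suc ?n) \<and> Mark \<s>'' = Mark \<s>' \<and>
        Kid \<s>'' = (Kid \<s>')(y' * N + ?n := z') \<and>
        Pos \<s>'' = (Pos \<s>')(z' := ?n) \<and>
        Key \<s>'' = Key \<s>'"
      have "wp link_step ?Q \<s>' (Suc \<tau>')"
        using Suc gz w by (simp add: link_step_def z_def[symmetric] sw_def[symmetric] y'_def z'_def)
      then show ?thesis
      proof (rule wp_mono)
        fix \<s>'' \<tau>'' assume Q: "?Q \<s>'' \<tau>''"
        have "(y', z') = (?y, Root \<s>' h) \<or> (z', y') = (?y, Root \<s>' h)"
          "Key \<s>' y' \<le> Key \<s>' z'"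
          by (auto simp: y'_def z'_def z_def sw_def)
        then have "linking N H D (Suc ?i) ?j ?R \<s>''"
          using Q by (intro linking_link[OF I(1) D i refl Suc, of y' z']) simp_all
        then show "?I \<s>'' \<tau>''" using Q I(2) by simp
      qed
    qed
  next
    case (4 \<s>' \<tau>')
    note u = unchangedD[OF 4(2), unfolded link_step_def, simplified]
    let ?j = "Vj \<s>'"
    have I: "linking N H D ?R ?j ?R \<s>'" "\<tau>' \<le> \<tau> + 2 + 17 * ?R" using 4(1,3) u
      by (auto simp: linking_def)
    have "card {n. n < D \<and> Bucket \<s>' n \<noteq> 0} \<le> card {..<D}" by (intro card_mono) auto
    then have "2 * ?j \<le> ?R + D" using I(1) by (simp add: linking_def)
    moreover have "heap N N H (\<s>'\<lparr>nat_var := (nat_var \<s>')(''R'' := ?j)\<rparr>)"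
      using I(1) heapD(3)[OF h] u unfolding heap_def linking_def by simp
    ultimately show ?case using I by (simp add: linking_def)
  qed
qed

definition clear_step :: prog where
  "clear_step = seq [SetNArr ''b'' (NArr ''g'' (NArr ''r'' (NVar ''i''))) (NConst 0),
     SetNVar ''i'' (NAdd (NVar ''i'') (NConst 1))]"

definition clear_prog :: prog where
  "clear_prog = seq [SetNVar ''i'' (NConst 0), Loop (NLess (NVar ''i'') (NVar ''R'')) clear_step]"

text \<open>Every nonzero bucket sits at the degree of a listed root, so a walk over the roots
  clears them all. A sweep over the array itself would not be paid for by the potential.\<close>

lemma wp_clear:
  assumes "\<forall>n l. Bucket \<s> n = Suc l \<longrightarrow>
        l < VR \<s> \<and> Deg \<s> (Root \<s> l) = n"
  shows "wp clear_prog (\<lambda>\<s>' \<tau>'. (\<forall>n. Bucket \<s>' n = 0) \<and> \<tau>' \<le> \<tau> + 3 * VR \<s> + 2) \<s> \<tau>"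
proof -
  let ?R = "VR \<s>"
  let ?I = "\<lambda>(\<s>' :: store) \<tau>'. (\<forall>n l. Bucket \<s>' n = Suc l \<longrightarrow>
      Vi \<s>' \<le> l \<and> l < ?R \<and> Deg \<s> (Root \<s> l) = n) \<and>
    Vi \<s>' \<le> ?R \<and> \<tau>' \<le> \<tau> + 1 + 3 * Vi \<s>'"
  show ?thesis
    unfolding clear_prog_def seq.simps wp_Seq wp_SetNVar
  proof (rule wp_Loop_frame[where I = ?I and K = "\<tau> + 1 + 3 * ?R"], goal_cases)
    case 1
    then show ?case using assms by simp
  next
    case (3 \<s>' \<tau>')
    note u = unchangedD[OF 3(2), unfolded clear_step_def, simplified]
    have "Suc (Vi \<s>') \<le> l" if "Bucket \<s>' n = Suc l"
      "n \<noteq> Deg \<s> (Root \<s> (Vi \<s>'))" for n l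
      using 3(1) that by (metis Suc_leI order_le_imp_less_or_eq)
    then show ?case using 3(1,3) by (auto simp: clear_step_def u)
  next
    case (4 \<s>' \<tau>')
    note u = unchangedD[OF 4(2), unfolded clear_step_def, simplified]
    have "Bucket \<s>' n = 0" for n 
    proof (cases "Bucket \<s>' n")
      case (Suc l)
      then have "Vi \<s>' \<le> l" "l < VR \<s>" using 4(1) by auto
      then show ?thesis using 4(3) u(1)[of "''R''"] by simp
    qed
    then show ?case using 4(1,3) u by auto
  qed auto
qed

definition pop_prog :: prog where
  "pop_prog = seq [min_prog, SetNVar ''x'' (NArr ''r'' (NVar ''i'')), kids_prog,
     SetNVar ''R'' (NSub (NVar ''R'') (NConst 1)),
     SetNArr ''r'' (NVar ''i'') (NArr ''r'' (NVar ''R'')),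
     link_prog, clear_prog]"

lemma wp_pop:
  assumes h: "heap N N H \<s>" and b: "\<And>n. Bucket \<s> n = 0" and D: "N < 2 ^ q" "D = 3 * q"
    and R: "0 < VR \<s>"
  shows "wp pop_prog (\<lambda>\<s>' \<tau>'. \<exists>x\<in>H. Vx \<s>' = x \<and>
      (\<forall>v\<in>H. Key \<s> x \<le> Key \<s> v) \<and>
      heap N N (H - {x}) \<s>' \<and> (\<forall>n. Bucket \<s>' n = 0) \<and>
      \<tau>' + 60 * pot (H - {x}) \<s>' \<le> \<tau> + 60 * pot H \<s> + 103 * D + 20) \<s> \<tau>" (is "wp _ ?Q _ _")
  unfolding pop_prog_def seq.simps wp_Seq
proof (rule wp_frame[OF wp_min[OF R]], goal_cases)
  case (1 \<s>1 \<tau>1)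
  note m = 1(1) and u1 = unchangedD[OF 1(2), unfolded min_prog_def min_step_def, simplified]
  note f = heapD(1)[OF h] and bij = heapD(2)[OF h]
  have N: "N \<notin> H" using fib_sub[OF f] by auto
  let ?i = "Vi \<s>1"
  define x where "x = Root \<s> ?i"
  have x: "x \<in> H" "Par \<s> x = 0" using bij m by (auto simp: bij_betw_def x_def)
  have min: "Key \<s> x \<le> Key \<s> v" if "v \<in> H" for v
  proof -
    obtain r where r: "r \<in> H" "Par \<s> r = 0" "Key \<s> r \<le> Key \<s> v"
      using fib_root_below[OF f disjI1[OF N] \<open>v \<in> H\<close>] by blast
    then obtain l where "l < VR \<s>" "r = Root \<s> l"
      using bij by (auto simp: bij_betw_def image_iff set_eq_iff)
    then show ?thesis using m r unfolding x_def by fastforce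
  qed
  have gD: "Deg \<s> x < D" using fib_degree_bound[OF f disjI1[OF N] D(1) x(1)] D(2) by simp
  let ?\<s>1 = "\<s>1\<lparr>nat_var := (nat_var \<s>1)(''x'' := x)\<rparr>"
  have h1: "heap N N H ?\<s>1" and p1: "pot H ?\<s>1 = pot H \<s>" using h by (simp_all add: heap_def pot_def u1)
  have "wp kids_prog (wp (SetNVar ''R'' (NSub (NVar ''R'') (NConst 1)))
     (wp (SetNArr ''r'' (NVar ''i'') (NArr ''r'' (NVar ''R''))) (wp link_prog (wp clear_prog ?Q)))) ?\<s>1 (Suc \<tau>1)"
  proof (rule wp_frame[OF wp_kids[OF h1 x(1)]], goal_cases)
    show "Par ?\<s>1 x = 0" "Vx ?\<s>1 = x" using x u1 by simp_all
  next
    case (3 \<s>2 \<tau>2)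
    note k = 3(1) and u2 = unchangedD[OF 3(2), unfolded kids_prog_def kids_step_def cut_prog_def, simplified]
    let ?R = "VR \<s>2 - Suc 0"
    define \<s>3 where "\<s>3 = \<s>2\<lparr>nat_var := (nat_var \<s>2)(''R'' := ?R),
      nat_arr := (nat_arr \<s>2)(''r'' := (Root \<s>2)(?i := Root \<s>2 ?R))\<rparr>"
    have i2: "Vi \<s>2 = ?i" using u2 by simp
    have *: "?i < VR \<s>2" "Root \<s>2 ?i = x" using k m u1 x_def by auto
    have h3: "heap N N (H - {x}) \<s>3" and p3: "pot (H - {x}) \<s>3 + 1 \<le> pot H \<s>2"
      using heap_remove[of N H \<s>2 x ?i \<s>3] k x(1) * by (simp_all add: \<s>3_def)
    have b3: "Bucket \<s>3 n = 0" for n using b u1 u2 by (simp add: \<s>3_def)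
    have "wp link_prog (wp clear_prog ?Q) \<s>3 (\<tau>2 + 2)"
    proof (rule wp_frame[OF wp_link[OF h3 b3 D]], goal_cases)
      case (1 \<s>4 \<tau>4)
      note l = 1(1) and u4 = unchangedD[OF 1(2), unfolded link_prog_def link_step_def, simplified]
      show ?case
      proof (rule wp_frame[OF wp_clear], goal_cases)
        case (2 \<s>5 \<tau>5)
        note c = 2(1) and u5 = unchangedD[OF 2(2), unfolded clear_prog_def clear_step_def, simplified]
        have x5: "Vx \<s>5 = x" using u5 u4 u2 by (simp add: \<s>3_def)
        have h5: "heap N N (H - {x}) \<s>5" using l by (simp add: heap_def u5)
        define S where "S = (\<Sum>x\<in>H - {x}. Mark \<s>3 x)"
        have p5: "pot (H - {x}) \<s>5 = VR \<s>4 + 2 * S" "pot (H - {x}) \<s>3 = VR \<s>3 + 2 * S"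
          by (simp_all add: pot_def u5 u4 S_def)
        have "VR \<s> \<le> VR \<s>3 + 1" using k u1 *(1) by (simp add: \<s>3_def)
        \<comment> \<open>Of the 103, fewer than \<open>D\<close> children account for 71 each. A
          root that survives linking costs 60 in potential and 3 for clearing, and there are at most
          half of \<open>VR \<s>3 + D\<close> of them, which adds 31.5 per unit of \<open>D\<close>.
          Each root before linking releases 60, enough for the other half of these costs, 17 for
          linking and 4 for the scan.\<close>
        then have "\<tau>5 + 60 * pot (H - {x}) \<s>5 \<le> \<tau> + 60 * pot H \<s> + 103 * D + 20"
          using c l k m p1 p3 p5 gD u1 by simp
        then show ?case
          using x(1) min h5 c x5 by blast
      qed (use l in blast)
    qed
    then show ?case
      by (simp add: \<s>3_def i2)
  qed
  then show ?case
    by (simp add: x_def u1)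
qed

section \<open>Dijkstra's algorithm\<close>

lemma heap_set_nat_var [simp]:
  "x \<noteq> ''R'' \<Longrightarrow> heap N y0 H (\<s>\<lparr>nat_var := (nat_var \<s>)(x := v)\<rparr>) \<longleftrightarrow> heap N y0 H \<s>"
  "x \<noteq> ''R'' \<Longrightarrow> pot H (\<s>\<lparr>nat_var := (nat_var \<s>)(x := v)\<rparr>) = pot H \<s>"
  by (simp_all add: heap_def pot_def)

text \<open>The arcs are stored in compressed rows, grouped by their heads; \<open>lab\<close> is
  the edge behind an arc, and an undirected edge yields an arc in each direction. With
  \<open>thr\<close> as a parameter, every round instantiates the same arrays at its own threshold,
  and arcs at or above it are skipped rather than deleted.\<close>

locale csr =
  fixes N :: nat and off src lab dst :: "nat \<Rightarrow> nat" and chat d :: "nat \<Rightarrow> real" and t :: nat and thr :: real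
  assumes target: "t < N"
    and off_mono: "v < N \<Longrightarrow> off v \<le> off (Suc v)"
    and arc: "v < N \<Longrightarrow> off v \<le> i \<Longrightarrow> i < off (Suc v) \<Longrightarrow> src i < N \<and> dst i = v \<and> 0 \<le> chat (lab i)"
begin

text \<open>
  The arcs into removed nodes are relaxed, except that into \<open>x\<close> only those of index below \<open>b\<close> are;
  \<open>x = N\<close> if no node is being scanned, and \<open>c\<close> is the next removal stamp.
\<close>

definition dij :: "(nat \<Rightarrow> nat) \<Rightarrow> (nat \<Rightarrow> real) \<Rightarrow> (nat \<Rightarrow> nat) \<Rightarrow> nat \<Rightarrow> nat \<Rightarrow> nat \<Rightarrow> bool" where
  "dij f k nx c x b \<longleftrightarrow> 2 \<le> c \<and> (\<forall>v<N. f v < c) \<and> 1 \<le> f t \<and> k t = 0 \<and>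
     (\<forall>v<N. 1 \<le> f v \<longrightarrow> 0 \<le> k v) \<and>
     (\<forall>v<N. 1 \<le> f v \<and> v \<noteq> t \<longrightarrow> (\<exists>w<N. off w \<le> nx v \<and> nx v < off (Suc w) \<and> src (nx v) = v \<and>
        d (lab (nx v)) < thr \<and> 2 \<le> f w \<and> (2 \<le> f v \<longrightarrow> f w < f v) \<and> k v = chat (lab (nx v)) + k w)) \<and>
     (\<forall>u<N. \<forall>v<N. 2 \<le> f u \<and> f v = 1 \<longrightarrow> k u \<le> k v) \<and>
     (\<forall>u<N. \<forall>i. 2 \<le> f u \<and> off u \<le> i \<and> i < off (Suc u) \<and> d (lab i) < thr \<and> (u = x \<longrightarrow> i < b) \<longrightarrow>
        1 \<le> f (src i) \<and> k (src i) \<le> chat (lab i) + k u)"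

lemma dij_init:
  assumes "\<And>v. v < N \<Longrightarrow> f v = (if v = t then 1 else 0)" "k t = 0"
  shows "dij f k nx 2 N 0"
  using assms target unfolding dij_def by auto

text \<open>The second claim, that no removed node has a larger key than \<open>x\<close>, later
  protects the removed nodes: as costs are nonnegative, no arc into \<open>x\<close> can improve
  them.\<close>

lemma dij_pop:
  assumes D: "dij f k nx c N 0" and x: "x < N" "f x = 1" and min: "\<And>v. v < N \<Longrightarrow> f v = 1 \<Longrightarrow> k x \<le> k v"
  shows "dij (f(x := c)) k nx (Suc c) x (off x)"
    and "\<And>u. u < N \<Longrightarrow> 2 \<le> (f(x := c)) u \<Longrightarrow> k u \<le> k x"
proof -
  from D have c: "2 \<le> c" "\<And>v. v < N \<Longrightarrow> f v < c" "1 \<le> f t" "k t = 0"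
    and nn: "\<And>v. v < N \<Longrightarrow> 1 \<le> f v \<Longrightarrow> 0 \<le> k v"
    and tree: "\<And>v. v < N \<Longrightarrow> 1 \<le> f v \<Longrightarrow> v \<noteq> t \<Longrightarrow> \<exists>w<N. off w \<le> nx v \<and> nx v < off (Suc w) \<and> src (nx v) = v \<and>
        d (lab (nx v)) < thr \<and> 2 \<le> f w \<and> (2 \<le> f v \<longrightarrow> f w < f v) \<and> k v = chat (lab (nx v)) + k w"
    and ord: "\<And>u v. u < N \<Longrightarrow> v < N \<Longrightarrow> 2 \<le> f u \<Longrightarrow> f v = 1 \<Longrightarrow> k u \<le> k v"
    and rel: "\<And>u i. u < N \<Longrightarrow> 2 \<le> f u \<Longrightarrow> off u \<le> i \<Longrightarrow> i < off (Suc u) \<Longrightarrow> d (lab i) < thr \<Longrightarrow>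
        1 \<le> f (src i) \<and> k (src i) \<le> chat (lab i) + k u"
    unfolding dij_def by auto
  let ?f = "f(x := c)"
  have one: "1 \<le> ?f v \<longleftrightarrow> 1 \<le> f v" for v using c(1) x(2) by auto
  have "\<exists>w<N. off w \<le> nx v \<and> nx v < off (Suc w) \<and> src (nx v) = v \<and>
        d (lab (nx v)) < thr \<and> 2 \<le> ?f w \<and> (2 \<le> ?f v \<longrightarrow> ?f w < ?f v) \<and> k v = chat (lab (nx v)) + k w"
    if "v < N" "1 \<le> ?f v" "v \<noteq> t" for v
  proof -
    have v: "1 \<le> f v" using that one by blast
    from tree[OF that(1) v that(3)] obtain w where w: "w < N" "off w \<le> nx v" "nx v < off (Suc w)" "src (nx v) = v"
        "d (lab (nx v)) < thr" "2 \<le> f w" "2 \<le> f v \<longrightarrow> f w < f v" "k v = chat (lab (nx v)) + k w" by blast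
    have "w \<noteq> x" using w(6) x(2) by auto
    then show ?thesis using w c(2)[of w] by (intro exI[of _ w]) auto
  qed
  moreover have "k u \<le> k v" if "u < N" "v < N" "2 \<le> ?f u" "?f v = 1" for u v
    using that ord[of u v] min[of v] c(1) by (cases "u = x"; cases "v = x") auto
  moreover have "1 \<le> ?f (src i) \<and> k (src i) \<le> chat (lab i) + k u"
    if "u < N" "2 \<le> ?f u" "off u \<le> i" "i < off (Suc u)" "d (lab i) < thr" "u = x \<longrightarrow> i < off x" for u i
  proof -
    have "u \<noteq> x" using that by auto
    then show ?thesis using rel[of u i] that one by auto
  qed
  moreover have "?f v < Suc c" if "v < N" for v using c(2)[OF that] by auto
  ultimately show "dij ?f k nx (Suc c) x (off x)"
    using c nn one unfolding dij_def by (auto simp del: fun_upd_apply)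
  show "k u \<le> k x" if "u < N" "2 \<le> ?f u" for u
    using that ord[of u x] x by (cases "u = x") auto
qed

lemma dij_scan_end:
  assumes "dij f k nx c x (off (Suc x))"
  shows "dij f k nx c N 0"
  using assms unfolding dij_def by auto

lemma dij_skip:
  assumes D: "dij f k nx c x i"
    and "d (lab i) < thr \<Longrightarrow> 1 \<le> f (src i) \<and> k (src i) \<le> chat (lab i) + k x"
  shows "dij f k nx c x (Suc i)"
proof -
  have "1 \<le> f (src j) \<and> k (src j) \<le> chat (lab j) + k u"
    if "u < N" "2 \<le> f u" "off u \<le> j" "j < off (Suc u)" "d (lab j) < thr" "u = x \<longrightarrow> j < Suc i" for u j
  proof (cases "u = x \<and> j = i")
    case True
    then show ?thesis using assms(2) that by simp
  next
    case False
    then have "u = x \<longrightarrow> j < i" using that by auto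
    then show ?thesis using D that unfolding dij_def by blast
  qed
  then show ?thesis using D unfolding dij_def by blast
qed

text \<open>Inserting an unseen node and decreasing the key of a queued one update status, key and
  successor alike, so one lemma serves both.\<close>

lemma dij_improve:
  assumes D: "dij f k nx c x i" and x: "x < N" "2 \<le> f x" "\<And>u. u < N \<Longrightarrow> 2 \<le> f u \<Longrightarrow> k u \<le> k x"
    and i: "off x \<le> i" "i < off (Suc x)" "d (lab i) < thr"
    and y: "y = src i" "f y = 0 \<or> f y = 1 \<and> chat (lab i) + k x < k y"
    and n: "n = chat (lab i) + k x"
  shows "dij (f(y := 1)) (k(y := n)) (nx(y := i)) c x (Suc i)"
    and "\<And>u. u < N \<Longrightarrow> 2 \<le> (f(y := 1)) u \<Longrightarrow> (k(y := n)) u \<le> (k(y := n)) x"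
proof -
  from D have c: "2 \<le> c" "\<And>v. v < N \<Longrightarrow> f v < c" "1 \<le> f t" "k t = 0"
    and nn: "\<And>v. v < N \<Longrightarrow> 1 \<le> f v \<Longrightarrow> 0 \<le> k v"
    and tree: "\<And>v. v < N \<Longrightarrow> 1 \<le> f v \<Longrightarrow> v \<noteq> t \<Longrightarrow> \<exists>w<N. off w \<le> nx v \<and> nx v < off (Suc w) \<and> src (nx v) = v \<and>
        d (lab (nx v)) < thr \<and> 2 \<le> f w \<and> (2 \<le> f v \<longrightarrow> f w < f v) \<and> k v = chat (lab (nx v)) + k w"
    and ord: "\<And>u v. u < N \<Longrightarrow> v < N \<Longrightarrow> 2 \<le> f u \<Longrightarrow> f v = 1 \<Longrightarrow> k u \<le> k v"
    and rel: "\<And>u j. u < N \<Longrightarrow> 2 \<le> f u \<Longrightarrow> off u \<le> j \<Longrightarrow> j < off (Suc u) \<Longrightarrow> d (lab j) < thr \<Longrightarrow>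
        (u = x \<Longrightarrow> j < i) \<Longrightarrow> 1 \<le> f (src j) \<and> k (src j) \<le> chat (lab j) + k u"
    unfolding dij_def by auto
  have a: "y < N" "0 \<le> chat (lab i)" using arc[OF x(1) i(1,2)] y by auto
  have kn: "k x \<le> n" "0 \<le> n" using a n nn[OF x(1)] x(2) by auto
  have yx: "y \<noteq> x" using y(2) x(2) by auto
  \<comment> \<open>\<open>t\<close> has been seen and has key 0, and the new key is nonnegative, so
    \<open>t\<close> is never improved.\<close>
  have yt: "y \<noteq> t" using y(2) c(3,4) kn(2) n by auto
  let ?f = "f(y := 1)" and ?k = "k(y := n)" and ?x = "nx(y := i)"
  have two: "2 \<le> ?f u \<longleftrightarrow> 2 \<le> f u" "2 \<le> f u \<Longrightarrow> u \<noteq> y" for u using y(2) by auto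
  show "?k u \<le> ?k x" if "u < N" "2 \<le> ?f u" for u
    using x(3)[of u] that two yx by auto
  have "\<exists>w<N. off w \<le> ?x v \<and> ?x v < off (Suc w) \<and> src (?x v) = v \<and>
        d (lab (?x v)) < thr \<and> 2 \<le> ?f w \<and> (2 \<le> ?f v \<longrightarrow> ?f w < ?f v) \<and> ?k v = chat (lab (?x v)) + ?k w"
    if v: "v < N" "1 \<le> ?f v" "v \<noteq> t" for v
  proof (cases "v = y")
    case True
    then show ?thesis using i x yx y(1) n two by (intro exI[of _ x]) auto
  next
    case False
    then have "1 \<le> f v" using v by simp
    from tree[OF v(1) this v(3)] obtain w where w: "w < N" "off w \<le> nx v" "nx v < off (Suc w)" "src (nx v) = v"
        "d (lab (nx v)) < thr" "2 \<le> f w" "2 \<le> f v \<longrightarrow> f w < f v" "k v = chat (lab (nx v)) + k w" by blast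
    then show ?thesis using False two(2)[of w] by (intro exI[of _ w]) auto
  qed
  moreover have "?k u \<le> ?k v" if "u < N" "v < N" "2 \<le> ?f u" "?f v = 1" for u v
    using that ord[of u v] x(3)[of u] kn two[of u] by (cases "v = y") auto
  moreover have "1 \<le> ?f (src j) \<and> ?k (src j) \<le> chat (lab j) + ?k u"
    if u: "u < N" "2 \<le> ?f u" "off u \<le> j" "j < off (Suc u)" "d (lab j) < thr" "u = x \<longrightarrow> j < Suc i" for u j
  proof (cases "u = x \<and> j = i")
    case True
    then show ?thesis using y n yx by simp
  next
    case False
    then have "1 \<le> f (src j) \<and> k (src j) \<le> chat (lab j) + k u"
      using rel[of u j] u two by auto
    \<comment> \<open>An arc out of \<open>y\<close> that was relaxed before stays relaxed:
      \<open>y\<close> was queued already, and its key only goes down.\<close>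
    then show ?thesis using y(2) n two[of u] u(2) by (cases "src j = y") auto
  qed
  moreover have "?f v < c" if "v < N" for v using c(1) c(2)[OF that] by auto
  moreover have "0 \<le> ?k v" if "v < N" "1 \<le> ?f v" for v using nn that kn by auto
  ultimately show "dij ?f ?k ?x c x (Suc i)"
    using c yt unfolding dij_def by (auto simp del: fun_upd_apply simp: fun_upd_other)
qed

definition graph_store :: "store \<Rightarrow> bool" where
  "graph_store \<s> \<longleftrightarrow> VN \<s> = N \<and> Vt \<s> = t \<and> RT \<s> = thr \<and>
     Off \<s> = off \<and> Src \<s> = src \<and> Lab \<s> = lab \<and> Dst \<s> = dst \<and>
     Chat \<s> = chat \<and> Weight \<s> = d \<and> (\<forall>x<N. Row \<s> x = x * N)"

abbreviation (input) queued :: "store \<Rightarrow> nat set" where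
  "queued \<s> \<equiv> {v. v < N \<and> Status \<s> v = 1}"

end

section \<open>Relaxing arcs and the main loop of the search\<close>

definition insert_prog :: prog where
  "insert_prog = seq [
     SetNArr ''f'' (NVar ''y'') (NConst 1), SetRArr ''k'' (NVar ''y'') (RVar ''n''),
     SetNArr ''p'' (NVar ''y'') (NConst 0), SetNArr ''g'' (NVar ''y'') (NConst 0),
     SetNArr ''m'' (NVar ''y'') (NConst 0), SetNArr ''r'' (NVar ''R'') (NVar ''y''),
     SetNVar ''R'' (NAdd (NVar ''R'') (NConst 1))]"

definition relax_step :: prog where
  "relax_step = seq [
     Cond (RLess (RArr ''d'' (NArr ''e'' (NVar ''i''))) (RVar ''T''))
       (seq [
         SetNVar ''y'' (NArr ''u'' (NVar ''i'')),
         SetRVar ''n'' (RAdd (RArr ''chat'' (NArr ''e'' (NVar ''i''))) (RArr ''k'' (NVar ''x''))),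
         Cond (NEq (NArr ''f'' (NVar ''y'')) (NConst 0))
           (seq [SetNArr ''x'' (NVar ''y'') (NVar ''i''), insert_prog])
           (Cond (TAnd (NEq (NArr ''f'' (NVar ''y'')) (NConst 1)) (RLess (RVar ''n'') (RArr ''k'' (NVar ''y''))))
             (seq [SetNArr ''x'' (NVar ''y'') (NVar ''i''), SetRArr ''k'' (NVar ''y'') (RVar ''n''), cascade_prog])
             Skip)])
       Skip,
     SetNVar ''i'' (NAdd (NVar ''i'') (NConst 1))]"

definition scan_prog :: prog where
  "scan_prog = seq [
     SetNVar ''i'' (NArr ''a'' (NVar ''x'')),
     SetNVar ''h'' (NArr ''a'' (NAdd (NVar ''x'') (NConst 1))),
     Loop (NLess (NVar ''i'') (NVar ''h'')) relax_step]"

definition clear_status_step :: prog where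
  "clear_status_step = seq [SetNArr ''f'' (NVar ''i'') (NConst 0), SetNVar ''i'' (NAdd (NVar ''i'') (NConst 1))]"

definition dijkstra_step :: prog where
  "dijkstra_step = seq [pop_prog, SetNArr ''f'' (NVar ''x'') (NVar ''F''),
     SetNVar ''F'' (NAdd (NVar ''F'') (NConst 1)), scan_prog]"

definition dijkstra_prog :: prog where
  "dijkstra_prog = seq [
     SetNVar ''i'' (NConst 0), Loop (NLess (NVar ''i'') (NVar ''N'')) clear_status_step,
     SetNVar ''R'' (NConst 0), SetNVar ''F'' (NConst 2),
     SetNVar ''y'' (NVar ''t''), SetRVar ''n'' (RConst 0), insert_prog,
     Loop (NLess (NConst 0) (NVar ''R'')) dijkstra_step]"

text \<open>67 is the sum of seven commands and one unit of potential for the new root.\<close>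

lemma wp_insert:
  assumes h: "heap N N H \<s>" and y: "y \<notin> H" "y < N" "Vy \<s> = y"
  shows "wp insert_prog (\<lambda>\<s>' \<tau>'. heap N N (insert y H) \<s>' \<and> Status \<s>' = (Status \<s>)(y := 1) \<and>
     Key \<s>' = (Key \<s>)(y := Rn \<s>) \<and>
     \<tau>' + 60 * pot (insert y H) \<s>' \<le> \<tau> + 60 * pot H \<s> + 67) \<s> \<tau>"
proof -
  note f = heapD(1)[OF h]
  have N: "N \<notin> H" using fib_sub[OF f] by auto
  have "{x \<in> insert y H. ((Par \<s>)(y := 0)) x = 0} = insert y {x \<in> H. Par \<s> x = 0}"
    by auto
  moreover have "y \<notin> {x \<in> H. Par \<s> x = 0}" using y(1) by simp
  ultimately have bij: "bij_betw ((Root \<s>)(VR \<s> := y)) {..<Suc (VR \<s>)}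
      {x \<in> insert y H. ((Par \<s>)(y := 0)) x = 0}"
    using bij_betw_push[OF heapD(2)[OF h]] by simp
  note ins = fib_insert[OF f disjI1[OF N] y(1,2), where nk = "Rn \<s>" and ?y1.0 = N]
  have sm: "(\<Sum>x\<in>insert y H. ((Mark \<s>)(y := 0)) x) = (\<Sum>x\<in>H. Mark \<s> x)"
    using y(1) fib_finite[OF f] by (auto intro: sum.cong)
  let ?Q = "\<lambda>(\<s>' :: store) \<tau>'. \<tau>' = \<tau> + 7 \<and>
      Status \<s>' = (Status \<s>)(y := 1) \<and>
      Key \<s>' = (Key \<s>)(y := Rn \<s>) \<and>
      Par \<s>' = (Par \<s>)(y := 0) \<and> Deg \<s>' = (Deg \<s>)(y := 0) \<and>
      Mark \<s>' = (Mark \<s>)(y := 0) \<and>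
      Root \<s>' = (Root \<s>)(VR \<s> := y) \<and>
      VR \<s>' = Suc (VR \<s>) \<and>
      Kid \<s>' = Kid \<s> \<and> Pos \<s>' = Pos \<s> \<and> Row \<s>' = Row \<s>"
  have "wp insert_prog ?Q \<s> \<tau>" using y(3) by (simp add: insert_prog_def)
  then show ?thesis
  proof (rule wp_mono)
    fix \<s>' \<tau>' assume Q: "?Q \<s>' \<tau>'"
    then have "heap N N (insert y H) \<s>'"
      using ins bij heapD(3)[OF h] unfolding heap_def by metis
    moreover have "pot (insert y H) \<s>' = Suc (pot H \<s>)"
    proof -
      have "pot (insert y H) \<s>' = Suc (VR \<s>) + 2 * (\<Sum>x\<in>insert y H. ((Mark \<s>)(y := 0)) x)"
        using Q by (simp only: pot_def)
      then show ?thesis unfolding sm by (simp add: pot_def)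
    qed
    ultimately show "heap N N (insert y H) \<s>' \<and> Status \<s>' = (Status \<s>)(y := 1) \<and>
     Key \<s>' = (Key \<s>)(y := Rn \<s>) \<and>
     \<tau>' + 60 * pot (insert y H) \<s>' \<le> \<tau> + 60 * pot H \<s> + 67"
      using Q by simp
  qed
qed

lemmas cascade_defs = cascade_prog_def cascade_step_def cut_prog_def
lemmas relax_defs = relax_step_def insert_prog_def cascade_defs

context csr begin

definition scanning :: "store \<Rightarrow> bool" where
  "scanning \<s> \<longleftrightarrow> graph_store \<s> \<and> heap N N (queued \<s>) \<s> \<and> (let x = Vx \<s> in
     x < N \<and> 2 \<le> Status \<s> x \<and>
     (\<forall>u<N. 2 \<le> Status \<s> u \<longrightarrow> Key \<s> u \<le> Key \<s> x) \<and>
     off x \<le> Vi \<s> \<and> Vi \<s> \<le> off (Suc x) \<and>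
     dij (Status \<s>) (Key \<s>) (Next \<s>) (VF \<s>) x (Vi \<s>))"

text \<open>The set of removed nodes must stay the same, because the charges of the main loop are
  indexed by it. The 260 consists of the 250 of a cascade and the commands around it.\<close>

lemma wp_relax:
  assumes S: "scanning \<s>" and i: "Vi \<s> < off (Suc (Vx \<s>))"
  shows "wp relax_step (\<lambda>\<s>' \<tau>'. scanning \<s>' \<and> Vi \<s>' = Suc (Vi \<s>) \<and>
     (\<forall>v<N. 2 \<le> Status \<s>' v \<longleftrightarrow> 2 \<le> Status \<s> v) \<and>
     \<tau>' + 60 * pot (queued \<s>') \<s>' \<le> \<tau> + 60 * pot (queued \<s>) \<s> + 260) \<s> \<tau>"
    (is "wp _ ?P _ _")
proof -
  let ?i = "Vi \<s>" and ?x = "Vx \<s>" and ?f = "Status \<s>" and ?k = "Key \<s>"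
    and ?nx = "Next \<s>" and ?c = "VF \<s>"
  have gs: "graph_store \<s>" and h: "heap N N (queued \<s>) \<s>" and x: "?x < N" "2 \<le> ?f ?x"
    and mx: "\<And>u. u < N \<Longrightarrow> 2 \<le> ?f u \<Longrightarrow> ?k u \<le> ?k ?x" and oi: "off ?x \<le> ?i"
    and D: "dij ?f ?k ?nx ?c ?x ?i"
    using S by (auto simp: scanning_def Let_def)
  have st: "Src \<s> = src" "Lab \<s> = lab" "Chat \<s> = chat" "Weight \<s> = d"
    "RT \<s> = thr" using gs by (auto simp: graph_store_def)
  define y where "y = src ?i"
  define n where "n = chat (lab ?i) + ?k ?x"
  have yN: "y < N" using arc[OF x(1) oi i] by (simp add: y_def)
  \<comment> \<open>The three cases below differ in queue, keys and clock; the other clauses of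
    \<open>scanning\<close> follow from the frame.\<close>
  have done_: "?P \<s>' \<tau>'"
    if u: "unchanged relax_step \<s> \<s>'" and *: "Vi \<s>' = Suc ?i" "heap N N (queued \<s>') \<s>'"
      "dij (Status \<s>') (Key \<s>') (Next \<s>') ?c ?x (Suc ?i)"
      "\<And>u. u < N \<Longrightarrow> 2 \<le> Status \<s>' u \<longleftrightarrow> 2 \<le> ?f u"
      "\<And>u. u < N \<Longrightarrow> 2 \<le> Status \<s>' u \<Longrightarrow> Key \<s>' u \<le> Key \<s>' ?x"
      "\<tau>' + 60 * pot (queued \<s>') \<s>' \<le> \<tau> + 60 * pot (queued \<s>) \<s> + 260"
    for \<s>' \<tau>'
  proof -
    note u' = unchangedD[OF u, unfolded relax_defs, simplified]
    show ?thesis using * gs x oi i unfolding scanning_def Let_def graph_store_def by (simp add: u')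
  qed
  show ?thesis
  proof (rule wp_frame)
    consider (skip) "\<not> (d (lab ?i) < thr \<and> (?f y = 0 \<or> ?f y = 1 \<and> n < ?k y))"
      | (new) "d (lab ?i) < thr" "?f y = 0" | (better) "d (lab ?i) < thr" "?f y = 1" "n < ?k y"
      by blast
    then show "wp relax_step (\<lambda>\<s>' \<tau>'. unchanged relax_step \<s> \<s>' \<longrightarrow> ?P \<s>' \<tau>') \<s> \<tau>"
    proof cases
      case skip
      let ?Q = "\<lambda>(\<s>' :: store) \<tau>'. \<tau>' \<le> \<tau> + 7 \<and> Vi \<s>' = Suc ?i \<and> nat_arr \<s>' = nat_arr \<s> \<and>
        real_arr \<s>' = real_arr \<s> \<and> VR \<s>' = VR \<s>"
      have "wp relax_step ?Q \<s> \<tau>"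
        using skip by (auto simp: relax_step_def st y_def n_def)
      then show ?thesis
      proof (rule wp_mono, intro impI)
        fix \<s>' \<tau>' assume Q: "?Q \<s>' \<tau>'" and u: "unchanged relax_step \<s> \<s>'"
        have "1 \<le> ?f y \<and> ?k y \<le> n" if "d (lab ?i) < thr"
        proof (cases "?f y = 1")
          case False
          \<comment> \<open>A removed node: its key is at most that of \<open>x\<close>, and the arc
            only adds a nonnegative cost.\<close>
          then have "2 \<le> ?f y" using skip that by linarith
          then have "?k y \<le> ?k ?x" using mx yN by blast
          then show ?thesis using arc[OF x(1) oi i] \<open>2 \<le> ?f y\<close> by (simp add: n_def)
        qed (use skip that in auto)
        then have "dij ?f ?k ?nx ?c ?x (Suc ?i)"
          by (intro dij_skip[OF D]) (simp add: y_def n_def)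
        moreover have "heap N N (queued \<s>') \<s>'" "pot (queued \<s>') \<s>' = pot (queued \<s>) \<s>"
          using h Q by (simp_all add: heap_def pot_def)
        ultimately show "?P \<s>' \<tau>'" using Q mx by (intro done_[OF u]) simp_all
      qed
    next
      case new
      let ?\<s>1 = "\<s>\<lparr>nat_var := (nat_var \<s>)(''y'' := y), real_var := (real_var \<s>)(''n'' := n),
        nat_arr := (nat_arr \<s>)(''x'' := ?nx(y := ?i))\<rparr>"
      have h1: "heap N N (queued \<s>) ?\<s>1" "pot (queued \<s>) ?\<s>1 = pot (queued \<s>) \<s>"
        using h by (simp_all add: heap_def pot_def)
      \<comment> \<open>Symbolic execution up to the call, so that the specification of the
        subprogram meets an explicit store.\<close>
      have red: "wp relax_step Q \<s> \<tau>"
        if "wp insert_prog (wp (SetNVar ''i'' (NAdd (NVar ''i'') (NConst 1))) Q) ?\<s>1 (\<tau> + 5)" for Q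
        using new that by (simp add: relax_step_def st y_def[symmetric] n_def[symmetric] eval_nat_numeral)
      show ?thesis
      proof (rule red, rule wp_frame[OF wp_insert[OF h1(1), of y]], goal_cases)
        case (4 \<s>2 \<tau>2)
        note I = 4(1) and u2 = unchangedD[OF 4(2), unfolded insert_prog_def, simplified]
        have q: "queued \<s>2 = insert y (queued \<s>)" using I yN by auto
        have hq: "heap N N (queued \<s>2) \<s>2" unfolding q using I by blast
        let ?\<s>3 = "\<s>2\<lparr>nat_var := (nat_var \<s>2)(''i'' := Suc ?i)\<rparr>"
        have "?P ?\<s>3 (Suc \<tau>2)" if u: "unchanged relax_step \<s> ?\<s>3"
        proof (rule done_[OF u])
          show "heap N N (queued ?\<s>3) ?\<s>3" using hq by simp
          show "dij (Status ?\<s>3) (Key ?\<s>3) (Next ?\<s>3) ?c ?x (Suc ?i)"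
            using dij_improve(1)[OF D x mx oi i new(1) y_def disjI1[OF new(2)] n_def] I u2 by simp
          show "Key ?\<s>3 u \<le> Key ?\<s>3 ?x" if "u < N" "2 \<le> Status ?\<s>3 u" for u
            using dij_improve(2)[OF D x mx oi i new(1) y_def disjI1[OF new(2)] n_def, of u] I that by simp
          show "2 \<le> Status ?\<s>3 u \<longleftrightarrow> 2 \<le> ?f u" for u using I new by simp
          have "pot (queued ?\<s>3) ?\<s>3 = pot (insert y (queued \<s>)) \<s>2" unfolding q[symmetric] by simp
          then show "Suc \<tau>2 + 60 * pot (queued ?\<s>3) ?\<s>3 \<le> \<tau> + 60 * pot (queued \<s>) \<s> + 260"
            using I h1(2) by simp
        qed simp
        then show ?case using u2 by simp
      qed (use new yN in simp_all)
    next
      case better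
      have yq: "y \<in> queued \<s>" using better yN by simp
      let ?\<s>1 = "\<s>\<lparr>nat_var := (nat_var \<s>)(''y'' := y), real_var := (real_var \<s>)(''n'' := n),
        nat_arr := (nat_arr \<s>)(''x'' := ?nx(y := ?i)), real_arr := (real_arr \<s>)(''k'' := ?k(y := n))\<rparr>"
      have NH: "N \<notin> queued \<s>" by simp
      have h1: "heap N y (queued \<s>) ?\<s>1" "pot (queued \<s>) ?\<s>1 = pot (queued \<s>) \<s>"
        using fib_decrease_key[OF heapD(1)[OF h] disjI1[OF NH] yq, of n] heapD[OF h] better(3)
        by (simp_all add: heap_def pot_def)
      have red: "wp relax_step Q \<s> \<tau>"
        if "wp cascade_prog (wp (SetNVar ''i'' (NAdd (NVar ''i'') (NConst 1))) Q) ?\<s>1 (\<tau> + 7)" for Q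
        using better that by (simp add: relax_step_def st y_def[symmetric] n_def[symmetric] eval_nat_numeral)
      show ?thesis
      proof (rule red, rule wp_frame[OF wp_cascade[OF h1(1) yq]], goal_cases)
        case (2 \<s>2 \<tau>2)
        note I = 2(1) and u2 = unchangedD[OF 2(2), unfolded cascade_defs, simplified]
        have q: "queued \<s>2 = queued \<s>" using u2 by simp
        let ?\<s>3 = "\<s>2\<lparr>nat_var := (nat_var \<s>2)(''i'' := Suc ?i)\<rparr>"
        have "?P ?\<s>3 (Suc \<tau>2)" if u: "unchanged relax_step \<s> ?\<s>3"
        proof (rule done_[OF u])
          have fy: "?f(y := 1) = ?f" using better by (simp add: fun_upd_idem)
          note imp = dij_improve[OF D x mx oi i better(1) y_def _ n_def, unfolded fy]
          have imp': "?f y = 0 \<or> ?f y = 1 \<and> chat (lab ?i) + ?k ?x < ?k y" using better n_def by simp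
          show "heap N N (queued ?\<s>3) ?\<s>3" using I q by simp
          show "dij (Status ?\<s>3) (Key ?\<s>3) (Next ?\<s>3) ?c ?x (Suc ?i)"
            using imp(1)[OF _ _ imp'] u2 by simp
          show "Key ?\<s>3 u \<le> Key ?\<s>3 ?x" if "u < N" "2 \<le> Status ?\<s>3 u" for u
            using imp(2)[OF _ _ imp', of u] u2 that by simp
          show "2 \<le> Status ?\<s>3 u \<longleftrightarrow> 2 \<le> ?f u" for u using u2 by simp
          have "pot (queued ?\<s>3) ?\<s>3 = pot (queued \<s>) \<s>2" using q by (simp add: pot_def)
          then show "Suc \<tau>2 + 60 * pot (queued ?\<s>3) ?\<s>3 \<le> \<tau> + 60 * pot (queued \<s>) \<s> + 260"
            using I h1(2) by simp
        qed simp
        then show ?case using u2 by simp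
      qed simp
    qed
  qed blast
qed

end

lemmas pop_defs = pop_prog_def min_prog_def min_step_def kids_prog_def kids_step_def link_prog_def
  link_step_def clear_prog_def clear_step_def cut_prog_def
lemmas scan_defs = scan_prog_def relax_defs
lemmas dijkstra_defs = dijkstra_prog_def dijkstra_step_def clear_status_step_def pop_defs scan_defs

context csr begin

lemma wp_scan:
  assumes gs: "graph_store \<s>" and h: "heap N N (queued \<s>) \<s>" and x: "Vx \<s> = x" "x < N" "2 \<le> Status \<s> x"
    and mx: "\<And>u. u < N \<Longrightarrow> 2 \<le> Status \<s> u \<Longrightarrow> Key \<s> u \<le> Key \<s> x"
    and D: "dij (Status \<s>) (Key \<s>) (Next \<s>) (VF \<s>) x (off x)"
  shows "wp scan_prog (\<lambda>\<s>' \<tau>'. heap N N (queued \<s>') \<s>' \<and>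
     dij (Status \<s>') (Key \<s>') (Next \<s>') (VF \<s>') N 0 \<and>
     (\<forall>v<N. 2 \<le> Status \<s>' v \<longleftrightarrow> 2 \<le> Status \<s> v) \<and>
     \<tau>' + 60 * pot (queued \<s>') \<s>' \<le> \<tau> + 60 * pot (queued \<s>) \<s> + 261 * (off (Suc x) - off x) + 3) \<s> \<tau>"
proof -
  let ?B = "\<tau> + 2 + 60 * pot (queued \<s>) \<s>"
  let ?I = "\<lambda>\<s>' \<tau>'. scanning \<s>' \<and> (\<forall>v<N. 2 \<le> Status \<s>' v \<longleftrightarrow> 2 \<le> Status \<s> v) \<and>
     Vi \<s>' \<le> off (Suc x) \<and>
     \<tau>' + 60 * pot (queued \<s>') \<s>' \<le> ?B + 261 * (Vi \<s>' - off x)"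
  let ?\<s> = "\<s>\<lparr>nat_var := (nat_var \<s>)(''i'' := off x, ''h'' := off (Suc x))\<rparr>"
  have a: "Off \<s> = off" using gs by (simp add: graph_store_def)
  have h1: "heap N y0 H ?\<s> = heap N y0 H \<s>" "pot H ?\<s> = pot H \<s>" for y0 H
    by (simp_all add: heap_def pot_def)
  have "wp (Loop (NLess (NVar ''i'') (NVar ''h'')) relax_step)
    (\<lambda>\<s>' \<tau>'. heap N N (queued \<s>') \<s>' \<and>
     dij (Status \<s>') (Key \<s>') (Next \<s>') (VF \<s>') N 0 \<and>
     (\<forall>v<N. 2 \<le> Status \<s>' v \<longleftrightarrow> 2 \<le> Status \<s> v) \<and>
     \<tau>' + 60 * pot (queued \<s>') \<s>' \<le> \<tau> + 60 * pot (queued \<s>) \<s> + 261 * (off (Suc x) - off x) + 3) ?\<s> (\<tau> + 2)"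
  proof (rule wp_Loop_frame[where I = ?I and K = "?B + 261 * (off (Suc x) - off x)"], goal_cases)
    case 1
    have "scanning ?\<s>"
      using gs h x mx D off_mono[OF x(2)] by (simp add: scanning_def graph_store_def h1)
    then show ?case using off_mono[OF x(2)] by (simp add: h1)
  next
    case (2 \<s>' \<tau>')
    then have "Vi \<s>' - off x \<le> off (Suc x) - off x" by auto
    then show ?case using 2 by linarith
  next
    case (3 \<s>' \<tau>')
    note u = unchangedD[OF 3(2), unfolded relax_defs, simplified]
    have x': "Vx \<s>' = x" and i: "Vi \<s>' < off (Suc x)" using u x 3(3) by simp_all
    have S: "scanning \<s>'" using 3(1) by blast
    then have "off x \<le> Vi \<s>'" by (simp add: scanning_def Let_def x')
    then show ?case using 3(1) i x'
      by (intro wp_mono[OF wp_relax[OF S]]) (auto simp: Suc_diff_le)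
  next
    case (4 \<s>' \<tau>')
    note u = unchangedD[OF 4(2), unfolded relax_defs, simplified]
    have x': "Vx \<s>' = x" and i: "Vi \<s>' = off (Suc x)" using u x 4(1,3) by simp_all
    have S: "scanning \<s>'" using 4(1) by blast
    have "dij (Status \<s>') (Key \<s>') (Next \<s>') (VF \<s>') N 0"
      using S by (intro dij_scan_end[of _ _ _ _ x]) (simp add: scanning_def Let_def x' i)
    then show ?case using 4(1) S i by (auto simp: scanning_def)
  qed
  then show ?thesis using x(1) by (simp add: scan_prog_def a eval_nat_numeral)
qed

lemma wp_dijkstra:
  assumes gs: "graph_store \<s>" and b: "\<And>n. Bucket \<s> n = 0" and Dq: "N < 2 ^ q" "D = 3 * q"
  shows "wp dijkstra_prog (\<lambda>\<s>' \<tau>'. (\<forall>n. Bucket \<s>' n = 0) \<and> (\<forall>v<N. Status \<s>' v \<noteq> 1) \<and>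
     dij (Status \<s>') (Key \<s>') (Next \<s>') (VF \<s>') N 0 \<and>
     \<tau>' \<le> \<tau> + 261 * (\<Sum>v<N. off (Suc v) - off v) + N * (103 * D + 32) + 80) \<s> \<tau>"
proof -
  \<comment> \<open>The charge of a node pays for its extraction and for the scan of its arcs. A
    removed node stays removed during the search, so each node pays once, and the sum over the
    removed nodes bounds the clock in every iteration.\<close>
  define W where "W v = 261 * (off (Suc v) - off v) + (103 * D + 29)" for v
  let ?done = "\<lambda>\<s>'. {v. v < N \<and> 2 \<le> Status \<s>' v}"
  let ?I1 = "\<lambda>(\<s>' :: store) \<tau>'. (\<forall>v<Vi \<s>'. Status \<s>' v = 0) \<and> Vi \<s>' \<le> N \<and>
     \<tau>' \<le> \<tau> + 1 + 3 * Vi \<s>'"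
  define B where "B = \<tau> + 3 * N + 76"
  let ?I = "\<lambda>\<s>' \<tau>'. heap N N (queued \<s>') \<s>' \<and> (\<forall>n. Bucket \<s>' n = 0) \<and>
     dij (Status \<s>') (Key \<s>') (Next \<s>') (VF \<s>') N 0 \<and>
     \<tau>' + 60 * pot (queued \<s>') \<s>' \<le> B + (\<Sum>v\<in>?done \<s>'. W v)"
  let ?P = "\<lambda>\<s>' \<tau>'. (\<forall>n. Bucket \<s>' n = 0) \<and> (\<forall>v<N. Status \<s>' v \<noteq> 1) \<and>
     dij (Status \<s>') (Key \<s>') (Next \<s>') (VF \<s>') N 0 \<and>
     \<tau>' \<le> \<tau> + 261 * (\<Sum>v<N. off (Suc v) - off v) + N * (103 * D + 32) + 80"
  have total: "(\<Sum>v\<in>{v. v < N \<and> P v}. W v) \<le> 261 * (\<Sum>v<N. off (Suc v) - off v) + N * (103 * D + 29)" for P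
  proof -
    have "(\<Sum>v\<in>{v. v < N \<and> P v}. W v) \<le> (\<Sum>v<N. W v)" by (rule sum_mono2) auto
    also have "\<dots> = 261 * (\<Sum>v<N. off (Suc v) - off v) + N * (103 * D + 29)"
      unfolding W_def sum.distrib by (simp add: sum_distrib_left distrib_left)
    finally show ?thesis .
  qed
  have main: "wp (Loop (NLess (NConst 0) (NVar ''R'')) dijkstra_step) ?P \<s>1 \<tau>1"
    if I: "?I \<s>1 \<tau>1" and gs: "graph_store \<s>1" for \<s>1 \<tau>1
  proof (rule wp_Loop_frame[where I = ?I and K = "B + (261 * (\<Sum>v<N. off (Suc v) - off v) + N * (103 * D + 29))"], goal_cases)
    case 1
    then show ?case using I .
  next
    case (2 \<s>' \<tau>')
    then show ?case using total[of "\<lambda>v. 2 \<le> Status \<s>' v"] by linarith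
  next
    case (3 \<s>2 \<tau>2)
    note u = unchangedD[OF 3(2), unfolded dijkstra_defs, simplified]
    have gs2: "graph_store \<s>2" using gs by (simp add: graph_store_def u)
    have h2: "heap N N (queued \<s>2) \<s>2" and b2: "\<And>n. Bucket \<s>2 n = 0"
      and D2: "dij (Status \<s>2) (Key \<s>2) (Next \<s>2) (VF \<s>2) N 0"
      and t2: "\<tau>2 + 60 * pot (queued \<s>2) \<s>2 \<le> B + (\<Sum>v\<in>?done \<s>2. W v)" using 3(1) by auto
    have R: "0 < VR \<s>2" using 3(3) by simp
    show ?case
      unfolding dijkstra_step_def seq.simps wp_Seq
    proof (rule wp_frame[OF wp_pop[OF h2 b2 Dq R]])
      fix \<s>3 \<tau>3
      assume "\<exists>x\<in>queued \<s>2. Vx \<s>3 = x \<and>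
        (\<forall>v\<in>queued \<s>2. Key \<s>2 x \<le> Key \<s>2 v) \<and>
        heap N N (queued \<s>2 - {x}) \<s>3 \<and> (\<forall>n. Bucket \<s>3 n = 0) \<and>
        \<tau>3 + 60 * pot (queued \<s>2 - {x}) \<s>3 \<le> Suc \<tau>2 + 60 * pot (queued \<s>2) \<s>2 + 103 * D + 20"
        and "unchanged pop_prog \<s>2 \<s>3"
      then obtain x where x: "x < N" "Status \<s>2 x = 1" "Vx \<s>3 = x"
          "\<And>v. v < N \<Longrightarrow> Status \<s>2 v = 1 \<Longrightarrow> Key \<s>2 x \<le> Key \<s>2 v"
          "heap N N (queued \<s>2 - {x}) \<s>3" "\<And>n. Bucket \<s>3 n = 0"
          "\<tau>3 + 60 * pot (queued \<s>2 - {x}) \<s>3 \<le> Suc \<tau>2 + 60 * pot (queued \<s>2) \<s>2 + 103 * D + 20"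
        and "unchanged pop_prog \<s>2 \<s>3" by blast
      note u3 = unchangedD[OF this(8), unfolded pop_defs, simplified]
      let ?c = "VF \<s>2"
      define \<s>4 where "\<s>4 = \<s>3\<lparr>nat_arr := (nat_arr \<s>3)(''f'' := (Status \<s>2)(x := ?c)),
        nat_var := (nat_var \<s>3)(''F'' := Suc ?c)\<rparr>"
      have c: "2 \<le> ?c" using D2 by (simp add: dij_def)
      have q: "queued \<s>4 = queued \<s>2 - {x}" using c by (auto simp: \<s>4_def)
      have h4: "heap N N (queued \<s>2 - {x}) \<s>4" and p4: "pot (queued \<s>2 - {x}) \<s>4 = pot (queued \<s>2 - {x}) \<s>3"
        using x(5) by (simp_all add: \<s>4_def heap_def pot_def)
      note pop = dij_pop[OF D2 x(1,2,4)]
      have "wp scan_prog ?I \<s>4 (\<tau>3 + 2)"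
      proof (rule wp_frame[OF wp_scan[of _ x]], goal_cases)
        show "graph_store \<s>4" using gs2 by (simp add: graph_store_def \<s>4_def u3)
        show "heap N N (queued \<s>4) \<s>4" unfolding q by (rule h4)
        show "Vx \<s>4 = x" "x < N" using x by (simp_all add: \<s>4_def)
        show "2 \<le> Status \<s>4 x" using c by (simp add: \<s>4_def)
        show "Key \<s>4 u \<le> Key \<s>4 x" if "u < N" "2 \<le> Status \<s>4 u" for u
          using pop(2)[of u] that by (simp add: \<s>4_def u3)
        show "dij (Status \<s>4) (Key \<s>4) (Next \<s>4) (VF \<s>4) x (off x)"
          using pop(1) by (simp add: \<s>4_def u3)
      next
        case (8 \<s>5 \<tau>5)
        note s = 8(1) and u5 = unchangedD[OF 8(2), unfolded scan_defs, simplified]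
        have "?done \<s>5 = ?done \<s>4" using s by blast
        also have "\<dots> = insert x (?done \<s>2)" using c x(1) by (auto simp: \<s>4_def)
        finally have "(\<Sum>v\<in>?done \<s>5. W v) = W x + (\<Sum>v\<in>?done \<s>2. W v)" using x(2) by simp
        moreover have "\<tau>5 + 60 * pot (queued \<s>5) \<s>5 \<le> \<tau>2 + 60 * pot (queued \<s>2) \<s>2 + W x"
          using s x(7) p4 unfolding q W_def by linarith
        moreover have "Bucket \<s>5 n = 0" for n using x(6) by (simp add: u5 \<s>4_def)
        ultimately show "?I \<s>5 \<tau>5" using s t2 by simp
      qed
      then show "wp (SetNArr ''f'' (NVar ''x'') (NVar ''F'')) (wp (SetNVar ''F'' (NAdd (NVar ''F'') (NConst 1)))
        (wp scan_prog ?I)) \<s>3 \<tau>3"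
        by (simp add: \<s>4_def x(3) u3)
    qed
  next
    case (4 \<s>' \<tau>')
    have h: "heap N N (queued \<s>') \<s>'" using 4(1) by blast
    \<comment> \<open>No root is left, and every queued node would have one above it.\<close>
    have "queued \<s>' = {}"
      using heapD(2)[OF h] fib_root_below[OF heapD(1)[OF h]] 4(3) by (fastforce simp: bij_betw_def)
    then have "\<forall>v<N. Status \<s>' v \<noteq> 1" by blast
    moreover have "Suc \<tau>' \<le> \<tau> + 261 * (\<Sum>v<N. off (Suc v) - off v) + N * (103 * D + 32) + 80"
      using total[of "\<lambda>v. 2 \<le> Status \<s>' v"] 4(1) by (simp add: B_def algebra_simps)
    ultimately show ?case using 4(1) by blast
  qed
  show ?thesis
    unfolding dijkstra_prog_def seq.simps wp_Seq wp_SetNVar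
  proof (rule wp_Loop_frame[where I = ?I1 and K = "\<tau> + 1 + 3 * N"], goal_cases)
    case (3 \<s>' \<tau>')
    note u = unchangedD[OF 3(2), unfolded clear_status_step_def, simplified]
    have "Vi \<s>' < N" using 3(3) u gs by (simp add: graph_store_def)
    then show ?case using 3(1) by (auto simp: clear_status_step_def less_Suc_eq)
  next
    case (4 \<s>1 \<tau>1)
    note I1 = 4(1)
    note u = unchangedD[OF 4(2), unfolded clear_status_step_def, simplified]
    have gs1: "graph_store \<s>1" using gs by (simp add: graph_store_def u)
    have f1: "Status \<s>1 v = 0" if "v < N" for v
      using 4(1,3) u gs that by (simp add: graph_store_def)
    define \<s>2 where "\<s>2 = \<s>1\<lparr>nat_var := (nat_var \<s>1)(''R'' := 0, ''F'' := 2, ''y'' := t),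
      real_var := (real_var \<s>1)(''n'' := 0)\<rparr>"
    have h2: "heap N N {} \<s>2" using gs1 by (simp add: heap_def fib_def \<s>2_def graph_store_def acyclic_def bij_betw_def)
    have "wp insert_prog (wp (Loop (NLess (NConst 0) (NVar ''R'')) dijkstra_step) ?P) \<s>2 (\<tau>1 + 5)"
    proof (rule wp_frame[OF wp_insert[OF h2, of t]], goal_cases)
      case (4 \<s>3 \<tau>3)
      note i = 4(1) and u3 = unchangedD[OF 4(2), unfolded insert_prog_def, simplified]
      have f3: "Status \<s>3 v = (if v = t then 1 else 0)" if "v < N" for v
        using i f1[OF that] by (simp add: \<s>2_def)
      have q: "queued \<s>3 = {t}" using f3 target by (auto split: if_split_asm)
      have dn: "?done \<s>3 = {}" using f3 by (auto split: if_split_asm)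
      have "\<tau>3 + 60 * pot {t} \<s>3 \<le> B" using i I1 by (simp add: pot_def \<s>2_def B_def)
      moreover have "dij (Status \<s>3) (Key \<s>3) (Next \<s>3) (VF \<s>3) N 0"
      proof -
        have "VF \<s>3 = 2" by (simp add: u3 \<s>2_def)
        moreover have "Key \<s>3 t = 0" using i by (simp add: \<s>2_def)
        ultimately show ?thesis using dij_init[OF f3] by simp
      qed
      moreover have "Bucket \<s>3 n = 0" for n using b by (simp add: u3 \<s>2_def u)
      moreover have "graph_store \<s>3" using gs1 by (simp add: graph_store_def u3 \<s>2_def)
      ultimately show ?case
        using i q dn by (intro main) simp_all
    qed (use target in \<open>simp_all add: \<s>2_def\<close>)
    moreover have "Vt \<s>1 = t" using gs1 by (simp add: graph_store_def)
    ultimately show ?case by (simp add: \<s>2_def eval_nat_numeral)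
  qed auto
qed

end

section \<open>Simple paths and the robust objective\<close>

text \<open>Node list and edge list over an arbitrary link relation, so that directed walks,
  undirected walks and walks through the adjacency arrays share one notion.\<close>

fun steps :: "('e \<Rightarrow> 'v \<Rightarrow> 'v \<Rightarrow> bool) \<Rightarrow> 'v list \<Rightarrow> 'e list \<Rightarrow> bool" where
  "steps L [v] [] \<longleftrightarrow> True"
| "steps L (u # v # vs) (e # es) \<longleftrightarrow> L e u v \<and> steps L (v # vs) es"
| "steps L _ _ \<longleftrightarrow> False"

definition arc_link :: "('v, 'e) pre_digraph \<Rightarrow> 'e \<Rightarrow> 'v \<Rightarrow> 'v \<Rightarrow> bool" where
  "arc_link G e u v \<longleftrightarrow> e \<in> arcs G \<and> tail G e = u \<and> head G e = v"

definition edge_link :: "bool \<Rightarrow> ('v, 'e) pre_digraph \<Rightarrow> 'e \<Rightarrow> 'v \<Rightarrow> 'v \<Rightarrow> bool" where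
  "edge_link directed G e u v \<longleftrightarrow> arc_link G e u v \<or> \<not> directed \<and> arc_link G e v u"

lemma steps_mono: "steps L vs es \<Longrightarrow> (\<And>e u v. e \<in> set es \<Longrightarrow> L e u v \<Longrightarrow> L' e u v) \<Longrightarrow> steps L' vs es"
  by (induction L vs es rule: steps.induct) auto

lemma steps_nonempty: "steps L vs es \<Longrightarrow> vs \<noteq> [] \<and> length vs = Suc (length es)"
  by (induction L vs es rule: steps.induct) auto

lemma steps_endpoint:
  assumes "steps L vs es" "e \<in> set es" "L e u v"
    and "\<And>e u v u' v'. L e u v \<Longrightarrow> L e u' v' \<Longrightarrow> u \<in> {u', v'}"
  shows "u \<in> set vs"
  using assms
proof (induction L vs es rule: steps.induct)
  case (2 L u' v' vs e' es)
  show ?case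
  proof (cases "e = e'")
    case True
    then have "u \<in> {u', v'}" using "2.prems"(1,3) by (intro "2.prems"(4)[of e u v]) auto
    then show ?thesis by auto
  next
    case False
    then have "u \<in> set (v' # vs)" using "2.prems"(1-3) by (intro "2.IH"[OF _ _ _ "2.prems"(4)]) auto
    then show ?thesis by auto
  qed
qed auto

lemma edge_link_endpoint: "edge_link directed G e u v \<Longrightarrow> edge_link directed G e u' v' \<Longrightarrow> u \<in> {u', v'}"
  by (auto simp: edge_link_def arc_link_def)

text \<open>An edge used twice would bring back the node \<open>u\<close> at which it was first
  entered: both uses have the same two endpoints, so \<open>u\<close> would recur among the later
  nodes.\<close>

lemma steps_distinct:
  assumes "steps (edge_link directed G) vs es" "distinct vs"
  shows "distinct es" "set es \<subseteq> arcs G"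
  using assms
proof (induction "edge_link directed G" vs es rule: steps.induct)
  case (2 u v vs e es)
  {
    case 1
    then have "e \<notin> set es"
      using steps_endpoint[of "edge_link directed G" "v # vs" es e u v] edge_link_endpoint by fastforce
    then show ?case using 1 2 by simp
  next
    case 2
    then show ?case using "2.hyps" by (auto simp: edge_link_def arc_link_def)
  }
qed auto

text \<open>Holds for arbitrary graph records, so it applies to every reorientation of an undirected
  graph.\<close>

lemma steps_arc_link_iff:
  "steps (arc_link H) vs es \<and> hd vs = u \<longleftrightarrow>
     vs = pre_digraph.awalk_verts H u es \<and> set es \<subseteq> arcs H \<and> pre_digraph.cas H u es (last vs)"
proof (induction es arbitrary: u vs)
  case Nil
  then show ?case
    by (cases vs rule: remdups_adj.cases) (auto simp: pre_digraph.awalk_verts.simps pre_digraph.cas.simps)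
next
  case (Cons e es)
  have ne: "pre_digraph.awalk_verts H w es \<noteq> []" for w
    by (cases es) (auto simp: pre_digraph.awalk_verts.simps)
  show ?case
  proof (cases vs rule: remdups_adj.cases)
    case (3 x y ws)
    have "steps (arc_link H) vs (e # es) \<and> hd vs = u \<longleftrightarrow>
        e \<in> arcs H \<and> tail H e = u \<and> x = u \<and> y = head H e \<and> (steps (arc_link H) (y # ws) es \<and> hd (y # ws) = head H e)"
      by (auto simp: 3 arc_link_def)
    moreover have "hd (pre_digraph.awalk_verts H w es) = w" if "pre_digraph.cas H w es z" for w z
      using that by (cases es) (auto simp: pre_digraph.awalk_verts.simps pre_digraph.cas.simps)
    then have "y = head H e" if "pre_digraph.cas H (head H e) es z" "y # ws = pre_digraph.awalk_verts H (head H e) es" for z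
      using that by (metis list.sel(1))
    ultimately show ?thesis
      unfolding Cons.IH by (auto simp: 3 pre_digraph.awalk_verts.simps pre_digraph.cas.simps)
  qed (use ne[symmetric] in \<open>auto simp: pre_digraph.awalk_verts.simps\<close>)
qed

lemma apath_iff_steps:
  "pre_digraph.apath H s es t \<longleftrightarrow>
     s \<in> verts H \<and> (\<exists>vs. steps (arc_link H) vs es \<and> hd vs = s \<and> last vs = t \<and> distinct vs)"
proof
  assume "pre_digraph.apath H s es t"
  then have a: "s \<in> verts H" "set es \<subseteq> arcs H" "pre_digraph.cas H s es t" "distinct (pre_digraph.awalk_verts H s es)"
    by (auto simp: pre_digraph.apath_def pre_digraph.awalk_def)
  have "last (pre_digraph.awalk_verts H s es) = t" using a(3)
    by (induction es arbitrary: s)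
      (auto simp: pre_digraph.awalk_verts.simps pre_digraph.cas.simps neq_Nil_conv split: list.splits,
       metis list.distinct(1) list.exhaust pre_digraph.awalk_verts.simps)
  then show "s \<in> verts H \<and> (\<exists>vs. steps (arc_link H) vs es \<and> hd vs = s \<and> last vs = t \<and> distinct vs)"
    using a steps_arc_link_iff[of H "pre_digraph.awalk_verts H s es" es s] by auto
next
  assume "s \<in> verts H \<and> (\<exists>vs. steps (arc_link H) vs es \<and> hd vs = s \<and> last vs = t \<and> distinct vs)"
  then obtain vs where "s \<in> verts H" "steps (arc_link H) vs es \<and> hd vs = s" "last vs = t" "distinct vs" by blast
  then show "pre_digraph.apath H s es t"
    unfolding steps_arc_link_iff by (auto simp: pre_digraph.apath_def pre_digraph.awalk_def)
qed

text \<open>The first edge of a simple path does not occur in the rest, so its direction can be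
  overwritten without disturbing the orientation found for the rest.\<close>

lemma steps_orientation:
  assumes "steps (edge_link False G) vs es" "distinct vs"
  shows "\<exists>H\<in>reorientations G. steps (arc_link H) vs es"
  using assms
proof (induction "edge_link False G" vs es rule: steps.induct)
  case (1 v)
  have "G \<in> reorientations G" by (simp add: reorientations_def)
  then show ?case by auto
next
  case (2 u v vs e es)
  then obtain H where H: "H \<in> reorientations G" "steps (arc_link H) (v # vs) es" by auto
  let ?H = "H\<lparr>tail := (tail H)(e := u), head := (head H)(e := v)\<rparr>"
  have e: "edge_link False G e u v" and st: "steps (edge_link False G) (v # vs) es" using 2 by auto
  then have "e \<notin> set es"
    using steps_endpoint[OF st _ e] edge_link_endpoint 2(3) by fastforce
  then have "steps (arc_link ?H) (v # vs) es"
    by (intro steps_mono[OF H(2)]) (auto simp: arc_link_def)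
  moreover have "?H \<in> reorientations G"
    using H(1) e by (auto simp: reorientations_def edge_link_def arc_link_def)
  moreover have "arc_link ?H e u v" using H(1) e by (auto simp: reorientations_def edge_link_def arc_link_def)
  ultimately show ?case by (intro bexI[of _ ?H]) auto
qed auto

lemma st_paths_iff:
  "P \<in> st_paths directed G s t \<longleftrightarrow>
     s \<in> verts G \<and> (\<exists>vs. steps (edge_link directed G) vs P \<and> hd vs = s \<and> last vs = t \<and> distinct vs)"
proof (cases directed)
  case True
  then have "edge_link directed G = arc_link G" by (auto simp: edge_link_def fun_eq_iff)
  then show ?thesis using True by (simp add: st_paths_def apath_iff_steps)
next
  case False
  have "steps (edge_link False G) vs P" if "H \<in> reorientations G" "steps (arc_link H) vs P" for H vs
    using that(1) by (intro steps_mono[OF that(2)]) (auto simp: edge_link_def arc_link_def reorientations_def)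
  moreover have "verts H = verts G" if "H \<in> reorientations G" for H using that by (auto simp: reorientations_def)
  ultimately show ?thesis
    using False steps_orientation by (simp add: st_paths_def apath_iff_steps) blast
qed

lemma finite_st_paths:
  assumes "finite (arcs G)"
  shows "finite (st_paths directed G s t)"
proof (rule finite_subset)
  show "st_paths directed G s t \<subseteq> {es. set es \<subseteq> arcs G \<and> distinct es}"
    using steps_distinct by (fastforce simp: st_paths_iff)
  show "finite {es. set es \<subseteq> arcs G \<and> distinct es}" using assms by (rule finite_subset_distinct)
qed

section \<open>The robust objective on the Manhattan ball\<close>

lemma path_cost_sum_list: "distinct P \<Longrightarrow> path_cost c P = sum_list (map c P)"
  by (simp add: path_cost_def sum_list_distinct_conv_sum_set)

definition path_weight :: "('e \<Rightarrow> real) \<Rightarrow> 'e list \<Rightarrow> real" where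
  "path_weight d P = Max (d ` set P)"

text \<open>The worst case spends the whole budget on a heaviest edge of the path: a share
  \<open>\<bar>b e\<bar> / d e\<close> of the budget buys an increase of at most \<open>d e\<close>
  times that share, and the shares sum to at most 1.\<close>

lemma robust_cost_manhattan:
  assumes E: "finite E" "set P \<subseteq> E" "P \<noteq> []" and d: "\<And>e. e \<in> E \<Longrightarrow> 0 < d e" and l: "0 \<le> l"
  shows "robust_cost (manhattan_ball E d) chat l P = path_cost chat P + l * path_weight d P"
proof -
  let ?m = "path_weight d P"
  have cost: "path_cost (\<lambda>e. chat e + l * b e) P = path_cost chat P + l * (\<Sum>e\<in>set P. b e)" for b
    by (simp add: path_cost_def sum.distrib sum_distrib_left)
  have "?m \<in> d ` set P" using E(3) unfolding path_weight_def by (intro Max_in) auto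
  then obtain e0 where e0: "e0 \<in> set P" "?m = d e0" by blast
  have d0: "0 < d e0" using d e0 E(2) by blast
  let ?S = "path_cost chat P + l * ?m"
  let ?X = "path_cost ` {\<lambda>e. chat e + l * b e |b. b \<in> manhattan_ball E d}"
  have "Sup ((\<lambda>c. path_cost c P) ` uncertainty_set (manhattan_ball E d) chat l) = ?S"
  proof (rule cSup_eq_maximum)
    let ?b = "\<lambda>e. if e = e0 then d e0 else 0"
    have "(\<Sum>e\<in>E. \<bar>?b e\<bar> / d e) = (\<Sum>e\<in>E. if e = e0 then 1 else 0)"
      using d0 by (intro sum.cong) auto
    then have "?b \<in> manhattan_ball E d" using E e0 by (auto simp: manhattan_ball_def)
    moreover have "path_cost (\<lambda>e. chat e + l * ?b e) P = ?S"
      unfolding cost using e0 by simp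
    ultimately show "?S \<in> (\<lambda>c. path_cost c P) ` uncertainty_set (manhattan_ball E d) chat l"
      unfolding uncertainty_set_def by (intro image_eqI[of _ _ "\<lambda>e. chat e + l * ?b e"]) auto
  next
    fix y assume "y \<in> (\<lambda>c. path_cost c P) ` uncertainty_set (manhattan_ball E d) chat l"
    then obtain b where b: "b \<in> manhattan_ball E d" "y = path_cost chat P + l * (\<Sum>e\<in>set P. b e)"
      unfolding uncertainty_set_def using cost by auto
    have "(\<Sum>e\<in>set P. b e) \<le> (\<Sum>e\<in>set P. ?m * (\<bar>b e\<bar> / d e))"
    proof (rule sum_mono)
      fix e assume e: "e \<in> set P"
      then have "0 < d e" "d e \<le> ?m" using d E(2) by (auto simp: path_weight_def)
      then have "d e * (\<bar>b e\<bar> / d e) \<le> ?m * (\<bar>b e\<bar> / d e)" by (intro mult_right_mono) auto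
      then show "b e \<le> ?m * (\<bar>b e\<bar> / d e)" using \<open>0 < d e\<close> by simp
    qed
    also have "\<dots> = ?m * (\<Sum>e\<in>set P. \<bar>b e\<bar> / d e)" by (simp add: sum_distrib_left)
    also have "\<dots> \<le> ?m * (\<Sum>e\<in>E. \<bar>b e\<bar> / d e)"
      using e0 E d by (intro mult_left_mono sum_mono2) (auto simp: less_imp_le)
    also have "\<dots> \<le> ?m * 1"
      using b(1) e0 E d by (intro mult_left_mono) (auto simp: manhattan_ball_def less_imp_le)
    finally show "y \<le> ?S" using b(2) l by (simp add: mult_left_mono)
  qed
  then show ?thesis by (simp add: robust_cost_def)
qed

section \<open>Lower envelopes of lines\<close>

text \<open>A stack of lines \<open>c i + \<lambda> m i\<close> with decreasing slopes; line \<open>i\<close> is lowest on \<open>[b i, b (i + 1)]\<close>.\<close>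

definition envelope :: "(nat \<Rightarrow> real) \<Rightarrow> (nat \<Rightarrow> real) \<Rightarrow> (nat \<Rightarrow> real) \<Rightarrow> nat \<Rightarrow> bool" where
  "envelope c m b k \<longleftrightarrow> (0 < k \<longrightarrow> b 0 = 0) \<and>
     (\<forall>i. Suc i < k \<longrightarrow> b i < b (Suc i) \<and> m (Suc i) < m i \<and>
        c i + b (Suc i) * m i = c (Suc i) + b (Suc i) * m (Suc i))"

lemma envelope_pop: "envelope c m b k \<Longrightarrow> k' \<le> k \<Longrightarrow> envelope c m b k'"
  unfolding envelope_def by auto

text \<open>\<open>b'\<close> is where the new line crosses the top one. Since the new line is
  strictly above at the breakpoint of the top and has the smaller slope, the crossing lies strictly
  to the right.\<close>

lemma envelope_push:
  assumes "envelope c m b k"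
    and "k = 0 \<Longrightarrow> b' = 0"
    and "0 < k \<Longrightarrow> m' < m (k - 1) \<and> c (k - 1) + b (k - 1) * m (k - 1) < c' + b (k - 1) * m' \<and>
      b' = (c' - c (k - 1)) / (m (k - 1) - m')"
  shows "envelope (c(k := c')) (m(k := m')) (b(k := b')) (Suc k)"
proof (cases k)
  case 0
  then show ?thesis using assms(2) by (simp add: envelope_def)
next
  case (Suc j)
  have h: "m' < m j" "c j + b j * m j < c' + b j * m'" "b' = (c' - c j) / (m j - m')"
    using assms(3) Suc by auto
  have "b j * (m j - m') < c' - c j" using h(2) by (simp add: algebra_simps)
  then have "b j < b'" using h(1,3) by (simp add: pos_less_divide_eq)
  moreover have "c j + b' * m j = c' + b' * m'" using h by (simp add: field_simps)
  ultimately show ?thesis using assms(1) h(1) Suc by (auto simp: envelope_def less_Suc_eq)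
qed

context
  fixes c m b :: "nat \<Rightarrow> real" and k :: nat
  assumes envelope: "envelope c m b k"
begin

lemma envelope_break_mono: "i \<le> j \<Longrightarrow> j < k \<Longrightarrow> b i \<le> b j"
proof (induction j rule: dec_induct)
  case (step j)
  then have "b j < b (Suc j)" using envelope by (auto simp: envelope_def)
  then show ?case using step by simp
qed simp

lemma envelope_break_nonneg: "i < k \<Longrightarrow> 0 \<le> b i"
  using envelope_break_mono[of 0 i] envelope by (simp add: envelope_def)

lemma envelope_slope_less: "i < j \<Longrightarrow> j < k \<Longrightarrow> m j < m i"
proof (induction j)
  case (Suc j)
  then have "m (Suc j) < m j" using envelope by (auto simp: envelope_def)
  then show ?case using Suc by (cases "i = j") auto
qed simp

text \<open>The difference of neighbouring lines factors as
  \<open>(b (Suc i) - l) * (m i - m (Suc i))\<close>, and the second factor is positive.\<close>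

lemma envelope_adjacent:
  assumes "Suc i < k"
  shows "l \<le> b (Suc i) \<Longrightarrow> c i + l * m i \<le> c (Suc i) + l * m (Suc i)"
    and "b (Suc i) \<le> l \<Longrightarrow> c (Suc i) + l * m (Suc i) \<le> c i + l * m i"
proof -
  have h: "m (Suc i) < m i" "c i + b (Suc i) * m i = c (Suc i) + b (Suc i) * m (Suc i)"
    using envelope assms by (auto simp: envelope_def)
  have eq: "(c (Suc i) + l * m (Suc i)) - (c i + l * m i) = (b (Suc i) - l) * (m i - m (Suc i))"
    using h(2) by (simp add: algebra_simps)
  show "l \<le> b (Suc i) \<Longrightarrow> c i + l * m i \<le> c (Suc i) + l * m (Suc i)"
    using eq h(1) mult_nonneg_nonneg[of "b (Suc i) - l" "m i - m (Suc i)"] by linarith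
  show "b (Suc i) \<le> l \<Longrightarrow> c (Suc i) + l * m (Suc i) \<le> c i + l * m i"
    using eq h(1) mult_nonneg_nonneg[of "l - b (Suc i)" "m i - m (Suc i)"] by (simp add: algebra_simps)
qed

lemma envelope_lowest:
  assumes "i < k" "j < k" "b i \<le> l" "Suc i < k \<Longrightarrow> l \<le> b (Suc i)"
  shows "c i + l * m i \<le> c j + l * m j"
proof (cases "i \<le> j")
  case True
  then show ?thesis using assms(2)
  proof (induction j rule: dec_induct)
    case (step n)
    have "l \<le> b (Suc n)" using assms(4) envelope_break_mono[of "Suc i" "Suc n"] step by auto
    then show ?case using envelope_adjacent(1)[of n] step by fastforce
  qed simp
next
  case False
  then have "j \<le> i" by simp
  then show ?thesis
  proof (induction j rule: inc_induct)
    case (step n)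
    have "b (Suc n) \<le> l" using assms(1,3) envelope_break_mono[of "Suc n" i] step by simp
    then show ?case using envelope_adjacent(2)[of n l] step assms(1) by fastforce
  qed simp
qed

text \<open>From its breakpoint on, the top is matched or beaten by the flatter new line, and left
  of it by its predecessor on the stack. The bottom line has no predecessor, but its breakpoint is 0
  and sizes are nonnegative.\<close>

lemma envelope_top_redundant:
  assumes "0 < k" "m' < m (k - 1)" "c' + b (k - 1) * m' \<le> c (k - 1) + b (k - 1) * m (k - 1)" "0 \<le> l"
  shows "c' + l * m' \<le> c (k - 1) + l * m (k - 1) \<or>
    (\<exists>i<k - 1. c i + l * m i \<le> c (k - 1) + l * m (k - 1))"
proof (cases "b (k - 1) \<le> l")
  case True
  have "(l - b (k - 1)) * (m (k - 1) - m') \<ge> 0" using True assms(2) by simp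
  then show ?thesis using assms(3) by (simp add: algebra_simps)
next
  case False
  then have "k \<noteq> 1" using envelope assms(1,4) by (auto simp: envelope_def)
  then obtain i where i: "k = Suc (Suc i)" using assms(1) by (cases k; cases "k - 1") auto
  then have "c i + l * m i \<le> c (Suc i) + l * m (Suc i)"
    using envelope_adjacent(1)[of i l] False by simp
  then show ?thesis using i by auto
qed

text \<open>A line that stays on or above line \<open>i\<close> on its whole interval and touches it
  at the midpoint coincides with it. So \<open>S\<close> contains a path of every slope on the
  envelope, and these slopes are distinct.\<close>

lemma envelope_card_le:
  fixes C W :: "'p \<Rightarrow> real"
  assumes cover: "\<And>P l. P \<in> X \<Longrightarrow> 0 \<le> l \<Longrightarrow> \<exists>i<k. c i + l * m i \<le> C P + l * W P"
    and mem: "\<And>i. i < k \<Longrightarrow> \<exists>P\<in>X. C P = c i \<and> W P = m i"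
    and S: "finite S" "S \<subseteq> X"
    and opt: "\<And>l. 0 \<le> l \<Longrightarrow> \<exists>P\<in>S. \<forall>Q\<in>X. C P + l * W P \<le> C Q + l * W Q"
  shows "k \<le> card S"
proof -
  have "\<exists>P\<in>S. W P = m i" if i: "i < k" for i
  proof -
    \<comment> \<open>The last line is lowest on an unbounded interval; a piece of length 1 stands
      in for it.\<close>
    define h where "h = (if Suc i < k then b (Suc i) else b i + 1)"
    have bh: "0 \<le> b i" "b i < h" using envelope_break_nonneg[OF i] envelope by (auto simp: h_def envelope_def)
    then obtain P where P: "P \<in> S" "\<forall>Q\<in>X. C P + (b i + h) / 2 * W P \<le> C Q + (b i + h) / 2 * W Q"
      using opt[of "(b i + h) / 2"] by auto
    obtain Q where "Q \<in> X" "C Q = c i" "W Q = m i" using mem[OF i] by blast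
    then have mid: "C P + (b i + h) / 2 * W P \<le> c i + (b i + h) / 2 * m i" using P(2) by force
    have low: "c i + l * m i \<le> C P + l * W P" if l: "b i \<le> l" "l \<le> h" for l
    proof -
      obtain j where "j < k" "c j + l * m j \<le> C P + l * W P" using cover[of P l] P(1) S(2) l bh by auto
      moreover from this have "c i + l * m i \<le> c j + l * m j"
        using l by (intro envelope_lowest[OF i]) (auto simp: h_def)
      ultimately show ?thesis by linarith
    qed
    have "c i + b i * m i \<le> C P + b i * W P" "c i + h * m i \<le> C P + h * W P" using low bh by auto
    then have "c i + b i * m i = C P + b i * W P" "c i + h * m i = C P + h * W P"
      using mid by (auto simp: field_simps)
    then have "(h - b i) * (W P - m i) = 0" by (simp add: algebra_simps)
    then show ?thesis using bh P(1) by auto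
  qed
  then have "m ` {..<k} \<subseteq> W ` S" by force
  moreover have "inj_on m {..<k}"
    using envelope_slope_less by (intro linorder_inj_onI) (auto, force)
  ultimately have "card {..<k} \<le> card (W ` S)"
    using card_mono[OF finite_imageI[OF S(1), of W], of "m ` {..<k}"] card_image[of m "{..<k}"] by simp
  then show ?thesis using card_image_le[OF S(1), of W] by simp
qed

end

section \<open>Reading off a shortest path\<close>

definition trace_step :: prog where
  "trace_step = seq [
     SetNVar ''i'' (NArr ''x'' (NVar ''v'')),
     SetNArr ''out'' (NVar ''o'') (NArr ''e'' (NVar ''i'')),
     SetNVar ''o'' (NAdd (NVar ''o'') (NConst 1)),
     Cond (RLess (RVar ''m'') (RArr ''d'' (NArr ''e'' (NVar ''i''))))
       (SetRVar ''m'' (RArr ''d'' (NArr ''e'' (NVar ''i'')))) Skip,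
     SetNVar ''v'' (NArr ''v'' (NVar ''i''))]"

definition trace_prog :: prog where
  "trace_prog = seq [SetNVar ''v'' (NVar ''s''), SetNVar ''o'' (NArr ''start'' (NVar ''k'')),
     SetRVar ''m'' (RConst 0), Loop (TNot (NEq (NVar ''v'') (NVar ''t''))) trace_step]"

lemmas trace_defs = trace_prog_def trace_step_def

context csr begin

text \<open>The clause \<open>f v < f u\<close> makes the removal stamps decrease towards
  \<open>t\<close>. Termination and simplicity of the path rest on it; keys could not exclude a
  cycle of cost zero.\<close>

fun follow :: "(nat \<Rightarrow> nat) \<Rightarrow> (nat \<Rightarrow> real) \<Rightarrow> (nat \<Rightarrow> nat) \<Rightarrow> nat list \<Rightarrow> nat list \<Rightarrow> bool" where
  "follow f k nx [v] [] \<longleftrightarrow> v = t"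
| "follow f k nx (u # v # vs) (e # es) \<longleftrightarrow> u \<noteq> t \<and> u < N \<and> v < N \<and> off v \<le> nx u \<and> nx u < off (Suc v) \<and>
     src (nx u) = u \<and> lab (nx u) = e \<and> d e < thr \<and> f v < f u \<and> k u = chat e + k v \<and>
     follow f k nx (v # vs) es"
| "follow f k nx _ _ \<longleftrightarrow> False"

lemma follow_exists:
  assumes "dij f k nx c N 0" "v < N" "2 \<le> f v"
  shows "\<exists>vs es. follow f k nx (v # vs) es"
  using assms(2,3)
proof (induction "f v" arbitrary: v rule: less_induct)
  case less
  show ?case
  proof (cases "v = t")
    case True
    then have "follow f k nx [v] []" by simp
    then show ?thesis by blast
  next
    case False
    have "1 \<le> f v" using less.prems by simp
    then obtain w where w: "w < N" "off w \<le> nx v" "nx v < off (Suc w)" "src (nx v) = v"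
        "d (lab (nx v)) < thr" "2 \<le> f w" "f w < f v" "k v = chat (lab (nx v)) + k w"
      using assms(1) less.prems False unfolding dij_def by blast
    from less.hyps[OF w(7,1,6)] obtain vs es where "follow f k nx (w # vs) es" by blast
    then have "follow f k nx (v # w # vs) (lab (nx v) # es)" using w less.prems False by simp
    then show ?thesis by blast
  qed
qed

lemma follow_length: "follow f k nx vs es \<Longrightarrow> length vs = Suc (length es) \<and> last vs = t"
  by (induction f k nx vs es rule: follow.induct) auto

lemma follow_distinct:
  assumes "follow f k nx vs es"
  shows "distinct vs" "x \<in> set (tl vs) \<Longrightarrow> f x < f (hd vs)"
proof -
  have "distinct vs \<and> (\<forall>x\<in>set (tl vs). f x < f (hd vs))"
    using assms by (induction f k nx vs es rule: follow.induct) fastforce+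
  then show "distinct vs" "x \<in> set (tl vs) \<Longrightarrow> f x < f (hd vs)" by auto
qed

lemma follow_nodes: "follow f k nx vs es \<Longrightarrow> set vs \<subseteq> {..<N}"
  using target by (induction f k nx vs es rule: follow.induct) auto

lemma follow_length_le:
  assumes "follow f k nx vs es"
  shows "length es < N"
proof -
  have "length vs = card (set vs)" using follow_distinct(1)[OF assms] by (simp add: distinct_card)
  also have "\<dots> \<le> N" using card_mono[OF _ follow_nodes[OF assms]] by simp
  finally show ?thesis using follow_length[OF assms] by simp
qed

lemma follow_cost: "follow f k nx vs es \<Longrightarrow> k (hd vs) = sum_list (map chat es) + k t"
  by (induction f k nx vs es rule: follow.induct) auto

lemma follow_thr: "follow f k nx vs es \<Longrightarrow> e \<in> set es \<Longrightarrow> d e < thr"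
  by (induction f k nx vs es rule: follow.induct) auto

lemma follow_steps:
  assumes "follow f k nx vs es" "\<And>v i. v < N \<Longrightarrow> off v \<le> i \<Longrightarrow> i < off (Suc v) \<Longrightarrow> L (lab i) (src i) v"
  shows "steps L vs es"
  using assms(1)
proof (induction f k nx vs es rule: follow.induct)
  case (2 f k nx u v vs e es)
  then show ?case using assms(2)[of v "nx u"] by auto
qed auto

lemma follow_nth:
  "follow f k nx vs es \<Longrightarrow> j < length es \<Longrightarrow>
     vs ! j \<noteq> t \<and> lab (nx (vs ! j)) = es ! j \<and> dst (nx (vs ! j)) = vs ! Suc j"
proof (induction f k nx vs es arbitrary: j rule: follow.induct)
  case (2 f k nx u v vs e es)
  then show ?case using arc[of v "nx u"] by (cases j) auto
qed auto

lemma wp_trace: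
  assumes fo: "follow f k (Next \<s>) vs es" and s: "hd vs = Vs \<s>"
    and gs: "graph_store \<s>"
  defines "st \<equiv> Start \<s> (Vk \<s>)"
  shows "wp trace_prog (\<lambda>\<s>' \<tau>'. Vo \<s>' = st + length es \<and>
     (\<forall>j<length es. Out \<s>' (st + j) = es ! j) \<and> (\<forall>i<st. Out \<s>' i = Out \<s> i) \<and>
     Rm \<s>' = Max (insert 0 (d ` set es)) \<and> \<tau>' \<le> \<tau> + 7 * length es + 4) \<s> \<tau>"
proof -
  let ?nx = "Next \<s>"
  have g: "Vt \<s> = t" "Lab \<s> = lab" "Dst \<s> = dst" "Weight \<s> = d"
    using gs by (auto simp: graph_store_def)
  note len = follow_length[OF fo]
  have vs: "vs \<noteq> []" using len by auto
  have last: "vs ! length es = t" using len vs by (metis last_conv_nth diff_Suc_1)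
  let ?J = "\<lambda>j (\<s>' :: store) \<tau>'. j \<le> length es \<and> Vo \<s>' = st + j \<and> Vv \<s>' = vs ! j \<and>
     (\<forall>l<j. Out \<s>' (st + l) = es ! l) \<and> (\<forall>i<st. Out \<s>' i = Out \<s> i) \<and>
     Rm \<s>' = Max (insert 0 (d ` set (take j es))) \<and> \<tau>' \<le> \<tau> + 3 + 7 * j"
  show ?thesis
    unfolding trace_prog_def seq.simps wp_Seq wp_SetNVar wp_SetRVar
  proof (rule wp_Loop_frame[where I = "\<lambda>\<s>' \<tau>'. \<exists>j. ?J j \<s>' \<tau>'" and K = "\<tau> + 3 + 7 * length es"], goal_cases)
    case 1
    have "?J 0 (\<s>\<lparr>nat_var := (nat_var \<s>)(''v'' := Vs \<s>, ''o'' := st),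
      real_var := (real_var \<s>)(''m'' := 0)\<rparr>) (\<tau> + 3)" using s vs by (simp add: hd_conv_nth)
    then show ?case by (intro exI[of _ 0]) (simp add: st_def)
  next
    case (2 \<s>' \<tau>')
    then show ?case by force
  next
    case (3 \<s>' \<tau>')
    note u = unchangedD[OF 3(2), unfolded trace_step_def, simplified]
    obtain j where j: "?J j \<s>' \<tau>'" using 3(1) by blast
    have "j \<noteq> length es" using 3(3) j last u g by auto
    then have jl: "j < length es" using j by simp
    note n = follow_nth[OF fo jl]
    have ov: "Vo \<s>' = st + j" "Vv \<s>' = vs ! j" using j by auto
    have tk: "d ` set (take (Suc j) es) = insert (d (es ! j)) (d ` set (take j es))"
      using jl by (simp add: take_Suc_conv_app_nth)
    have mx: "Max (insert 0 (insert (d (es ! j)) (d ` set (take j es)))) =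
        max (d (es ! j)) (Max (insert 0 (d ` set (take j es))))"
      by (subst insert_commute, subst Max_insert) auto
    let ?Q = "\<lambda>(\<s>'' :: store) \<tau>''. Vo \<s>'' = Suc (st + j) \<and> Vv \<s>'' = vs ! Suc j \<and>
      Out \<s>'' = (Out \<s>')(st + j := es ! j) \<and>
      Rm \<s>'' = max (d (es ! j)) (Rm \<s>') \<and> \<tau>'' \<le> \<tau>' + 7"
    have "wp trace_step ?Q \<s>' (Suc \<tau>')"
      using ov n by (simp add: trace_step_def u g max_def)
    then show ?case
    proof (rule wp_mono)
      fix \<s>'' \<tau>'' assume Q: "?Q \<s>'' \<tau>''"
      then have "?J (Suc j) \<s>'' \<tau>''" using j jl by (simp add: tk mx less_Suc_eq)
      then show "\<exists>j. ?J j \<s>'' \<tau>''" by blast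
    qed
  next
    case (4 \<s>' \<tau>')
    note u = unchangedD[OF 4(2), unfolded trace_step_def, simplified]
    obtain j where j: "?J j \<s>' \<tau>'" using 4(1) by blast
    have "vs ! j = t" using 4(3) j u g by simp
    then have "j = length es" using j follow_nth[OF fo, of j] by fastforce
    then show ?case using j by simp
  qed
qed

text \<open>The final keys form a feasible potential, so they bound the cost of every admissible path.\<close>

lemma dij_lower:
  assumes D: "dij f k nx c N 0" and f1: "\<And>v. v < N \<Longrightarrow> f v \<noteq> 1"
    and L: "\<And>e u v. L e u v \<Longrightarrow> v < N \<and> (\<exists>i. off v \<le> i \<and> i < off (Suc v) \<and> lab i = e \<and> src i = u)"
    and st: "steps L vs es" "last vs = t" "\<And>e. e \<in> set es \<Longrightarrow> d e < thr"
  shows "2 \<le> f (hd vs) \<and> k (hd vs) \<le> sum_list (map chat es)"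
  using st L
proof (induction L vs es rule: steps.induct)
  case (1 L v)
  have "1 \<le> f t" "k t = 0" using D by (auto simp: dij_def)
  then show ?case using 1 f1[OF target] by auto
next
  case (2 L u v vs e es)
  have "2 \<le> f (hd (v # vs)) \<and> k (hd (v # vs)) \<le> sum_list (map chat es)"
    using "2.prems" by (intro "2.IH"[OF _ _ _ "2.prems"(4)]) auto
  then have v: "2 \<le> f v" "k v \<le> sum_list (map chat es)" by auto
  have "L e u v" "d e < thr" using "2.prems" by auto
  with "2.prems"(4)[of e u v] obtain i where i: "v < N" "off v \<le> i" "i < off (Suc v)" "lab i = e" "src i = u"
    by blast
  have "1 \<le> f (src i) \<and> k (src i) \<le> chat (lab i) + k v"
    using D i v \<open>d e < thr\<close> unfolding dij_def by blast
  moreover have "u < N" using arc[OF i(1-3)] i by simp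
  ultimately show ?case using i v f1[of u] by auto
qed auto

end

text \<open>Translates the final state of the search into paths of \<open>G\<close>. An unseen
  \<open>s\<close> means that every path has an edge at or above the threshold, which is how the
  algorithm learns that it is done.\<close>

lemma search_result:
  fixes G :: "(nat, nat) pre_digraph"
  assumes csr: "csr N off src lab dst chat t"
    and D: "csr.dij N off src lab chat d t thr f k nx c N 0" and f1: "\<And>v. v < N \<Longrightarrow> f v \<noteq> 1"
    and L: "\<And>e u v. edge_link directed G e u v \<longleftrightarrow> v < N \<and> (\<exists>i. off v \<le> i \<and> i < off (Suc v) \<and> lab i = e \<and> src i = u)"
    and s: "s < N" "s \<in> verts G" "s \<noteq> t"
  shows "0 < f s \<Longrightarrow> \<exists>vs es. csr.follow N off src lab chat d t thr f k nx vs es \<and> hd vs = s \<and> es \<in> st_paths directed G s t \<and>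
      es \<noteq> [] \<and> path_cost chat es = k s \<and> (\<forall>e\<in>set es. d e < thr) \<and>
      (\<forall>P\<in>st_paths directed G s t. (\<forall>e\<in>set P. d e < thr) \<longrightarrow> k s \<le> path_cost chat P)"
    and "f s = 0 \<Longrightarrow> P \<in> st_paths directed G s t \<Longrightarrow> \<exists>e\<in>set P. thr \<le> d e"
proof -
  interpret csr N off src lab dst chat d t thr by (rule csr)
  have low: "2 \<le> f s \<and> k s \<le> path_cost chat P"
    if P: "P \<in> st_paths directed G s t" "\<And>e. e \<in> set P \<Longrightarrow> d e < thr" for P
  proof -
    obtain vs where vs: "steps (edge_link directed G) vs P" "hd vs = s" "last vs = t" "distinct vs"
      using P(1) by (auto simp: st_paths_iff)
    have "2 \<le> f (hd vs) \<and> k (hd vs) \<le> sum_list (map chat P)"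
      using L by (intro dij_lower[OF D f1 _ vs(1,3) P(2)]) auto
    then show ?thesis using vs path_cost_sum_list steps_distinct(1)[OF vs(1,4)] by metis
  qed
  then show "\<exists>e\<in>set P. thr \<le> d e" if "f s = 0" "P \<in> st_paths directed G s t"
    using that by (metis not_le not_numeral_le_zero)
  assume "0 < f s"
  then have "2 \<le> f s" using f1[OF s(1)] by linarith
  then obtain vs es where fo: "follow f k nx (s # vs) es" using follow_exists[OF D s(1)] by blast
  have st: "steps (edge_link directed G) (s # vs) es" using L by (intro follow_steps[OF fo]) auto
  note dist = follow_distinct(1)[OF fo]
  have P: "es \<in> st_paths directed G s t"
    using st dist follow_length[OF fo] s(2) unfolding st_paths_iff by (auto intro!: exI[of _ "s # vs"])
  have "es \<noteq> []" using fo s(3) by (cases vs) auto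
  moreover have "path_cost chat es = k s"
    using follow_cost[OF fo] D path_cost_sum_list[OF steps_distinct(1)[OF st dist], of chat] by (simp add: dij_def)
  ultimately show "\<exists>vs es. follow f k nx vs es \<and> hd vs = s \<and> es \<in> st_paths directed G s t \<and>
      es \<noteq> [] \<and> path_cost chat es = k s \<and> (\<forall>e\<in>set es. d e < thr) \<and>
      (\<forall>P\<in>st_paths directed G s t. (\<forall>e\<in>set P. d e < thr) \<longrightarrow> k s \<le> path_cost chat P)"
    using fo P follow_thr[OF fo] low by (intro exI[of _ "s # vs"] exI[of _ es]) auto
qed

section \<open>Rounds of the algorithm\<close>

text \<open>Both lines are compared at the breakpoint of the top. A tie drops the top too: it would
  be lowest at a single point only, and keeping it would spoil the strict order of the breakpoints
  and hence minimality.\<close>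

definition drop_prog :: prog where
  "drop_prog = Loop (TAnd (NLess (NConst 0) (NVar ''k''))
       (TNot (RLess
         (RAdd (RArr ''c'' (NSub (NVar ''k'') (NConst 1)))
           (RMul (RArr ''b'' (NSub (NVar ''k'') (NConst 1))) (RArr ''m'' (NSub (NVar ''k'') (NConst 1)))))
         (RAdd (RArr ''k'' (NVar ''s'')) (RMul (RArr ''b'' (NSub (NVar ''k'') (NConst 1))) (RVar ''m''))))))
     (SetNVar ''k'' (NSub (NVar ''k'') (NConst 1)))"

definition push_prog :: prog where
  "push_prog = seq [
     Cond (NLess (NConst 0) (NVar ''k''))
       (SetRArr ''b'' (NVar ''k'') (RDiv
         (RSub (RArr ''k'' (NVar ''s'')) (RArr ''c'' (NSub (NVar ''k'') (NConst 1))))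
         (RSub (RArr ''m'' (NSub (NVar ''k'') (NConst 1))) (RVar ''m''))))
       (SetRArr ''b'' (NVar ''k'') (RConst 0)),
     SetRArr ''c'' (NVar ''k'') (RArr ''k'' (NVar ''s'')),
     SetRArr ''m'' (NVar ''k'') (RVar ''m''),
     trace_prog,
     SetNArr ''start'' (NAdd (NVar ''k'') (NConst 1)) (NVar ''o''),
     SetNVar ''k'' (NAdd (NVar ''k'') (NConst 1)),
     SetRVar ''T'' (RVar ''m'')]"

text \<open>The path is traced twice. The first trace provides its maximal weight, which the
  comparison with the stack needs; the second writes the edges to their final place once
  \<open>k\<close> is settled. What the first writes lies behind the segments of the paths on the
  stack.\<close>

definition round_prog :: prog where
  "round_prog = seq [dijkstra_prog,
     Cond (NLess (NConst 0) (NArr ''f'' (NVar ''s'')))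
       (seq [trace_prog, drop_prog, push_prog])
       (SetNVar ''G'' (NConst 0))]"

text \<open>The bound by \<open>RT\<close> prepares the next push: a path with all weights below the
  threshold has a strictly smaller slope than every line on the stack.\<close>

definition outputs_ok ::
    "nat list set \<Rightarrow> (nat \<Rightarrow> real) \<Rightarrow> (nat \<Rightarrow> real) \<Rightarrow> nat \<Rightarrow> store \<Rightarrow> bool" where
  "outputs_ok X chat d k \<s> \<longleftrightarrow>
     envelope (Cost \<s>) (Slope \<s>) (Break \<s>) k \<and>
     (\<forall>i j. i \<le> j \<and> j \<le> k \<longrightarrow> Start \<s> i \<le> Start \<s> j) \<and>
     (\<forall>i<k. output_path \<s> i \<in> X \<and> path_cost chat (output_path \<s> i) = Cost \<s> i \<and>
        path_weight d (output_path \<s> i) = Slope \<s> i \<and> RT \<s> \<le> Slope \<s> i)"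

lemma outputs_ok_le:
  assumes "outputs_ok X chat d k \<s>" "k' \<le> k"
    and "Cost \<s>' = Cost \<s>" "Slope \<s>' = Slope \<s>"
      "Break \<s>' = Break \<s>" "Start \<s>' = Start \<s>"
      "RT \<s>' = RT \<s>"
      "\<And>i. i < Start \<s> k \<Longrightarrow> Out \<s>' i = Out \<s> i"
  shows "outputs_ok X chat d k' \<s>'"
proof -
  have "output_path \<s>' i = output_path \<s> i" if "i < k" for i
  proof -
    have "Start \<s> (Suc i) \<le> Start \<s> k"
      using assms(1) that by (simp add: outputs_ok_def)
    then show ?thesis using assms(6,8) by (auto simp: output_path_def)
  qed
  then show ?thesis using assms(1-7) by (auto simp: outputs_ok_def intro: envelope_pop)
qed

lemma outputs_ok_push:
  assumes ok: "outputs_ok X chat d k \<s>"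
    and P: "P \<in> X" "path_cost chat P = c'" "path_weight d P = m'" "m' < RT \<s>"
    and b0: "k = 0 \<Longrightarrow> b' = 0"
    and top: "0 < k \<Longrightarrow> Cost \<s> (k - 1) + Break \<s> (k - 1) * Slope \<s> (k - 1)
        < c' + Break \<s> (k - 1) * m' \<and>
      b' = (c' - Cost \<s> (k - 1)) / (Slope \<s> (k - 1) - m')"
    and s': "Cost \<s>' = (Cost \<s>)(k := c')" "Slope \<s>' = (Slope \<s>)(k := m')"
      "Break \<s>' = (Break \<s>)(k := b')" "RT \<s>' = m'"
      "Start \<s>' = (Start \<s>)(Suc k := Start \<s> k + length P)"
      "\<And>i. i < Start \<s> k \<Longrightarrow> Out \<s>' i = Out \<s> i"
      "\<And>j. j < length P \<Longrightarrow> Out \<s>' (Start \<s> k + j) = P ! j"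
  shows "outputs_ok X chat d (Suc k) \<s>'"
proof -
  let ?st = "Start \<s>"
  have old: "output_path \<s>' i = output_path \<s> i" if "i < k" for i
  proof -
    have "?st (Suc i) \<le> ?st k" using ok that by (simp add: outputs_ok_def)
    then show ?thesis using that s' by (auto simp: output_path_def)
  qed
  have new: "output_path \<s>' k = P"
    by (rule nth_equalityI) (simp_all add: output_path_def s')
  have mono: "i \<le> j \<Longrightarrow> j \<le> k \<Longrightarrow> ?st i \<le> ?st j" for i j using ok by (simp add: outputs_ok_def)
  have "Start \<s>' i \<le> Start \<s>' j" if "i \<le> j" "j \<le> Suc k" for i j
    using that mono[of i j] mono[of i k] unfolding s'(5) by (cases "j = Suc k"; cases "i = Suc k") auto
  moreover have "envelope (Cost \<s>') (Slope \<s>') (Break \<s>') (Suc k)"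
    unfolding s'(1-3)
  proof (rule envelope_push)
    show "envelope (Cost \<s>) (Slope \<s>) (Break \<s>) k" using ok by (simp add: outputs_ok_def)
    assume "0 < k"
    moreover from this have "RT \<s> \<le> Slope \<s> (k - 1)"
      using ok by (simp add: outputs_ok_def)
    then have "m' < Slope \<s> (k - 1)" using P(4) by simp
    ultimately show "m' < Slope \<s> (k - 1) \<and>
      Cost \<s> (k - 1) + Break \<s> (k - 1) * Slope \<s> (k - 1) < c' + Break \<s> (k - 1) * m' \<and>
      b' = (c' - Cost \<s> (k - 1)) / (Slope \<s> (k - 1) - m')" using top by blast
  qed (fact b0)
  moreover have "output_path \<s>' i \<in> X \<and> path_cost chat (output_path \<s>' i) = Cost \<s>' i \<and>
        path_weight d (output_path \<s>' i) = Slope \<s>' i \<and> RT \<s>' \<le> Slope \<s>' i"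
    if "i < Suc k" for i
  proof (cases "i = k")
    case False
    then have i: "i < k" using that by simp
    moreover have "RT \<s> \<le> Slope \<s> i" using ok i by (simp add: outputs_ok_def)
    ultimately show ?thesis using ok old[OF i] P(4) s' by (auto simp: outputs_ok_def)
  qed (use new P s' in simp)
  ultimately show ?thesis unfolding outputs_ok_def by blast
qed

text \<open>The new line is not on the stack yet, so coverage is a disjunction: at each size a path
  is matched by a stack line or by the new one. Each drop trades its line for these two
  options.\<close>

lemma wp_drop:
  assumes ok: "outputs_ok X chat d (Vk \<s>) \<s>" and m': "Rm \<s> < RT \<s>"
    and cov: "\<And>P l. P \<in> Y \<Longrightarrow> 0 \<le> l \<Longrightarrow>
       (\<exists>i<Vk \<s>. Cost \<s> i + l * Slope \<s> i \<le> path_cost chat P + l * path_weight d P) \<or>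
       Key \<s> (Vs \<s>) + l * Rm \<s> \<le> path_cost chat P + l * path_weight d P"
  shows "wp drop_prog (\<lambda>\<s>' \<tau>'. let k' = Vk \<s>'; c' = Key \<s> (Vs \<s>); m' = Rm \<s> in
     k' \<le> Vk \<s> \<and>
     (0 < k' \<longrightarrow> Cost \<s> (k' - 1) + Break \<s> (k' - 1) * Slope \<s> (k' - 1)
        < c' + Break \<s> (k' - 1) * m') \<and>
     (\<forall>P\<in>Y. \<forall>l\<ge>0. (\<exists>i<k'. Cost \<s> i + l * Slope \<s> i \<le> path_cost chat P + l * path_weight d P) \<or>
        c' + l * m' \<le> path_cost chat P + l * path_weight d P) \<and>
     \<tau>' \<le> \<tau> + 2 * Vk \<s> + 1) \<s> \<tau>"
proof -
  let ?c = "Cost \<s>" and ?m = "Slope \<s>" and ?b = "Break \<s>"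
    and ?c' = "Key \<s> (Vs \<s>)" and ?m' = "Rm \<s>"
  let ?I = "\<lambda>(\<s>' :: store) \<tau>'. let k' = Vk \<s>' in k' \<le> Vk \<s> \<and>
     (\<forall>P\<in>Y. \<forall>l\<ge>0. (\<exists>i<k'. ?c i + l * ?m i \<le> path_cost chat P + l * path_weight d P) \<or>
        ?c' + l * ?m' \<le> path_cost chat P + l * path_weight d P) \<and>
     \<tau>' + 2 * k' \<le> \<tau> + 2 * Vk \<s>"
  show ?thesis
    unfolding drop_prog_def
  proof (rule wp_Loop_frame[where I = ?I and K = "\<tau> + 2 * Vk \<s>"], goal_cases)
    case 1
    then show ?case using cov by auto
  next
    case (2 \<s>' \<tau>')
    then show ?case by (simp add: Let_def)
  next
    case (3 \<s>' \<tau>')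
    note u = unchangedD[OF 3(2), simplified]
    let ?k = "Vk \<s>'"
    have k: "0 < ?k" "?k \<le> Vk \<s>"
      and le: "?c' + ?b (?k - 1) * ?m' \<le> ?c (?k - 1) + ?b (?k - 1) * ?m (?k - 1)"
      using 3(1,3) u by (auto simp: Let_def)
    have env: "envelope ?c ?m ?b ?k" using ok k envelope_pop by (auto simp: outputs_ok_def)
    have "RT \<s> \<le> ?m (?k - 1)" using ok k by (simp add: outputs_ok_def)
    then have mk: "?m' < ?m (?k - 1)" using m' by simp
    have "(\<exists>i<?k - 1. ?c i + l * ?m i \<le> path_cost chat P + l * path_weight d P) \<or>
        ?c' + l * ?m' \<le> path_cost chat P + l * path_weight d P" if P: "P \<in> Y" "0 \<le> l" for P l
    proof -
      consider i where "i < ?k" "?c i + l * ?m i \<le> path_cost chat P + l * path_weight d P"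
        | "?c' + l * ?m' \<le> path_cost chat P + l * path_weight d P"
        using 3(1) P unfolding Let_def by blast
      then show ?thesis
      proof cases
        case (1 i)
        show ?thesis
        proof (cases "i = ?k - 1")
          case True
          then have top: "?c (?k - 1) + l * ?m (?k - 1) \<le> path_cost chat P + l * path_weight d P"
            using 1(2) by simp
          from envelope_top_redundant[OF env k(1) mk le P(2)] show ?thesis
          proof
            assume "\<exists>i<?k - 1. ?c i + l * ?m i \<le> ?c (?k - 1) + l * ?m (?k - 1)"
            then obtain i where "i < ?k - 1" "?c i + l * ?m i \<le> ?c (?k - 1) + l * ?m (?k - 1)" by blast
            then show ?thesis using order_trans[OF _ top] by blast
          qed (use order_trans[OF _ top] in blast)
        next
          case False
          then have "i < ?k - 1" using 1 by simp
          then show ?thesis using 1 by blast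
        qed
      qed blast
    qed
    then show ?case using 3(1) k by (auto simp: Let_def)
  next
    case (4 \<s>' \<tau>')
    note u = unchangedD[OF 4(2), simplified]
    show ?case using 4(1,3) u by (auto simp: Let_def not_le)
  qed
qed

text \<open>The trace starts its running maximum at 0, which positive weights make harmless.\<close>

lemma Max_insert_zero:
  fixes d :: "'e \<Rightarrow> real"
  assumes "es \<noteq> []" "\<And>e. e \<in> set es \<Longrightarrow> 0 < d e"
  shows "Max (insert 0 (d ` set es)) = path_weight d es"
proof -
  have "hd es \<in> set es" using assms(1) by simp
  then have "0 \<le> Max (d ` set es)"
    using assms(2)[of "hd es"] by (intro order_trans[OF less_imp_le Max_ge[of _ "d (hd es)"]]) auto
  then show ?thesis using assms(1) by (subst Max_insert) (auto simp: path_weight_def)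
qed

text \<open>The factor in \<open>2 * M\<close> is due to undirected edges, which are listed at both
  ends. \<open>q\<close> stands for the binary logarithm of \<open>N\<close>; it occurs in the
  analysis only and is not computed by the program.\<close>

locale search_problem =
  fixes N M :: nat and off src lab dst :: "nat \<Rightarrow> nat" and chat d :: "nat \<Rightarrow> real" and s t :: nat
    and directed :: bool and G :: "(nat, nat) pre_digraph" and q :: nat
  assumes csr: "csr N off src lab dst chat t"
    and links: "edge_link directed G e u v \<longleftrightarrow>
      v < N \<and> (\<exists>i. off v \<le> i \<and> i < off (Suc v) \<and> lab i = e \<and> src i = u)"
    and G: "verts G = {..<N}" "arcs G = {..<M}" "s < N" "s \<noteq> t"
    and d: "e < M \<Longrightarrow> 0 < d e"
    and off_sum: "(\<Sum>v<N. off (Suc v) - off v) \<le> 2 * M"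
    and q: "N < 2 ^ q"
begin

abbreviation paths :: "nat list set" where "paths \<equiv> st_paths directed G s t"

definition covered :: "nat \<Rightarrow> store \<Rightarrow> nat list set \<Rightarrow> bool" where
  "covered k \<s> Y \<longleftrightarrow> (\<forall>P\<in>Y. \<forall>l\<ge>0. \<exists>i<k. Cost \<s> i + l * Slope \<s> i \<le> path_cost chat P + l * path_weight d P)"

text \<open>Coverage is claimed only for paths whose maximum is at or above the threshold. At the
  start there are none; when the search fails there are no others.\<close>

definition round_inv :: "store \<Rightarrow> bool" where
  "round_inv \<s> \<longleftrightarrow> csr.graph_store N off src lab dst chat d t (RT \<s>) \<s> \<and> Vs \<s> = s \<and>
     (\<forall>n. Bucket \<s> n = 0) \<and> outputs_ok paths chat d (Vk \<s>) \<s> \<and>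
     covered (Vk \<s>) \<s> {P \<in> paths. RT \<s> \<le> path_weight d P}"

lemma path_edges:
  assumes "P \<in> paths"
  shows "P \<noteq> []" "set P \<subseteq> {..<M}" "path_weight d P \<in> d ` {..<M}" "e \<in> set P \<Longrightarrow> 0 < d e"
    "(\<exists>e\<in>set P. x \<le> d e) \<longleftrightarrow> x \<le> path_weight d P"
proof -
  obtain vs where vs: "steps (edge_link directed G) vs P" "hd vs = s" "last vs = t" "distinct vs"
    using assms by (auto simp: st_paths_iff)
  show ne: "P \<noteq> []" using steps_nonempty[OF vs(1)] vs G(4) by (cases vs) auto
  show sub: "set P \<subseteq> {..<M}" using steps_distinct(2)[OF vs(1,4)] G(2) by simp
  have "path_weight d P \<in> d ` set P" unfolding path_weight_def using ne by (intro Max_in) auto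
  then show "path_weight d P \<in> d ` {..<M}" using sub by blast
  show "e \<in> set P \<Longrightarrow> 0 < d e" using sub d by auto
  show "(\<exists>e\<in>set P. x \<le> d e) \<longleftrightarrow> x \<le> path_weight d P"
    unfolding path_weight_def using ne by (subst Max_ge_iff) auto
qed

text \<open>The slopes on the stack are distinct, and each of them is the weight of some
  edge.\<close>

lemma outputs_count:
  assumes "outputs_ok paths chat d k \<s>"
  shows "k \<le> M"
proof -
  have env: "envelope (Cost \<s>) (Slope \<s>) (Break \<s>) k"
    using assms by (simp add: outputs_ok_def)
  have "inj_on (Slope \<s>) {..<k}"
    using envelope_slope_less[OF env] by (intro linorder_inj_onI) (auto, force)
  moreover have "Slope \<s> ` {..<k} \<subseteq> d ` {..<M}"
  proof
    fix x assume "x \<in> Slope \<s> ` {..<k}"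
    then obtain i where "i < k" "x = Slope \<s> i" by auto
    then have "output_path \<s> i \<in> paths" "path_weight d (output_path \<s> i) = x"
      using assms by (auto simp: outputs_ok_def)
    then show "x \<in> d ` {..<M}" using path_edges(3) by blast
  qed
  ultimately have "card {..<k} \<le> card (d ` {..<M})"
    using card_mono[of "d ` {..<M}" "Slope \<s> ` {..<k}"] card_image[of "Slope \<s>" "{..<k}"] by simp
  then show ?thesis using card_image_le[of "{..<M}" d] by simp
qed

text \<open>\<open>526 * M\<close> covers 261 for each of at most \<open>2 * M\<close> arcs and the
  drops; 309 is \<open>103 * 3\<close>, from \<open>D = 3 * q\<close>; 46 is 32 from Dijkstra's
  algorithm plus 7 per node for each of the two traces.\<close>

definition round_time :: nat where
  "round_time = 526 * M + N * (309 * q + 46) + 120"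

lemma wp_push:
  assumes fo: "csr.follow N off src lab chat d t thr f k (Next \<s>) vs es" "hd vs = s"
    and gs: "csr.graph_store N off src lab dst chat d t thr \<s>" "thr = RT \<s>" "Vs \<s> = s"
    and es: "es \<in> paths" "path_cost chat es = Key \<s> s" "path_weight d es = Rm \<s>"
      "Rm \<s> < RT \<s>"
    and ok: "outputs_ok paths chat d (Vk \<s>) \<s>"
    and top: "0 < Vk \<s> \<Longrightarrow>
      Cost \<s> (Vk \<s> - 1) + Break \<s> (Vk \<s> - 1) * Slope \<s> (Vk \<s> - 1)
        < Key \<s> s + Break \<s> (Vk \<s> - 1) * Rm \<s>"
  shows "wp push_prog (\<lambda>\<s>' \<tau>'. Vk \<s>' = Suc (Vk \<s>) \<and>
     outputs_ok paths chat d (Suc (Vk \<s>)) \<s>' \<and> RT \<s>' = Rm \<s> \<and>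
     Cost \<s>' = (Cost \<s>)(Vk \<s> := Key \<s> s) \<and>
     Slope \<s>' = (Slope \<s>)(Vk \<s> := Rm \<s>) \<and>
     \<tau>' \<le> \<tau> + 7 * N + 12) \<s> \<tau>" (is "wp _ ?P _ _")
proof -
  let ?k = "Vk \<s>" and ?c = "Cost \<s>" and ?m = "Slope \<s>" and ?b = "Break \<s>"
    and ?c' = "Key \<s> s" and ?m' = "Rm \<s>"
  define b' where "b' = (if 0 < ?k then (?c' - ?c (?k - 1)) / (?m (?k - 1) - ?m') else 0)"
  define \<s>1 where "\<s>1 = \<s>\<lparr>real_arr := (real_arr \<s>)(''b'' := ?b(?k := b'), ''c'' := ?c(?k := ?c'), ''m'' := ?m(?k := ?m'))\<rparr>"
  interpret csr N off src lab dst chat d t thr by (rule csr)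
  have gs1: "graph_store \<s>1" using gs(1) by (simp add: graph_store_def \<s>1_def)
  have red: "wp push_prog Q \<s> \<tau>"
    if "wp trace_prog (wp (seq [SetNArr ''start'' (NAdd (NVar ''k'') (NConst 1)) (NVar ''o''),
     SetNVar ''k'' (NAdd (NVar ''k'') (NConst 1)), SetRVar ''T'' (RVar ''m'')]) Q) \<s>1 (\<tau> + 4)" for Q
    using that gs(3) by (cases "0 < ?k") (simp_all add: push_prog_def \<s>1_def b'_def eval_nat_numeral)
  show ?thesis
  proof (rule red, rule wp_frame[OF wp_trace[OF _ _ gs1, of f k vs es]], goal_cases)
    show "follow f k (Next \<s>1) vs es" using fo(1) by (simp add: \<s>1_def)
    show "hd vs = Vs \<s>1" using fo(2) gs(3) by (simp add: \<s>1_def)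
  next
    case (3 \<s>2 \<tau>2)
    note t = 3(1) and u = unchangedD[OF 3(2), unfolded trace_defs, simplified]
    let ?\<s>3 = "\<s>2\<lparr>nat_arr := (nat_arr \<s>2)(''start'' := (Start \<s>)(Suc ?k := Start \<s> ?k + length es)),
      nat_var := (nat_var \<s>2)(''k'' := Suc ?k), real_var := (real_var \<s>2)(''T'' := ?m')\<rparr>"
    have m2: "Rm \<s>2 = ?m'"
      using t Max_insert_zero[of es d] path_edges(1,4)[OF es(1)] es(3) by simp
    have "outputs_ok paths chat d (Suc ?k) ?\<s>3"
    proof (rule outputs_ok_push[OF ok es(1,2,3,4)])
      show "Break ?\<s>3 = ?b(?k := b')" by (simp add: u \<s>1_def)
    next
      show "0 < ?k \<Longrightarrow> ?c (?k - 1) + ?b (?k - 1) * ?m (?k - 1) < ?c' + ?b (?k - 1) * ?m' \<and>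
        b' = (?c' - ?c (?k - 1)) / (?m (?k - 1) - ?m')" using top by (simp add: b'_def)
    qed (use t in \<open>simp_all add: u \<s>1_def b'_def\<close>)
    moreover have "length es < N" by (rule follow_length_le[OF fo(1)])
    ultimately have "?P ?\<s>3 (\<tau>2 + 3)" using t by (simp add: u \<s>1_def)
    then show ?case
      using t m2 by (simp add: u \<s>1_def eval_nat_numeral)
  qed
qed

text \<open>A round either lowers the threshold to the weight of an edge, which gives the progress
  measure for the outer loop, or clears the flag \<open>G\<close> because no path is left below the
  threshold.\<close>

lemma wp_round:
  assumes inv: "round_inv \<s>"
  shows "wp round_prog (\<lambda>\<s>' \<tau>'. round_inv \<s>' \<and> \<tau>' \<le> \<tau> + round_time \<and>
    (VG \<s>' = VG \<s> \<and> RT \<s>' < RT \<s> \<and> RT \<s>' \<in> d ` {..<M} \<or>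
     VG \<s>' = 0 \<and> RT \<s>' = RT \<s> \<and> (\<forall>P\<in>paths. RT \<s> \<le> path_weight d P))) \<s> \<tau>"
    (is "wp _ ?P _ _")
proof -
  let ?thr = "RT \<s>"
  interpret csr N off src lab dst chat d t ?thr by (rule csr)
  have gs: "graph_store \<s>" and s: "Vs \<s> = s" and b: "\<And>n. Bucket \<s> n = 0"
    and ok: "outputs_ok paths chat d (Vk \<s>) \<s>"
    and cov: "covered (Vk \<s>) \<s> {P \<in> paths. ?thr \<le> path_weight d P}"
    using inv by (auto simp: round_inv_def)
  let ?k = "Vk \<s>"
  note kM = outputs_count[OF ok]
  show ?thesis
    unfolding round_prog_def seq.simps wp_Seq
  proof (rule wp_frame[OF wp_dijkstra[OF gs b q refl]], goal_cases)
    case (1 \<s>1 \<tau>1)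
    note D = 1(1) and u1 = unchangedD[OF 1(2), unfolded dijkstra_defs, simplified]
    have \<tau>1: "\<tau>1 \<le> \<tau> + 522 * M + N * (309 * q + 32) + 80" using D off_sum by simp
    note res = search_result[OF csr conjunct1[OF conjunct2[OF conjunct2[OF D]]] _ links G(3) _ G(4)]
    have f1: "\<And>v. v < N \<Longrightarrow> Status \<s>1 v \<noteq> 1" and sv: "s \<in> verts G" using D G by auto
    have gs1: "graph_store \<s>1" using gs by (simp add: graph_store_def u1)
    show ?case
    proof (cases "Status \<s>1 s = 0")
      case True
      let ?\<s>2 = "\<s>1\<lparr>nat_var := (nat_var \<s>1)(''G'' := 0)\<rparr>"
      have "\<forall>P\<in>paths. ?thr \<le> path_weight d P" using res(2)[OF f1 sv True] path_edges(5) by blast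
      moreover have "outputs_ok paths chat d ?k ?\<s>2"
        by (rule outputs_ok_le[OF ok order_refl]) (simp_all add: u1)
      then have "round_inv ?\<s>2"
        using D gs1 s cov by (simp add: round_inv_def u1 covered_def graph_store_def)
      ultimately have "?P ?\<s>2 (\<tau>1 + 2)" using \<tau>1 by (simp add: u1 round_time_def algebra_simps)
      then show ?thesis using True s by (simp add: u1)
    next
      case False
      then obtain vs es where fo: "follow (Status \<s>1) (Key \<s>1) (Next \<s>1) vs es"
          and hd: "hd vs = s" and es: "es \<in> paths" "es \<noteq> []" "path_cost chat es = Key \<s>1 s"
          and thr: "\<forall>e\<in>set es. d e < ?thr"
          and best: "\<And>P. P \<in> paths \<Longrightarrow> \<forall>e\<in>set P. d e < ?thr \<Longrightarrow> Key \<s>1 s \<le> path_cost chat P"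
        using res(1)[OF f1 sv] by blast
      define c' where "c' = Key \<s>1 s"
      define m' where "m' = path_weight d es"
      define Y where "Y = {P \<in> paths. m' \<le> path_weight d P}"
      have lenN: "length es < N" by (rule follow_length_le[OF fo])
      have m't: "m' < ?thr" using thr path_edges(5)[OF es(1), of ?thr] by (auto simp: m'_def not_le[symmetric])
      have "wp trace_prog (wp drop_prog (wp push_prog ?P)) \<s>1 (Suc \<tau>1)"
      proof (rule wp_frame[OF wp_trace[OF fo _ gs1]], goal_cases)
        show "hd vs = Vs \<s>1" using hd s by (simp add: u1)
      next
        case (2 \<s>2 \<tau>2)
        note t = 2(1) and u2 = unchangedD[OF 2(2), unfolded trace_defs, simplified]
        have m2: "Rm \<s>2 = m'"
          using t Max_insert_zero[of es d] path_edges(1,4)[OF es(1)] by (simp add: m'_def)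
        have ok2: "outputs_ok paths chat d (Vk \<s>2) \<s>2"
          using t by (intro outputs_ok_le[OF ok]) (simp_all add: u2 u1)
        have T2: "RT \<s>2 = ?thr" "Key \<s>2 (Vs \<s>2) = c'" "Vk \<s>2 = ?k"
          using s by (simp_all add: u2 u1 c'_def)
        have cov2: "(\<exists>i<Vk \<s>2. Cost \<s>2 i + l * Slope \<s>2 i \<le> path_cost chat P + l * path_weight d P) \<or>
             Key \<s>2 (Vs \<s>2) + l * Rm \<s>2 \<le> path_cost chat P + l * path_weight d P"
          if P: "P \<in> Y" "0 \<le> l" for P l
        proof (cases "?thr \<le> path_weight d P")
          case True
          then show ?thesis using cov P by (auto simp: covered_def u2 u1 Y_def)
        next
          case False
          then have "\<forall>e\<in>set P. d e < ?thr" using path_edges(5)[of P ?thr] P by (auto simp: not_le[symmetric] Y_def)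
          then have "c' \<le> path_cost chat P" using best P by (simp add: c'_def Y_def)
          moreover have "l * m' \<le> l * path_weight d P" using P by (intro mult_left_mono) (auto simp: Y_def)
          ultimately show ?thesis unfolding T2 m2 by linarith
        qed
        have m2T: "Rm \<s>2 < RT \<s>2" using m2 T2 m't by simp
        show ?case
        proof (rule wp_frame[OF wp_drop[OF ok2 m2T cov2]], assumption, assumption, goal_cases)
          case (1 \<s>3 \<tau>3)
          note p = 1(1) and u3 = unchangedD[OF 1(2), unfolded drop_prog_def, simplified]
          let ?k3 = "Vk \<s>3"
          have k3: "?k3 \<le> ?k" using p T2 by (simp add: Let_def)
          have ok3: "outputs_ok paths chat d ?k3 \<s>3"
            using k3 T2 by (intro outputs_ok_le[OF ok2]) (simp_all add: u3)
          have gs3: "graph_store \<s>3" using gs1 by (simp add: graph_store_def u2 u3)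
          have c3: "Key \<s>3 s = c'" "Rm \<s>3 = m'" "RT \<s>3 = ?thr" "Vs \<s>3 = s"
            using T2 m2 s by (simp_all add: u3 u2 u1)
          show ?case
          proof (rule wp_frame[OF wp_push[OF _ hd gs3 _ c3(4) es(1)]], goal_cases)
            show "follow (Status \<s>1) (Key \<s>1) (Next \<s>3) vs es"
              using fo by (simp add: u3 u2)
            show "?thr = RT \<s>3" "path_cost chat es = Key \<s>3 s"
              "path_weight d es = Rm \<s>3" "Rm \<s>3 < RT \<s>3"
              "outputs_ok paths chat d ?k3 \<s>3"
              using es ok3 m't unfolding c3 by (simp_all add: c'_def m'_def)
            show "Cost \<s>3 (?k3 - 1) + Break \<s>3 (?k3 - 1) * Slope \<s>3 (?k3 - 1)
                < Key \<s>3 s + Break \<s>3 (?k3 - 1) * Rm \<s>3" if "0 < ?k3"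
              using p that T2 m2 unfolding c3 by (simp add: Let_def u3)
          next
            case (8 \<s>4 \<tau>4)
            note r = 8(1) and u4 = unchangedD[OF 8(2), unfolded push_prog_def trace_defs, simplified]
            have T4: "RT \<s>4 = m'" using r c3 by simp
            have "csr.graph_store N off src lab dst chat d t m' \<s>4"
              using gs3 T4 by (simp add: csr.graph_store_def[OF csr] u4)
            moreover have "Bucket \<s>4 n = 0" for n using D by (simp add: u4 u3 u2)
            moreover have "covered (Suc ?k3) \<s>4 Y"
              unfolding covered_def
            proof (intro ballI allI impI)
              fix P l assume P: "P \<in> Y" "0 \<le> (l :: real)"
              then consider i where "i < ?k3" "Cost \<s>2 i + l * Slope \<s>2 i \<le> path_cost chat P + l * path_weight d P"
                | "c' + l * m' \<le> path_cost chat P + l * path_weight d P"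
                using p unfolding Let_def T2 m2 by blast
              then show "\<exists>i<Suc ?k3. Cost \<s>4 i + l * Slope \<s>4 i \<le> path_cost chat P + l * path_weight d P"
              proof cases
                case (1 i)
                then show ?thesis using r by (intro exI[of _ i]) (simp add: u3)
              next
                case 2
                then show ?thesis using r c3 by (intro exI[of _ ?k3]) simp
              qed
            qed
            ultimately have "round_inv \<s>4" using r s T4 by (simp add: round_inv_def u4 u3 u2 u1 Y_def)
            moreover have "\<tau>4 \<le> \<tau> + round_time"
              using r p t \<tau>1 T2(3) kM lenN by (simp add: Let_def round_time_def algebra_simps)
            moreover have "VG \<s>4 = VG \<s>" by (simp add: u4 u3 u2 u1)
            moreover have "m' \<in> d ` {..<M}" unfolding m'_def by (rule path_edges(3)[OF es(1)])
            ultimately show "?P \<s>4 \<tau>4" using T4 m't by simp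
          qed
        qed
      qed
      moreover have "wp (Seq drop_prog push_prog) Q = wp drop_prog (wp push_prog Q)" for Q by (intro ext) simp
      ultimately show ?thesis using False s by (simp add: u1)
    qed
  qed
qed

end

section \<open>Building the adjacency structure\<close>

definition append_prog :: "nexp \<Rightarrow> prog" where
  "append_prog x = seq [SetNArr ''u'' (NVar ''i'') x, SetNArr ''e'' (NVar ''i'') (NVar ''e''),
     SetNArr ''v'' (NVar ''i'') (NVar ''v''), SetNVar ''i'' (NAdd (NVar ''i'') (NConst 1))]"

text \<open>Directedness is a constant of the program and not part of the input: the embedded 0 or 1
  decides the second test.\<close>

definition add_step :: "bool \<Rightarrow> prog" where
  "add_step directed = seq [
     Cond (NEq (NArr ''head'' (NVar ''e'')) (NVar ''v'')) (append_prog (NArr ''tail'' (NVar ''e''))) Skip,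
     Cond (TAnd (NLess (NConst 0) (NConst (of_bool (\<not> directed)))) (NEq (NArr ''tail'' (NVar ''e'')) (NVar ''v'')))
       (append_prog (NArr ''head'' (NVar ''e''))) Skip,
     SetNVar ''e'' (NAdd (NVar ''e'') (NConst 1))]"

text \<open>Every node scans the whole edge list. This costs \<open>N * M\<close> steps in total,
  which the time bound allows as \<open>ln N\<close> is bounded away from 0. The row starts
  \<open>v * N\<close> are produced by repeated addition.\<close>

definition row_step :: "bool \<Rightarrow> prog" where
  "row_step directed = seq [
     SetNArr ''w'' (NVar ''v'') (NVar ''o''), SetNVar ''o'' (NAdd (NVar ''o'') (NVar ''N'')),
     SetNArr ''a'' (NVar ''v'') (NVar ''i''), SetNVar ''e'' (NConst 0),
     Loop (NLess (NVar ''e'') (NVar ''M'')) (add_step directed),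
     SetNVar ''v'' (NAdd (NVar ''v'') (NConst 1))]"

text \<open>Started from 1, the sum of the positive weights ends strictly above each of them and so
  serves as a first threshold that excludes no edge.\<close>

definition sum_step :: prog where
  "sum_step = seq [SetRVar ''T'' (RAdd (RVar ''T'') (RArr ''d'' (NVar ''e''))),
     SetNVar ''e'' (NAdd (NVar ''e'') (NConst 1))]"

definition prep_prog :: "bool \<Rightarrow> prog" where
  "prep_prog directed = seq [
     Loop (NLess (NVar ''v'') (NVar ''N'')) (row_step directed),
     SetNArr ''a'' (NVar ''N'') (NVar ''i''),
     SetRVar ''T'' (RConst 1), SetNVar ''e'' (NConst 0),
     Loop (NLess (NVar ''e'') (NVar ''M'')) sum_step,
     SetNVar ''G'' (NConst 1)]"

definition main_prog :: "bool \<Rightarrow> prog" where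
  "main_prog directed = Seq (prep_prog directed) (Loop (NLess (NConst 0) (NVar ''G'')) round_prog)"

lemmas add_defs = add_step_def append_prog_def
lemmas row_defs = row_step_def add_defs

definition links_into :: "bool \<Rightarrow> (nat \<Rightarrow> nat) \<Rightarrow> (nat \<Rightarrow> nat) \<Rightarrow> nat \<Rightarrow> nat \<Rightarrow> (nat \<times> nat) set" where
  "links_into directed ta he m v =
     {(e, u). e < m \<and> (he e = v \<and> u = ta e \<or> \<not> directed \<and> ta e = v \<and> u = he e)}"

text \<open>\<open>\<s>0\<close> is the store when the segment of \<open>v\<close> is begun.
  Contents are described as a set, since the search does not depend on the order of the arcs in a
  segment.\<close>

definition segment :: "store \<Rightarrow> nat \<Rightarrow> (nat \<times> nat) set \<Rightarrow> store \<Rightarrow> bool" where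
  "segment \<s>0 v S \<s> \<longleftrightarrow> (let i0 = Vi \<s>0; i = Vi \<s> in i0 \<le> i \<and>
     (\<forall>j<i0. Src \<s> j = Src \<s>0 j \<and> Lab \<s> j = Lab \<s>0 j \<and>
       Dst \<s> j = Dst \<s>0 j) \<and>
     (\<forall>j. i0 \<le> j \<and> j < i \<longrightarrow> Dst \<s> j = v) \<and>
     (\<lambda>j. (Lab \<s> j, Src \<s> j)) ` {i0..<i} = S)"

lemma wp_append:
  assumes "segment \<s>0 (Vv \<s>) S \<s>"
  shows "wp (append_prog x) (\<lambda>\<s>' \<tau>'.
    segment \<s>0 (Vv \<s>) (insert (Ve \<s>, nval x \<s>) S) \<s>' \<and>
    Vi \<s>' = Suc (Vi \<s>) \<and> \<tau>' = \<tau> + 4) \<s> \<tau>"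
proof -
  let ?i = "Vi \<s>" and ?b = "Vi \<s>0"
  let ?Q = "\<lambda>(\<s>' :: store) \<tau>'. Src \<s>' = (Src \<s>)(?i := nval x \<s>) \<and>
    Lab \<s>' = (Lab \<s>)(?i := Ve \<s>) \<and>
    Dst \<s>' = (Dst \<s>)(?i := Vv \<s>) \<and>
    Vi \<s>' = Suc ?i \<and> \<tau>' = \<tau> + 4"
  have "wp (append_prog x) ?Q \<s> \<tau>" by (simp add: append_prog_def)
  then show ?thesis
  proof (rule wp_mono)
    fix \<s>' \<tau>' assume Q: "?Q \<s>' \<tau>'"
    have i: "?b \<le> ?i" using assms by (simp add: segment_def Let_def)
    then have iv: "{?b..<Suc ?i} = insert ?i {?b..<?i}" by auto
    have "(\<lambda>j. (Lab \<s>' j, Src \<s>' j)) ` {?b..<?i} =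
        (\<lambda>j. (Lab \<s> j, Src \<s> j)) ` {?b..<?i}"
      by (rule image_cong) (use Q in auto)
    then show "segment \<s>0 (Vv \<s>) (insert (Ve \<s>, nval x \<s>) S) \<s>' \<and>
      Vi \<s>' = Suc (Vi \<s>) \<and> \<tau>' = \<tau> + 4"
      using Q assms i by (simp add: segment_def Let_def less_Suc_eq iv del: set_upt)
  qed
qed

lemma links_into_Suc:
  "links_into directed ta he (Suc m) v =
     (let S = links_into directed ta he m v; S' = (if he m = v then insert (m, ta m) S else S)
      in if \<not> directed \<and> ta m = v then insert (m, he m) S' else S')"
  by (auto simp: links_into_def Let_def less_Suc_eq)

text \<open>One upper bound for both kinds of graphs: heads and tails are counted even in the
  directed case, where only heads produce arcs. Its sum is at most \<open>2 * M\<close> either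
  way.\<close>

definition degree_upto :: "(nat \<Rightarrow> nat) \<Rightarrow> (nat \<Rightarrow> nat) \<Rightarrow> nat \<Rightarrow> nat \<Rightarrow> nat" where
  "degree_upto ta he m v = card {e. e < m \<and> he e = v} + card {e. e < m \<and> ta e = v}"

lemma degree_upto_Suc:
  "degree_upto ta he (Suc m) v = degree_upto ta he m v + of_bool (he m = v) + of_bool (ta m = v)"
proof -
  have "{e. e < Suc m \<and> f e = v} = (if f m = v then insert m {e. e < m \<and> f e = v} else {e. e < m \<and> f e = v})" for f :: "nat \<Rightarrow> nat"
    by (auto simp: less_Suc_eq)
  then show ?thesis by (simp add: degree_upto_def)
qed

lemma sum_degree_upto: "(\<Sum>v<N. degree_upto ta he M v) \<le> 2 * M"
proof -
  have "(\<Sum>v<N. card {e. e < M \<and> f e = v}) \<le> M" for f :: "nat \<Rightarrow> nat"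
  proof -
    have "(\<Sum>v<N. card {e. e < M \<and> f e = v}) = card (\<Union>v<N. {e. e < M \<and> f e = v})"
      by (subst card_UN_disjoint) auto
    also have "\<dots> \<le> card {..<M}" by (intro card_mono) auto
    finally show ?thesis by simp
  qed
  from this[of he] this[of ta] show ?thesis by (simp add: degree_upto_def sum.distrib)
qed

lemma wp_add:
  assumes seg: "segment \<s>0 v (links_into directed ta he (Ve \<s>) v) \<s>" and v: "Vv \<s> = v"
    and g: "Tail \<s> = ta" "Head \<s> = he"
    and i: "Vi \<s> \<le> b + degree_upto ta he (Ve \<s>) v"
  shows "wp (add_step directed) (\<lambda>\<s>' \<tau>'. Ve \<s>' = Suc (Ve \<s>) \<and>
    segment \<s>0 v (links_into directed ta he (Suc (Ve \<s>)) v) \<s>' \<and>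
    Vi \<s>' \<le> b + degree_upto ta he (Suc (Ve \<s>)) v \<and> \<tau>' \<le> \<tau> + 11) \<s> \<tau>"
    (is "wp _ ?P _ _")
proof -
  let ?e = "Ve \<s>" and ?S = "links_into directed ta he (Ve \<s>) v"
  define S1 where "S1 = (if he ?e = v then insert (?e, ta ?e) ?S else ?S)"
  define S2 where "S2 = (if \<not> directed \<and> ta ?e = v then insert (?e, he ?e) S1 else S1)"
  have S2: "links_into directed ta he (Suc ?e) v = S2"
    by (simp add: links_into_Suc S1_def S2_def Let_def)
  let ?c2 = "Cond (TAnd (NLess (NConst 0) (NConst (of_bool (\<not> directed)))) (NEq (NArr ''tail'' (NVar ''e'')) (NVar ''v'')))
       (append_prog (NArr ''head'' (NVar ''e''))) Skip"
  let ?c3 = "SetNVar ''e'' (NAdd (NVar ''e'') (NConst 1))"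
  let ?b1 = "of_bool (he ?e = v) :: nat" and ?b2 = "of_bool (ta ?e = v) :: nat"
  have snd: "wp ?c2 (wp ?c3 ?P) \<s>1 \<tau>1"
    if "segment \<s>0 v S1 \<s>1" "Vi \<s>1 \<le> Vi \<s> + ?b1" "\<tau>1 \<le> \<tau> + 5"
      and u1: "Ve \<s>1 = ?e" "Vv \<s>1 = v" "Tail \<s>1 = ta" "Head \<s>1 = he"
    for \<s>1 \<tau>1
  proof -
    have last: "wp ?c3 ?P \<s>2 \<tau>2"
      if "segment \<s>0 v S2 \<s>2" "Vi \<s>2 \<le> Vi \<s> + ?b1 + ?b2" "\<tau>2 \<le> \<tau> + 10"
        "Ve \<s>2 = ?e" for \<s>2 \<tau>2
      using that i S2 by (simp add: degree_upto_Suc segment_def)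
    show ?thesis
    proof (cases "\<not> directed \<and> ta ?e = v")
      case False
      then show ?thesis using last[of \<s>1 "Suc (Suc \<tau>1)"] that u1 by (auto simp: S2_def)
    next
      case True
      have "wp (append_prog (NArr ''head'' (NVar ''e''))) (wp ?c3 ?P) \<s>1 (Suc \<tau>1)"
      proof (rule wp_frame[OF wp_append[of \<s>0 \<s>1 S1]], goal_cases)
        show "segment \<s>0 (Vv \<s>1) S1 \<s>1" using that by simp
      next
        case (2 \<s>2 \<tau>2)
        note a = 2(1) and u = unchangedD[OF 2(2), unfolded append_prog_def, simplified]
        show "wp ?c3 ?P \<s>2 \<tau>2" by (rule last) (use a that True u u1 in \<open>simp_all add: S2_def\<close>)
      qed
      then show ?thesis using True u1 by simp
    qed
  qed
  show ?thesis
  proof (cases "he ?e = v")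
    case False
    then have "wp ?c2 (wp ?c3 ?P) \<s> (Suc (Suc \<tau>))"
      using seg v g by (intro snd) (simp_all add: S1_def)
    then show ?thesis using False v g unfolding add_step_def seq.simps wp_Seq wp_Cond by simp
  next
    case True
    have "wp (append_prog (NArr ''tail'' (NVar ''e''))) (wp ?c2 (wp ?c3 ?P)) \<s> (Suc \<tau>)"
    proof (rule wp_frame[OF wp_append[of \<s>0 \<s> ?S]], goal_cases)
      show "segment \<s>0 (Vv \<s>) ?S \<s>" using seg v by simp
    next
      case (2 \<s>2 \<tau>2)
      note a = 2(1) and u = unchangedD[OF 2(2), unfolded append_prog_def, simplified]
      show "wp ?c2 (wp ?c3 ?P) \<s>2 \<tau>2" by (rule snd) (use a True u v g in \<open>simp_all add: S1_def\<close>)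
    qed
    moreover have "wp (Seq ?c2 ?c3) Q = wp ?c2 (wp ?c3 Q)" for Q by (intro ext) (simp only: wp_Seq)
    ultimately show ?thesis using True v g unfolding add_step_def seq.simps wp_Seq wp_Cond by simp
  qed
qed

text \<open>In its uses \<open>a\<close> is the offset array with the current position put in at
  \<open>n\<close>: the program stores the end of a row only when it begins the next one.\<close>

definition rows :: "bool \<Rightarrow> (nat \<Rightarrow> nat) \<Rightarrow> (nat \<Rightarrow> nat) \<Rightarrow> nat \<Rightarrow> nat \<Rightarrow> (nat \<Rightarrow> nat) \<Rightarrow> store \<Rightarrow> bool" where
  "rows directed ta he M n a \<s> \<longleftrightarrow> (\<forall>v<n. a v \<le> a (Suc v) \<and> a (Suc v) \<le> a n \<and>
     (\<forall>j. a v \<le> j \<and> j < a (Suc v) \<longrightarrow> Dst \<s> j = v) \<and>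
     (\<lambda>j. (Lab \<s> j, Src \<s> j)) ` {a v..<a (Suc v)} = links_into directed ta he M v \<and>
     a (Suc v) \<le> a v + degree_upto ta he M v)"

lemma rows_Suc:
  assumes r: "rows directed ta he M n a \<s>" and i0: "Vi \<s>0 = a n"
    and eq: "Src \<s>0 = Src \<s>" "Lab \<s>0 = Lab \<s>" "Dst \<s>0 = Dst \<s>"
    and seg: "segment \<s>0 n (links_into directed ta he M n) \<s>'"
    and i: "Vi \<s>' \<le> a n + degree_upto ta he M n"
  shows "rows directed ta he M (Suc n) (a(Suc n := Vi \<s>')) \<s>'"
  unfolding rows_def
proof (intro allI impI)
  fix v assume v: "v < Suc n"
  let ?a = "a(Suc n := Vi \<s>')"
  have le: "a n \<le> Vi \<s>'" using seg i0 by (simp add: segment_def Let_def)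
  show "?a v \<le> ?a (Suc v) \<and> ?a (Suc v) \<le> ?a (Suc n) \<and>
     (\<forall>j. ?a v \<le> j \<and> j < ?a (Suc v) \<longrightarrow> Dst \<s>' j = v) \<and>
     (\<lambda>j. (Lab \<s>' j, Src \<s>' j)) ` {?a v..<?a (Suc v)} = links_into directed ta he M v \<and>
     ?a (Suc v) \<le> ?a v + degree_upto ta he M v"
  proof (cases "v = n")
    case True
    then show ?thesis using seg i0 i by (simp add: segment_def Let_def)
  next
    case False
    then have vn: "v < n" using v by simp
    then have a: "?a v = a v" "?a (Suc v) = a (Suc v)" by auto
    have o: "a (Suc v) \<le> a n" using r vn by (simp add: rows_def)
    have same: "Src \<s>' j = Src \<s> j" "Lab \<s>' j = Lab \<s> j"
      "Dst \<s>' j = Dst \<s> j" if "j < a (Suc v)" for j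
      using seg that o eq i0 by (auto simp: segment_def Let_def)
    have "(\<lambda>j. (Lab \<s>' j, Src \<s>' j)) ` {a v..<a (Suc v)} =
        (\<lambda>j. (Lab \<s> j, Src \<s> j)) ` {a v..<a (Suc v)}"
      by (rule image_cong) (use same in auto)
    then show ?thesis using r vn order_trans[OF o le] same unfolding rows_def a by simp
  qed
qed

lemma wp_row:
  assumes r: "rows directed ta he M n ((Off \<s>)(n := Vi \<s>)) \<s>"
    and n: "Vv \<s> = n" "VM \<s> = M" "VN \<s> = N"
    and g: "Tail \<s> = ta" "Head \<s> = he"
    and w: "Vo \<s> = n * N" "\<forall>x<n. Row \<s> x = x * N"
  shows "wp (row_step directed) (\<lambda>\<s>' \<tau>'. Vv \<s>' = Suc n \<and>
     rows directed ta he M (Suc n) ((Off \<s>')(Suc n := Vi \<s>')) \<s>' \<and>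
     Vo \<s>' = Suc n * N \<and> (\<forall>x<Suc n. Row \<s>' x = x * N) \<and> \<tau>' \<le> \<tau> + 12 * M + 6) \<s> \<tau>"
    (is "wp _ ?P _ _")
proof -
  let ?a = "(Off \<s>)(n := Vi \<s>)"
  define \<s>0 where "\<s>0 = \<s>\<lparr>nat_arr := (nat_arr \<s>)(''w'' := (Row \<s>)(n := n * N), ''a'' := ?a),
    nat_var := (nat_var \<s>)(''o'' := n * N + N, ''e'' := 0)\<rparr>"
  let ?I = "\<lambda>\<s>' \<tau>'. segment \<s>0 n (links_into directed ta he (Ve \<s>') n) \<s>' \<and> Ve \<s>' \<le> M \<and>
    Vi \<s>' \<le> ?a n + degree_upto ta he (Ve \<s>') n \<and> \<tau>' \<le> \<tau> + 4 + 12 * Ve \<s>'"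
  have "wp (Loop (NLess (NVar ''e'') (NVar ''M'')) (add_step directed))
      (wp (SetNVar ''v'' (NAdd (NVar ''v'') (NConst 1))) ?P) \<s>0 (\<tau> + 4)"
  proof (rule wp_Loop_frame[where I = ?I and K = "\<tau> + 4 + 12 * M"], goal_cases)
    case 1
    then show ?case by (simp add: \<s>0_def segment_def links_into_def)
  next
    case (3 \<s>' \<tau>')
    note u = unchangedD[OF 3(2), unfolded add_defs, simplified]
    show ?case
      by (rule wp_mono[OF wp_add[of \<s>0 n directed ta he \<s>' "?a n"]])
        (use 3 n g in \<open>auto simp: u \<s>0_def\<close>)
  next
    case (4 \<s>' \<tau>')
    note u = unchangedD[OF 4(2), unfolded add_defs, simplified]
    have e: "Ve \<s>' = M" using 4 n by (simp add: u \<s>0_def)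
    have "rows directed ta he M (Suc n) (?a(Suc n := Vi \<s>')) \<s>'"
      using 4(1) unfolding e by (intro rows_Suc[OF r, of \<s>0]) (simp_all add: \<s>0_def)
    then have "rows directed ta he M (Suc n) (?a(Suc n := Vi \<s>')) (\<s>'\<lparr>nat_var := (nat_var \<s>')(''v'' := Suc n)\<rparr>)"
      by (simp add: rows_def)
    then show ?case using 4(1) e w n by (simp add: u \<s>0_def less_Suc_eq)
  qed auto
  then show ?thesis using n w by (simp add: row_step_def \<s>0_def eval_nat_numeral)
qed

lemma wp_prep:
  fixes G :: "(nat, nat) pre_digraph"
  assumes G: "fin_digraph G" "verts G = {..<N}" "arcs G = {..<M}" and st: "s \<in> verts G" "t \<in> verts G" "t \<noteq> s"
    and chat: "\<And>e. e < M \<Longrightarrow> 0 \<le> chat e" and d: "\<And>e. e < M \<Longrightarrow> 0 < d e" and q: "N < 2 ^ q"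
  defines "\<s> \<equiv> input_store G s t chat d"
  shows "wp (prep_prog directed) (\<lambda>\<s>' \<tau>'. \<exists>off src lab dst.
     search_problem N M off src lab dst (Chat \<s>) (Weight \<s>) s t directed G q \<and>
     csr.graph_store N off src lab dst (Chat \<s>) (Weight \<s>) t (RT \<s>') \<s>' \<and>
     Vs \<s>' = s \<and> (\<forall>n. Bucket \<s>' n = 0) \<and> Vk \<s>' = 0 \<and> VG \<s>' = 1 \<and>
     (\<forall>e<M. d e < RT \<s>') \<and> \<tau>' \<le> \<tau> + N * (12 * M + 7) + 3 * M + 6) \<s> \<tau>"
    (is "wp _ ?P _ _")
proof -
  interpret G: fin_digraph G by (rule G(1))
  define ta where "ta = Tail \<s>"
  define he where "he = Head \<s>"
  have th: "ta e = tail G e" "he e = head G e" if "e < M" for e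
    using that G(3) by (simp_all add: ta_def he_def \<s>_def input_store_def)
  have thN: "ta e < N" "he e < N" if "e < M" for e
    using that G.tail_in_verts[of e] G.head_in_verts[of e] G(2,3) by (simp_all add: th)
  have s0: "VN \<s> = N" "VM \<s> = M" "Vs \<s> = s" "Vt \<s> = t"
    "Vv \<s> = 0" "Vi \<s> = 0" "Vo \<s> = 0" "Vk \<s> = 0"
    "\<And>n. Bucket \<s> n = 0" "\<And>e. e < M \<Longrightarrow> Chat \<s> e = chat e" "\<And>e. e < M \<Longrightarrow> Weight \<s> e = d e"
    using G by (simp_all add: \<s>_def input_store_def)
  have link: "edge_link directed G e u v \<longleftrightarrow> (e, u) \<in> links_into directed ta he M v" for e u v
    using G(3) th[of e] by (cases "e < M") (auto simp: edge_link_def arc_link_def links_into_def)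
  let ?I = "\<lambda>\<s>' \<tau>'. let n = Vv \<s>' in n \<le> N \<and>
     rows directed ta he M n ((Off \<s>')(n := Vi \<s>')) \<s>' \<and>
     Vo \<s>' = n * N \<and> (\<forall>x<n. Row \<s>' x = x * N) \<and> \<tau>' \<le> \<tau> + n * (12 * M + 7)"
  show ?thesis
    unfolding prep_prog_def seq.simps wp_Seq
  proof (rule wp_Loop_frame[where I = ?I and K = "\<tau> + N * (12 * M + 7)"], goal_cases)
    case 1
    then show ?case by (simp add: s0 rows_def)
  next
    case (2 \<s>' \<tau>')
    then have "Vv \<s>' * (12 * M + 7) \<le> N * (12 * M + 7)" by (intro mult_le_mono1) (simp add: Let_def)
    then show ?case using 2 unfolding Let_def by linarith
  next
    case (3 \<s>' \<tau>')
    note u = unchangedD[OF 3(2), unfolded row_defs, simplified]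
    show ?case
      by (rule wp_mono[OF wp_row[of directed ta he M "Vv \<s>'" \<s>' N]])
        (use 3 in \<open>auto simp: u s0 ta_def he_def Let_def\<close>)
  next
    case (4 \<s>1 \<tau>1)
    note u1 = unchangedD[OF 4(2), unfolded row_defs, simplified]
    have v: "Vv \<s>1 = N" using 4(1,3) by (simp add: u1 s0 Let_def)
    define off where "off = (Off \<s>1)(N := Vi \<s>1)"
    define \<s>2 where "\<s>2 = \<s>1\<lparr>nat_arr := (nat_arr \<s>1)(''a'' := off), real_var := (real_var \<s>1)(''T'' := 1),
      nat_var := (nat_var \<s>1)(''e'' := 0)\<rparr>"
    let ?src = "Src \<s>1" and ?lab = "Lab \<s>1" and ?dst = "Dst \<s>1"
    have rows: "rows directed ta he M N off \<s>1" and w: "\<forall>x<N. Row \<s>1 x = x * N"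
      and \<tau>1: "\<tau>1 \<le> \<tau> + N * (12 * M + 7)" using 4(1) v by (simp_all add: Let_def off_def)
    have row: "off v \<le> off (Suc v)" "\<And>j. off v \<le> j \<Longrightarrow> j < off (Suc v) \<Longrightarrow> ?dst j = v"
      "(\<lambda>j. (?lab j, ?src j)) ` {off v..<off (Suc v)} = links_into directed ta he M v"
      "off (Suc v) \<le> off v + degree_upto ta he M v" if "v < N" for v
      using rows that by (auto simp: rows_def)
    have mem: "(?lab j, ?src j) \<in> links_into directed ta he M v" if "v < N" "off v \<le> j" "j < off (Suc v)" for v j
      using row(3)[OF that(1)] that(2,3) by (metis (no_types, lifting) atLeastLessThan_iff image_eqI)
    have csr: "csr N off ?src ?lab ?dst (Chat \<s>) t"
    proof
      show "t < N" using st G by simp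
      show "off v \<le> off (Suc v)" if "v < N" for v using row(1)[OF that] .
      show "?src i < N \<and> ?dst i = v \<and> 0 \<le> Chat \<s> (?lab i)" if "v < N" "off v \<le> i" "i < off (Suc v)" for v i
        using mem[OF that] row(2)[OF that] thN chat s0(10) by (auto simp: links_into_def)
    qed
    have sp: "search_problem N M off ?src ?lab ?dst (Chat \<s>) (Weight \<s>) s t directed G q"
    proof (rule search_problem.intro, goal_cases)
      case 1 show ?case by (rule csr)
    next
      case (2 e u v)
      show ?case
      proof
        assume "edge_link directed G e u v"
        then have l: "(e, u) \<in> links_into directed ta he M v" by (simp add: link)
        then have vN: "v < N" using thN by (auto simp: links_into_def)
        with l row(3)[OF vN] have "(e, u) \<in> (\<lambda>j. (?lab j, ?src j)) ` {off v..<off (Suc v)}" by simp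
        then show "v < N \<and> (\<exists>i\<ge>off v. i < off (Suc v) \<and> ?lab i = e \<and> ?src i = u)" using vN by auto
      next
        assume "v < N \<and> (\<exists>i\<ge>off v. i < off (Suc v) \<and> ?lab i = e \<and> ?src i = u)"
        then show "edge_link directed G e u v" using mem link by blast
      qed
    next
      case 8
      have "(\<Sum>v<N. off (Suc v) - off v) \<le> (\<Sum>v<N. degree_upto ta he M v)"
        by (rule sum_mono) (use row(4) in \<open>simp add: le_diff_conv add.commute\<close>)
      also have "\<dots> \<le> 2 * M" by (rule sum_degree_upto)
      finally show ?case .
    qed (use G st d q s0(11) in auto)
    let ?J = "\<lambda>(\<s>' :: store) \<tau>'. Ve \<s>' \<le> M \<and> 1 \<le> RT \<s>' \<and>
      (\<forall>e<Ve \<s>'. d e < RT \<s>') \<and> \<tau>' \<le> \<tau>1 + 4 + 3 * Ve \<s>'"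
    have "wp (Loop (NLess (NVar ''e'') (NVar ''M'')) sum_step) (wp (SetNVar ''G'' (NConst 1)) ?P) \<s>2 (\<tau>1 + 4)"
    proof (rule wp_Loop_frame[where I = ?J and K = "\<tau>1 + 4 + 3 * M"], goal_cases)
      case 1
      then show ?case by (simp add: \<s>2_def)
    next
      case (3 \<s>' \<tau>')
      note u = unchangedD[OF 3(2), unfolded sum_step_def, simplified]
      have e: "Ve \<s>' < M" using 3(3) by (simp add: u \<s>2_def u1 s0)
      then have "Weight \<s>' (Ve \<s>') = d (Ve \<s>')" by (simp add: u \<s>2_def u1 s0)
      then show ?case using 3(1) e d[OF e] by (force simp: sum_step_def less_Suc_eq)
    next
      case (4 \<s>' \<tau>')
      note u = unchangedD[OF 4(2), unfolded sum_step_def, simplified]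
      have e: "Ve \<s>' = M" using 4(1,3) by (simp add: u \<s>2_def u1 s0)
      let ?\<s>3 = "\<s>'\<lparr>nat_var := (nat_var \<s>')(''G'' := 1)\<rparr>"
      have "csr.graph_store N off ?src ?lab ?dst (Chat \<s>) (Weight \<s>) t (RT ?\<s>3) ?\<s>3"
        using w by (simp add: csr.graph_store_def[OF csr] u \<s>2_def u1 s0)
      moreover have "Bucket ?\<s>3 n = 0" for n by (simp add: u \<s>2_def u1 s0)
      ultimately have "?P ?\<s>3 (Suc (Suc \<tau>'))"
        using sp 4(1) e \<tau>1 by (intro exI[of _ off] exI[of _ ?src] exI[of _ ?lab] exI[of _ ?dst]) (simp add: u \<s>2_def u1 s0)
      then show ?case by simp
    qed auto
    moreover have "VN \<s>1 = N" by (simp add: u1 s0)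
    ultimately show ?case by (simp add: \<s>2_def off_def eval_nat_numeral)
  qed
qed

section \<open>Number of rounds, optimality and total time\<close>

context search_problem begin

lemma wp_rounds:
  assumes inv: "round_inv \<s>" and G1: "VG \<s> = 1"
  shows "wp (Loop (NLess (NConst 0) (NVar ''G'')) round_prog) (\<lambda>\<s>' \<tau>'. round_inv \<s>' \<and>
     (\<forall>P\<in>paths. RT \<s>' \<le> path_weight d P) \<and> \<tau>' \<le> \<tau> + (round_time + 1) * (M + 1) + 1) \<s> \<tau>"
proof -
  \<comment> \<open>The measure is the number of edges below the threshold plus the flag. A
    successful round loses at least the edge whose weight becomes the threshold; the final one loses
    the flag.\<close>
  let ?c = "\<lambda>(\<s>' :: store). card {e. e < M \<and> d e < RT \<s>'}"
  let ?I = "\<lambda>\<s>' \<tau>'. round_inv \<s>' \<and> VG \<s>' \<le> 1 \<and>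
     (VG \<s>' = 0 \<longrightarrow> (\<forall>P\<in>paths. RT \<s>' \<le> path_weight d P)) \<and>
     \<tau>' + (round_time + 1) * (?c \<s>' + VG \<s>') \<le> \<tau> + (round_time + 1) * (M + 1)"
  show ?thesis
  proof (rule wp_Loop[where I = ?I and K = "\<tau> + (round_time + 1) * (M + 1)"], goal_cases)
    case 1
    have "?c \<s> \<le> card {..<M}" by (rule card_mono) auto
    then have "(round_time + 1) * (?c \<s> + VG \<s>) \<le> (round_time + 1) * (M + 1)"
      using G1 by (intro mult_le_mono2) simp
    then show ?case using inv G1 by simp
  next
    case (2 \<s>' \<tau>')
    then show ?case by linarith
  next
    case (3 \<s>1 \<tau>1)
    then have inv1: "round_inv \<s>1" and g: "VG \<s>1 = 1" by auto
    have b: "\<tau>1 + (round_time + 1) * (?c \<s>1 + 1) \<le> \<tau> + (round_time + 1) * (M + 1)" using 3(1) g by simp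
    show ?case
    proof (rule wp_mono[OF wp_round[OF inv1]])
      fix \<s>2 \<tau>2
      assume r: "round_inv \<s>2 \<and> \<tau>2 \<le> Suc \<tau>1 + round_time \<and>
        (VG \<s>2 = VG \<s>1 \<and> RT \<s>2 < RT \<s>1 \<and> RT \<s>2 \<in> d ` {..<M} \<or>
         VG \<s>2 = 0 \<and> RT \<s>2 = RT \<s>1 \<and> (\<forall>P\<in>paths. RT \<s>1 \<le> path_weight d P))"
      have "?c \<s>2 + VG \<s>2 \<le> ?c \<s>1"
      proof (cases "VG \<s>2 = 0")
        case True
        then have "RT \<s>2 = RT \<s>1" using r g by auto
        then show ?thesis using True by simp
      next
        case False
        then have T: "RT \<s>2 < RT \<s>1" "RT \<s>2 \<in> d ` {..<M}" "VG \<s>2 = 1"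
          using r g by auto
        then obtain e where e: "e < M" "RT \<s>2 = d e" by blast
        have "{e'. e' < M \<and> d e' < d e} \<subset> {e'. e' < M \<and> d e' < RT \<s>1}"
        proof
          show "{e'. e' < M \<and> d e' < d e} \<subseteq> {e'. e' < M \<and> d e' < RT \<s>1}"
            using T(1) e(2) by auto
          have "e \<in> {e'. e' < M \<and> d e' < RT \<s>1}" "e \<notin> {e'. e' < M \<and> d e' < d e}"
            using T(1) e by auto
          then show "{e'. e' < M \<and> d e' < d e} \<noteq> {e'. e' < M \<and> d e' < RT \<s>1}" by metis
        qed
        then have "{e. e < M \<and> d e < RT \<s>2} \<subset> {e. e < M \<and> d e < RT \<s>1}"
          unfolding e(2) .
        then have "?c \<s>2 < ?c \<s>1" by (intro psubset_card_mono) auto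
        then show ?thesis using T(3) by simp
      qed
      then have "(round_time + 1) * (?c \<s>2 + VG \<s>2) \<le> (round_time + 1) * ?c \<s>1"
        by (rule mult_le_mono2)
      then show "?I \<s>2 \<tau>2" using r b g by auto
    qed
  next
    case (4 \<s>' \<tau>')
    then show ?case by simp
  qed
qed

text \<open>\<open>chat\<close> and \<open>d\<close> are the arrays in memory, which agree with the
  given functions \<open>chat0\<close> and \<open>d0\<close> on edges only. Optimality at every size
  comes from coverage, minimality from \<open>envelope_card_le\<close>.\<close>

lemma outputs_solve:
  assumes inv: "round_inv \<s>" and all: "\<forall>P\<in>paths. RT \<s> \<le> path_weight d P"
    and agree: "\<And>e. e < M \<Longrightarrow> chat0 e = chat e" "\<And>e. e < M \<Longrightarrow> d0 e = d e" and ne: "paths \<noteq> {}"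
  shows "solves_variable_sized paths (manhattan_ball (arcs G) d0) chat0 (output_set \<s>)"
    and "card (output_set \<s>) \<le> M"
proof -
  let ?k = "Vk \<s>" and ?c = "Cost \<s>" and ?m = "Slope \<s>"
  let ?B = "manhattan_ball (arcs G) d0"
  have ok: "outputs_ok paths chat d ?k \<s>" and cov: "covered ?k \<s> paths"
    using inv all by (auto simp: round_inv_def covered_def)
  have env: "envelope ?c ?m (Break \<s>) ?k"
    and out: "\<And>i. i < ?k \<Longrightarrow> output_path \<s> i \<in> paths \<and> path_cost chat (output_path \<s> i) = ?c i \<and>
      path_weight d (output_path \<s> i) = ?m i"
    using ok by (auto simp: outputs_ok_def)
  have cost: "robust_cost ?B chat0 l P = path_cost chat P + l * path_weight d P" if "P \<in> paths" "0 \<le> l" for P l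
  proof -
    note e = path_edges[OF that(1)]
    have "path_cost chat0 P = path_cost chat P" "path_weight d0 P = path_weight d P"
      using e(2) agree by (auto simp: path_cost_def path_weight_def intro!: sum.cong arg_cong[of _ _ Max] image_cong)
    moreover have "robust_cost ?B chat0 l P = path_cost chat0 P + l * path_weight d0 P"
      using G e that agree d by (intro robust_cost_manhattan) auto
    ultimately show ?thesis by simp
  qed
  have opt: "robust_optimal paths ?B chat0 l P \<longleftrightarrow> P \<in> paths \<and>
      (\<forall>Q\<in>paths. path_cost chat P + l * path_weight d P \<le> path_cost chat Q + l * path_weight d Q)" if "0 \<le> l" for l P
    using cost[OF _ that] by (auto simp: robust_optimal_def is_arg_min_def not_less)
  have fin: "finite paths" using G by (intro finite_st_paths) simp
  have sub: "output_set \<s> \<subseteq> paths" using out by (auto simp: output_set_def)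
  have "\<exists>P\<in>output_set \<s>. robust_optimal paths ?B chat0 l P" if l: "0 \<le> l" for l
  proof -
    obtain P0 where "P0 \<in> paths" using ne by blast
    then have "{..<?k} \<noteq> {}" using cov l by (force simp: covered_def)
    then obtain i where i: "i < ?k" "\<And>j. j < ?k \<Longrightarrow> ?c i + l * ?m i \<le> ?c j + l * ?m j"
      using ex_is_arg_min_if_finite[of "{..<?k}" "\<lambda>i. ?c i + l * ?m i"] by (auto simp: is_arg_min_linorder)
    have "path_cost chat (output_path \<s> i) + l * path_weight d (output_path \<s> i) \<le> path_cost chat Q + l * path_weight d Q"
      if Q: "Q \<in> paths" for Q
    proof -
      obtain j where "j < ?k" "?c j + l * ?m j \<le> path_cost chat Q + l * path_weight d Q"
        using cov Q l by (auto simp: covered_def)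
      then show ?thesis using i(2)[of j] out[OF i(1)] by simp
    qed
    then show ?thesis using i(1) out[OF i(1)] opt[OF l] by (auto simp: output_set_def)
  qed
  then have covers: "covers_all_sizes paths ?B chat0 (output_set \<s>)"
    using sub by (simp add: covers_all_sizes_def)
  have le: "card (output_set \<s>) \<le> ?k" unfolding output_set_def using card_image_le[of "{..<?k}"] by force
  then show "card (output_set \<s>) \<le> M" using outputs_count[OF ok] by simp
  have "?k \<le> card S" if S: "covers_all_sizes paths ?B chat0 S" for S
  proof (rule envelope_card_le[OF env])
    show "\<And>P l. P \<in> paths \<Longrightarrow> 0 \<le> l \<Longrightarrow> \<exists>i<?k. ?c i + l * ?m i \<le> path_cost chat P + l * path_weight d P"
      using cov by (auto simp: covered_def)
    show "\<And>i. i < ?k \<Longrightarrow> \<exists>P\<in>paths. path_cost chat P = ?c i \<and> path_weight d P = ?m i" using out by blast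
    show "finite S" "S \<subseteq> paths" using S fin finite_subset by (auto simp: covers_all_sizes_def)
    show "\<And>l. 0 \<le> l \<Longrightarrow> \<exists>P\<in>S. \<forall>Q\<in>paths. path_cost chat P + l * path_weight d P \<le> path_cost chat Q + l * path_weight d Q"
      using S opt unfolding covers_all_sizes_def by blast
  qed
  then show "solves_variable_sized paths ?B chat0 (output_set \<s>)"
    using covers le unfolding solves_variable_sized_def is_arg_min_def by (meson le_trans not_le)
qed

end

text \<open>Terms in \<open>N\<close> alone are absorbed by \<open>N * M\<close>, terms in
  \<open>M\<close> by \<open>M * M\<close>, and additive constants next to \<open>q\<close> by the
  logarithm, as \<open>ln N\<close> is at least 1/2.\<close>

lemma time_bound:
  fixes N M q T :: nat
  assumes N: "2 \<le> N" and M: "1 \<le> M" and q: "2 ^ q \<le> N"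
    and T: "T \<le> N * (12 * M + 7) + 3 * M + 7 + (526 * M + N * (309 * Suc q + 46) + 121) * (M + 1)"
  shows "real T \<le> 3000 * ((real M)\<^sup>2 + real N * real M * ln (real N))"
proof -
  have "(526 * M + N * (309 * Suc q + 46) + 121) * (M + 1) \<le> (526 * M + N * (309 * Suc q + 46) + 121) * (2 * M)"
    using M by (intro mult_le_mono2) simp
  also have "\<dots> = 1052 * (M * M) + N * M * (618 * q + 710) + 242 * M" by (simp add: algebra_simps)
  finally have "T \<le> 12 * (N * M) + 7 * N + 3 * M + 7 + (1052 * (M * M) + N * M * (618 * q + 710) + 242 * M)"
    using T by (simp add: algebra_simps)
  moreover have "N \<le> N * M" "M \<le> M * M" using M by simp_all
  moreover have "N * M * (618 * q + 729) = N * M * (618 * q + 710) + 19 * (N * M)" by (simp add: algebra_simps)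
  ultimately have "T \<le> N * M * (618 * q + 729) + 1304 * (M * M)"
    using M by linarith
  then have "real T \<le> real N * real M * (618 * real q + 729) + 1304 * (real M)\<^sup>2"
    unfolding of_nat_le_iff[symmetric, where 'a = real] by (simp add: power2_eq_square algebra_simps)
  also have "\<dots> \<le> real N * real M * (3000 * ln (real N)) + 3000 * (real M)\<^sup>2"
  proof (intro add_mono mult_left_mono)
    have "real (2 ^ q) \<le> real N" using q by (simp only: of_nat_le_iff)
    then have "ln (2 ^ q) \<le> ln (real N)" using N by (subst ln_le_cancel_iff) simp_all
    then have "real q * ln 2 \<le> ln (real N)" by (simp add: ln_realpow)
    moreover have half: "1 / 2 \<le> ln (2 :: real)"
    proof -
      have "exp 1 \<le> (2 :: real) ^ 2" using exp_le by simp
      then have "1 \<le> ln ((2 :: real) ^ 2)" by (subst ln_ge_iff) simp_all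
      then show ?thesis unfolding ln_realpow by simp
    qed
    moreover have "real q * (1 / 2) \<le> real q * ln 2" using half by (intro mult_left_mono) auto
    moreover have "ln 2 \<le> ln (real N)" using N by simp
    \<comment> \<open>Both \<open>q \<le> 2 * ln N\<close> and \<open>1 \<le> 2 * ln N\<close> hold,
      so the left side is at most \<open>2694 * ln N\<close>.\<close>
    ultimately show "618 * real q + 729 \<le> 3000 * ln (real N)" by linarith
  qed auto
  finally show ?thesis by (simp add: algebra_simps)
qed

theorem theorem13:
  fixes directed :: bool
  shows "\<exists>(p :: prog) (C :: real). \<forall>(G :: (nat, nat) pre_digraph) (N :: nat) (M :: nat) (s :: nat) (t :: nat)
      (chat :: nat \<Rightarrow> real) (d :: nat \<Rightarrow> real).
    fin_digraph G \<and> verts G = {..<N} \<and> arcs G = {..<M} \<and>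
    s \<in> verts G \<and> t \<in> verts G \<and> t \<noteq> s \<and> st_paths directed G s t \<noteq> {} \<and>
    (\<forall>e\<in>arcs G. chat e \<ge> 0) \<and> (\<forall>e\<in>arcs G. d e > 0) \<longrightarrow>
    (\<exists>T \<sigma>. exec p (input_store G s t chat d) T \<sigma> \<and>
       real T \<le> C * ((real M)\<^sup>2 + real N * real M * ln (real N)) \<and>
       solves_variable_sized (st_paths directed G s t) (manhattan_ball (arcs G) d) chat (output_set \<sigma>) \<and>
       card (output_set \<sigma>) \<le> M)"
proof (rule exI[of _ "main_prog directed"], rule exI[of _ 3000], intro allI impI)
  fix G :: "(nat, nat) pre_digraph" and N M s t :: nat and chat d :: "nat \<Rightarrow> real"
  assume "fin_digraph G \<and> verts G = {..<N} \<and> arcs G = {..<M} \<and>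
    s \<in> verts G \<and> t \<in> verts G \<and> t \<noteq> s \<and> st_paths directed G s t \<noteq> {} \<and>
    (\<forall>e\<in>arcs G. chat e \<ge> 0) \<and> (\<forall>e\<in>arcs G. d e > 0)"
  then have G: "fin_digraph G" "verts G = {..<N}" "arcs G = {..<M}" and st: "s \<in> verts G" "t \<in> verts G" "t \<noteq> s"
    and ne: "st_paths directed G s t \<noteq> {}" and pos: "\<And>e. e < M \<Longrightarrow> 0 \<le> chat e" "\<And>e. e < M \<Longrightarrow> 0 < d e"
    by auto
  let ?\<s> = "input_store G s t chat d"
  have N: "2 \<le> N" using st G by auto
  \<comment> \<open>The lower bound relates \<open>q0\<close> to \<open>ln N\<close> in the running
    time; the degree bound needs the strict upper one, at \<open>Suc q0\<close>.\<close>
  obtain q0 where q0: "2 ^ q0 \<le> N" "N < 2 ^ (q0 + 1)" using ex_power_ivl1[of 2 N] N by auto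
  have q: "N < 2 ^ Suc q0" using q0(2) by simp
  have agree: "chat e = Chat ?\<s> e" "d e = Weight ?\<s> e" if "e < M" for e
    using that G by (simp_all add: input_store_def)
  have "wp (main_prog directed) (\<lambda>\<s> T. real T \<le> 3000 * ((real M)\<^sup>2 + real N * real M * ln (real N)) \<and>
       solves_variable_sized (st_paths directed G s t) (manhattan_ball (arcs G) d) chat (output_set \<s>) \<and>
       card (output_set \<s>) \<le> M) ?\<s> 0" (is "wp _ ?P _ _")
    unfolding main_prog_def wp_Seq
  proof (rule wp_mono[OF wp_prep[OF G st pos q]])
    fix \<s>1 \<tau>1
    assume "\<exists>off src lab dst.
     search_problem N M off src lab dst (Chat ?\<s>) (Weight ?\<s>) s t directed G (Suc q0) \<and>
     csr.graph_store N off src lab dst (Chat ?\<s>) (Weight ?\<s>) t (RT \<s>1) \<s>1 \<and>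
     Vs \<s>1 = s \<and> (\<forall>n. Bucket \<s>1 n = 0) \<and> Vk \<s>1 = 0 \<and> VG \<s>1 = 1 \<and>
     (\<forall>e<M. d e < RT \<s>1) \<and> \<tau>1 \<le> 0 + N * (12 * M + 7) + 3 * M + 6"
    then obtain off src lab dst where
        sp: "search_problem N M off src lab dst (Chat ?\<s>) (Weight ?\<s>) s t directed G (Suc q0)"
      and gs: "csr.graph_store N off src lab dst (Chat ?\<s>) (Weight ?\<s>) t (RT \<s>1) \<s>1"
      and s1: "Vs \<s>1 = s" "\<forall>n. Bucket \<s>1 n = 0" "Vk \<s>1 = 0" "VG \<s>1 = 1"
      and T: "\<forall>e<M. d e < RT \<s>1" and \<tau>1: "\<tau>1 \<le> 0 + N * (12 * M + 7) + 3 * M + 6" by blast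
    interpret search_problem N M off src lab dst "Chat ?\<s>" "Weight ?\<s>" s t directed G "Suc q0"
      by (rule sp)
    \<comment> \<open>A path between different nodes has an edge; the time bound relies on this to
      absorb terms without a factor \<open>M\<close>.\<close>
    have M: "1 \<le> M"
    proof -
      obtain P where "P \<in> paths" using ne by blast
      from path_edges(1,2)[OF this] show ?thesis by (cases P) auto
    qed
    \<comment> \<open>No path reaches the initial threshold, so the empty stack covers all that is
      required at the start.\<close>
    have "\<not> RT \<s>1 \<le> path_weight (Weight ?\<s>) P" if "P \<in> paths" for P
      using path_edges(3)[OF that] T agree(2) by (auto simp: not_le)
    then have "round_inv \<s>1"
      using gs s1 by (auto simp: round_inv_def outputs_ok_def envelope_def covered_def)
    from wp_rounds[OF this s1(4)]
    show "wp (Loop (NLess (NConst 0) (NVar ''G'')) round_prog) ?P \<s>1 \<tau>1"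
    proof (rule wp_mono)
      fix \<s>2 \<tau>2
      assume r: "round_inv \<s>2 \<and> (\<forall>P\<in>paths. RT \<s>2 \<le> path_weight (Weight ?\<s>) P) \<and>
        \<tau>2 \<le> \<tau>1 + (round_time + 1) * (M + 1) + 1"
      then have "real \<tau>2 \<le> 3000 * ((real M)\<^sup>2 + real N * real M * ln (real N))"
        using \<tau>1 by (intro time_bound[OF N M q0(1)]) (simp add: round_time_def algebra_simps)
      then show "?P \<s>2 \<tau>2"
        using r outputs_solve[of \<s>2, OF _ _ agree ne] by blast
    qed
  qed
  then show "\<exists>T \<s>. exec (main_prog directed) ?\<s> T \<s> \<and>
       real T \<le> 3000 * ((real M)\<^sup>2 + real N * real M * ln (real N)) \<and>
       solves_variable_sized (st_paths directed G s t) (manhattan_ball (arcs G) d) chat (output_set \<s>) \<and>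
       card (output_set \<s>) \<le> M"
    unfolding wp_def by simp
qed

end
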